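(* Let $\varepsilon>0$ and let $\beta,\alpha_o\ge 0$ be fixed constants. Consider the initial value problem on $\mathbb{R}$ for the unknown $f=f(x_1,t)$ \begin{align*} f_{tt}={}&-\Lambda f-\beta\Lambda^3 f+\alpha_o\Lambda f_{tx_1}+\varepsilon\Big[-\mathcal{H}\big((\mathcal{H}f_t)^2\big)+[\![\mathcal{H},f]\!]\Lambda f\Big]_{x_1}\\ &+\varepsilon\Big[-\alpha_o[\![\mathcal{H},f]\!]\Lambda f_{tx_1}+\beta[\![\mathcal{H},f]\!]\Lambda^3 f\Big]_{x_1}, \end{align*} with initial data $f(x_1,0)=f_0(x_1)$ and $f_t(x_1,0)=f_1(x_1)$. Assume that $(f_0,f_1)\in L^1(\mathbb{R})\times L^1(\mathbb{R})$ and that, for some $1<D<+\infty$, $$f_0(x_1)=\frac{1}{\sqrt{2\pi}}\int_{-D}^{D}\hat f_0(k)e^{ikx_1}\,dk,\qquad f_1(x_1)=\frac{1}{\sqrt{2\pi}}\int_{-D}^{D}\hat f_1(k)e^{ikx_1}\,dk.$$ Then there exist $T^*>0$ and a solution $f$ of this initial value problem on $[0,T^*]$ such that $$(f,f_t)\in \Big(L^\infty(0,T^*;\mathbb{A}_1(\mathbb{R}))\times L^\infty(0,T^*;\mathbb{A}_1(\mathbb{R}))\Big)\cap \Big(C(0,T^*;\mathbb{A}_{0.5}(\mathbb{R}))\times C(0,T^*;\mathbb{A}_{0.5}(\mathbb{R}))\Big).$$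
   Context: Subscripts $t$ and $x_1$ denote partial derivatives in time and in the space variable $x_1\in\mathbb{R}$. The Fourier transform is $\hat f(k)=\frac{1}{\sqrt{2\pi}}\int_{\mathbb{R}}f(x_1)e^{-ikx_1}\,dx_1$. The Hilbert transform $\mathcal{H}$ and the operator $\Lambda$ (and its powers $\Lambda^s$) are the Fourier multipliers $\widehat{\mathcal{H}f}(k)=-i\,\mathrm{sgn}(k)\hat f(k)$, $\widehat{\Lambda f}(k)=|k|\hat f(k)$, $\widehat{\Lambda^s f}(k)=|k|^s\hat f(k)$. For an operator $\mathcal{T}$ and functions $f,g$, the commutator is $[\![\mathcal{T},f]\!]g=\mathcal{T}(fg)-f\,\mathcal{T}(g)$. For $\tau\ge 0$ the Wiener space is $$\mathbb{A}_\tau(\mathbb{R})=\Big\{h\in L^1(\mathbb{R}):\ \|h\|_{\mathbb{A}_\tau}=\int_{\mathbb{R}}e^{\tau|n|}|\hat h(n)|\,dn<\infty\Big\}.$$ $L^\infty(0,T^*;X)$ and $C(0,T^*;X)$ denote, respectively, the essentially bounded functions and the continuous functions of time $t\in[0,T^*]$ with values in $X$. The constants are the steepness parameter $\varepsilon$, the odd Reynolds number $\alpha_o$ and the Bond number $\beta$. *)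

theory Defs
  imports "HOL-Analysis.Analysis"
begin

definition fourier_integral :: "(real \<Rightarrow> complex) \<Rightarrow> real \<Rightarrow> complex" where
  "fourier_integral h k =
     complex_of_real (1 / sqrt (2 * pi)) * (LINT x|lborel. h x * exp (- (\<i> * of_real (k * x))))"

definition inv_fourier_integral :: "(real \<Rightarrow> complex) \<Rightarrow> real \<Rightarrow> complex" where
  "inv_fourier_integral g x =
     complex_of_real (1 / sqrt (2 * pi)) * (LINT k|lborel. g k * exp (\<i> * of_real (k * x)))"

text \<open>The Hilbert transform of an integrable function is in general not integrable, so
  operators cannot be iterated with the integral formula alone. The Fourier transform is therefore
  extended, by inversion, to functions that are inverse transforms of integrable functions. Such
  a preimage is unique up to null sets, so the choice below is immaterial wherever the transform
  is used, that is, under an integral.\<close>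

definition fourier :: "(real \<Rightarrow> complex) \<Rightarrow> real \<Rightarrow> complex" where
  "fourier h =
     (if integrable lborel h then fourier_integral h
      else (SOME g. integrable lborel g \<and> h = inv_fourier_integral g))"

definition multiplier :: "(real \<Rightarrow> complex) \<Rightarrow> (real \<Rightarrow> complex) \<Rightarrow> real \<Rightarrow> complex" where
  "multiplier m h = inv_fourier_integral (\<lambda>k. m k * fourier h k)"

definition hilbert :: "(real \<Rightarrow> complex) \<Rightarrow> real \<Rightarrow> complex" where
  "hilbert = multiplier (\<lambda>k. - \<i> * of_real (sgn k))"

definition Lam_pow :: "real \<Rightarrow> (real \<Rightarrow> complex) \<Rightarrow> real \<Rightarrow> complex" where
  "Lam_pow s = multiplier (\<lambda>k. of_real (\<bar>k\<bar> powr s))"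

definition Lam :: "(real \<Rightarrow> complex) \<Rightarrow> real \<Rightarrow> complex" where
  "Lam = multiplier (\<lambda>k. of_real \<bar>k\<bar>)"

definition commutator ::
  "((real \<Rightarrow> complex) \<Rightarrow> real \<Rightarrow> complex) \<Rightarrow> (real \<Rightarrow> complex) \<Rightarrow> (real \<Rightarrow> complex) \<Rightarrow> real \<Rightarrow> complex"
where
  "commutator T f g = (\<lambda>x. T (\<lambda>y. f y * g y) x - f x * T g x)"

definition wiener :: "real \<Rightarrow> (real \<Rightarrow> complex) set" where
  "wiener \<tau> = {h. integrable lborel h \<and>
                  integrable lborel (\<lambda>n. exp (\<tau> * \<bar>n\<bar>) * cmod (fourier h n))}"

definition wiener_norm :: "real \<Rightarrow> (real \<Rightarrow> complex) \<Rightarrow> real" where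
  "wiener_norm \<tau> h = (LINT n|lborel. exp (\<tau> * \<bar>n\<bar>) * cmod (fourier h n))"

text \<open>Strongly (Bochner) measurable, essentially bounded functions of time: almost everywhere
  limits, in the Wiener norm, of simple functions with values in the Wiener space.\<close>

definition Linf_wiener :: "real \<Rightarrow> real \<Rightarrow> (real \<Rightarrow> real \<Rightarrow> complex) set" where
  "Linf_wiener T \<tau> = {u.
     (\<exists>M. AE t in lebesgue_on {0..T}. u t \<in> wiener \<tau> \<and> wiener_norm \<tau> (u t) \<le> M) \<and>
     (\<exists>s :: nat \<Rightarrow> real \<Rightarrow> real \<Rightarrow> complex.
        (\<forall>n. simple_function (lebesgue_on {0..T}) (s n) \<and> (\<forall>t\<in>{0..T}. s n t \<in> wiener \<tau>)) \<and>
        (AE t in lebesgue_on {0..T}. (\<lambda>n. wiener_norm \<tau> (\<lambda>x. s n t x - u t x)) \<longlonglongrightarrow> 0))}"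

definition C_wiener :: "real \<Rightarrow> real \<Rightarrow> (real \<Rightarrow> real \<Rightarrow> complex) set" where
  "C_wiener T \<tau> = {u. \<forall>t\<in>{0..T}. u t \<in> wiener \<tau> \<and>
     ((\<lambda>s. wiener_norm \<tau> (\<lambda>x. u s x - u t x)) \<longlongrightarrow> 0) (at t within {0..T})}"

definition cplx :: "(real \<Rightarrow> real) \<Rightarrow> real \<Rightarrow> complex" where
  "cplx h = (\<lambda>x. complex_of_real (h x))"

text \<open>The two brackets of the nonlinearity, with \<open>u\<close>, \<open>v\<close>, \<open>w\<close> standing for \<open>f\<close>, the time
  derivative of \<open>f\<close>, and the mixed second derivative of \<open>f\<close>.\<close>

definition flux1 :: "(real \<Rightarrow> complex) \<Rightarrow> (real \<Rightarrow> complex) \<Rightarrow> real \<Rightarrow> complex" where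
  "flux1 u v = (\<lambda>x. - hilbert (\<lambda>y. (hilbert v y)\<^sup>2) x + commutator hilbert u (Lam u) x)"

definition flux2 ::
  "real \<Rightarrow> real \<Rightarrow> (real \<Rightarrow> complex) \<Rightarrow> (real \<Rightarrow> complex) \<Rightarrow> real \<Rightarrow> complex" where
  "flux2 \<alpha> \<beta> u w =
     (\<lambda>x. - of_real \<alpha> * commutator hilbert u (Lam w) x
          + of_real \<beta> * commutator hilbert u (Lam_pow 3 u) x)"

text \<open>Classical solutions on \<open>[0,T]\<close>: every derivative in the equation exists at each point
  (one-sided in time at the endpoints). In \<open>f t x\<close> the first argument is time, and \<open>ft\<close> is the time
  derivative of \<open>f\<close>.\<close>

definition solves_ivp ::
  "real \<Rightarrow> real \<Rightarrow> real \<Rightarrow> (real \<Rightarrow> real) \<Rightarrow> (real \<Rightarrow> real) \<Rightarrow> real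
   \<Rightarrow> (real \<Rightarrow> real \<Rightarrow> real) \<Rightarrow> (real \<Rightarrow> real \<Rightarrow> real) \<Rightarrow> bool"
where
  "solves_ivp \<epsilon> \<alpha> \<beta> f0 f1 T f ft \<longleftrightarrow>
     (\<forall>x. f 0 x = f0 x \<and> ft 0 x = f1 x) \<and>
     (\<forall>t\<in>{0..T}. \<forall>x. ((\<lambda>s. f s x) has_real_derivative ft t x) (at t within {0..T})) \<and>
     (\<exists>ftt ftx N1x N2x. \<forall>t\<in>{0..T}. \<forall>x.
        ((\<lambda>s. ft s x) has_real_derivative ftt t x) (at t within {0..T}) \<and>
        ((\<lambda>y. ft t y) has_real_derivative ftx t x) (at x) \<and>
        (flux1 (cplx (f t)) (cplx (ft t)) has_vector_derivative N1x t x) (at x) \<and>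
        (flux2 \<alpha> \<beta> (cplx (f t)) (cplx (ftx t)) has_vector_derivative N2x t x) (at x) \<and>
        complex_of_real (ftt t x) =
          - Lam (cplx (f t)) x - of_real \<beta> * Lam_pow 3 (cplx (f t)) x
          + of_real \<alpha> * Lam (cplx (ftx t)) x
          + of_real \<epsilon> * N1x t x + of_real \<epsilon> * N2x t x)"

end

(* The problem is solved on the Fourier side. There the linear part is, for each frequency, an
   oscillator with bounded propagators. A commutator with the Hilbert transform only couples
   frequencies of opposite sign, whose moduli add up: all its derivatives but one are absorbed by an
   exponential weight, so the whole nonlinearity loses a single derivative in weighted spaces. With
   the weight exp (tau(t) |k|) / (1 + k^2) and tau decreasing at the rate R, Duhamel's formula
   recovers this derivative with a factor 1/R, and Banach's theorem applies for large R, up to the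
   time 1/R, without smallness of the data. The band limitation of f_0 makes om2 * f_0^, which enters
   the formula for f_t, harmless.

   The Wiener spaces also require integrability in x. It is not part of the fixed point argument and
   is proved for the solution afterwards: the data terms are convolutions of the data with
   integrable kernels, and the nonlinear terms are, by Plancherel, integrable kernels
   convolved with products of square integrable functions. *)

theory Submission
  imports Defs "HOL-Probability.Probability"
begin

section \<open>Fourier inversion and Plancherel\<close>

text \<open>With Q = \<Lambda>f + \<beta>\<Lambda>^3 f - \<alpha>\<Lambda>f_tx the equation reads
  f_tt = -Q + \<epsilon> (-H((H f_t)^2) + [H,f]Q)_x: the three commutators merge into one, whose
  second argument is the linear part itself. Norms are suprema over k against an envelope instead of
  integrals, so the gain of 1/R in Duhamel's integral holds separately at each k, and the factor
  1/(1 + k^2) keeps envelopes stable under convolution. The exponent falls from 3 to 2; of these 2,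
  one unit pays for symbols of order up to 3 and one for the factor cosh k in the estimates in x.
  The obstacle to integrability in x is the frequency 0: |k| has a corner, sgn k a jump, and the
  oscillator frequency behaves like sqrt |k|. The propagators depend on that frequency only through
  its square, which is Lipschitz near 0, and Lipschitz symbols suffice for integrable kernels. The
  outer sign of k occurs only multiplied by k, and the inner signs stay inside square integrable
  factors, where a jump is harmless.\<close>

abbreviation ift :: "(real \<Rightarrow> complex) \<Rightarrow> real \<Rightarrow> complex" where
  "ift \<equiv> inv_fourier_integral"

abbreviation L1n :: "(real \<Rightarrow> complex) \<Rightarrow> ennreal" where
  "L1n f \<equiv> \<integral>\<^sup>+x. ennreal (norm (f x)) \<partial>lborel"

text \<open>Continuity of the integrand is demanded only almost everywhere because the nonlinear
  kernel contains sgn (k - m), which jumps at m = k.\<close>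

lemma continuous_on_LINT:
  fixes F :: "'a::metric_space \<Rightarrow> real \<Rightarrow> complex"
  assumes meas: "\<And>x. x \<in> S \<Longrightarrow> F x \<in> borel_measurable lborel"
    and G: "integrable lborel G"
    and bnd: "\<And>x k. x \<in> S \<Longrightarrow> norm (F x k) \<le> G k"
    and cont: "\<And>x. x \<in> S \<Longrightarrow> AE k in lborel. continuous (at x within S) (\<lambda>x. F x k)"
  shows "continuous_on S (\<lambda>x. LINT k|lborel. F x k)"
  unfolding continuous_on_sequentially
proof (intro ballI allI impI, elim conjE)
  fix x u assume x: "x \<in> S" and u: "\<forall>n. u n \<in> S" "u \<longlonglongrightarrow> x"
  have "(\<lambda>n. LINT k|lborel. F (u n) k) \<longlonglongrightarrow> (LINT k|lborel. F x k)"
  proof (rule integral_dominated_convergence[where w = G])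
    show "AE k in lborel. (\<lambda>n. F (u n) k) \<longlonglongrightarrow> F x k"
      using cont[OF x]
    proof eventually_elim
      case (elim k)
      with u show ?case unfolding continuous_within_sequentially o_def by auto
    qed
  qed (use meas G bnd x u in auto)
  then show "((\<lambda>x. LINT k|lborel. F x k) \<circ> u) \<longlonglongrightarrow> (LINT k|lborel. F x k)"
    by (simp add: o_def)
qed

text \<open>By the mean value inequality on the convex set \<open>S\<close>, the bound on
  \<open>F'\<close> also bounds all difference quotients of \<open>F\<close>, so the remainder
  quotients are dominated by 2 \<open>G\<close>. Derivatives within \<open>S\<close> cover both the
  whole line and a time interval with its end points.\<close>

lemma has_vector_derivative_LINT:
  fixes F F' :: "real \<Rightarrow> real \<Rightarrow> complex"
  assumes S: "convex S" "t \<in> S"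
    and F: "\<And>s. s \<in> S \<Longrightarrow> integrable lborel (F s)"
    and F': "F' t \<in> borel_measurable lborel"
    and deriv: "\<And>s k. s \<in> S \<Longrightarrow> ((\<lambda>s. F s k) has_vector_derivative F' s k) (at s within S)"
    and G: "integrable lborel G"
    and bnd: "\<And>s k. s \<in> S \<Longrightarrow> norm (F' s k) \<le> G k"
  shows "((\<lambda>s. LINT k|lborel. F s k) has_vector_derivative (LINT k|lborel. F' t k)) (at t within S)"
proof -
  have F'i: "integrable lborel (F' t)"
    by (rule Bochner_Integration.integrable_bound[OF G F'])
      (use bnd[OF S(2)] in \<open>auto intro: order_trans[OF _ abs_ge_self]\<close>)
  have lip: "norm (F s k - F t k) \<le> G k * norm (s - t)" if "s \<in> S" for s k
  proof (rule differentiable_bound[OF S(1) _ _ that S(2)])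
    fix x assume x: "x \<in> S"
    show "((\<lambda>s. F s k) has_derivative (\<lambda>h. h *\<^sub>R F' x k)) (at x within S)"
      using deriv[OF x] by (simp add: has_vector_derivative_def)
    show "onorm (\<lambda>h. h *\<^sub>R F' x k) \<le> G k"
      using bnd[OF x] by (simp add: onorm_scaleR_left onorm_id)
  qed
  have "((\<lambda>y. (1 / norm (y - t)) *\<^sub>R
     ((LINT k|lborel. F y k) - ((LINT k|lborel. F t k) + (y - t) *\<^sub>R (LINT k|lborel. F' t k)))) \<longlongrightarrow> 0) (at t within S)"
    unfolding tendsto_at_iff_sequentially
  proof (intro allI impI)
    fix X :: "nat \<Rightarrow> real" assume X: "\<forall>i. X i \<in> S - {t}" "X \<longlonglongrightarrow> t"
    let ?q = "\<lambda>n k. (1 / norm (X n - t)) *\<^sub>R (F (X n) k - (F t k + (X n - t) *\<^sub>R F' t k))"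
    have L1: "(\<lambda>n. integral\<^sup>L lborel (?q n)) \<longlonglongrightarrow> integral\<^sup>L lborel (\<lambda>k::real. 0::complex)"
    proof (rule integral_dominated_convergence[where w = "\<lambda>k. 2 * G k" and s = ?q and f = "\<lambda>_. 0"])
      show "?q n \<in> borel_measurable lborel" for n
        using X F F'i S by (intro borel_measurable_integrable) auto
      show "integrable lborel (\<lambda>k. 2 * G k)" using G by simp
      show "AE k in lborel. (\<lambda>n. ?q n k) \<longlonglongrightarrow> 0"
      proof (rule AE_I2)
        fix k
        have "((\<lambda>y. (1 / norm (y - t)) *\<^sub>R (F y k - (F t k + (y - t) *\<^sub>R F' t k))) \<longlongrightarrow> 0) (at t within S)"
          using deriv[OF S(2), of k] unfolding has_vector_derivative_def has_derivative_within by auto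
        then show "(\<lambda>n. ?q n k) \<longlonglongrightarrow> 0"
          using X unfolding tendsto_at_iff_sequentially o_def by blast
      qed
      show "AE k in lborel. norm (?q n k) \<le> 2 * G k" for n
      proof (rule AE_I2)
        fix k
        have ne: "norm (X n - t) > 0" using X by auto
        have "norm (F (X n) k - (F t k + (X n - t) *\<^sub>R F' t k))
            \<le> norm (F (X n) k - F t k) + norm ((X n - t) *\<^sub>R F' t k)"
          by (metis diff_diff_add norm_triangle_ineq4)
        also have "\<dots> \<le> G k * norm (X n - t) + norm (X n - t) * G k"
          using lip[of "X n" k] X bnd[OF S(2), of k] by (intro add_mono) (auto intro!: mult_left_mono)
        finally show "norm (?q n k) \<le> 2 * G k"
          using ne by (simp only: norm_scaleR) (simp add: divide_le_eq mult.commute mult.left_commute)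
      qed
    qed auto
    have L2: "(LINT k|lborel. ?q n k) = (1 / norm (X n - t)) *\<^sub>R
     ((LINT k|lborel. F (X n) k) - ((LINT k|lborel. F t k) + (X n - t) *\<^sub>R (LINT k|lborel. F' t k)))" for n
    proof -
      have "integrable lborel (F (X n))" "integrable lborel (F t)" using X F S by auto
      then show ?thesis using F'i by simp
    qed
    show "((\<lambda>y. (1 / norm (y - t)) *\<^sub>R
     ((LINT k|lborel. F y k) - ((LINT k|lborel. F t k) + (y - t) *\<^sub>R (LINT k|lborel. F' t k)))) \<circ> X) \<longlonglongrightarrow> 0"
      using L1 by (simp only: L2 o_def Bochner_Integration.integral_zero)
  qed
  then show ?thesis
    unfolding has_vector_derivative_def has_derivative_within by (auto intro: bounded_linear_scaleR_left)
qed

section \<open>The inverse transform of integrable functions\<close>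

lemma integrable_mult_iexp:
  assumes "integrable lborel g"
  shows "integrable lborel (\<lambda>k. g k * iexp (k * x))"
  by (rule Bochner_Integration.integrable_bound[OF assms])
     (use assms in \<open>auto simp: norm_mult norm_exp_i_times\<close>)

lemma continuous_on_inv_fourier:
  assumes "integrable lborel g"
  shows "continuous_on S (ift g)"
proof -
  have "continuous_on S (\<lambda>x. LINT k|lborel. g k * iexp (k * x))"
    by (rule continuous_on_LINT[where G = "\<lambda>k. norm (g k)"])
      (use assms in \<open>auto simp: norm_mult norm_exp_i_times intro!: continuous_intros\<close>)
  then show ?thesis
    unfolding inv_fourier_integral_def[abs_def] by (intro continuous_intros)
qed

lemma borel_measurable_inv_fourier [measurable]:
  "integrable lborel g \<Longrightarrow> ift g \<in> borel_measurable borel"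
  by (rule borel_measurable_continuous_onI[OF continuous_on_inv_fourier])

lemma fourier_integral_eq: "fourier_integral h k = ift h (- k)"
  by (simp add: fourier_integral_def inv_fourier_integral_def mult.commute)

lemma norm_inv_fourier_le:
  assumes "integrable lborel g"
  shows "norm (ift g x) \<le> 1 / sqrt (2 * pi) * (LINT k|lborel. norm (g k))"
proof -
  have "norm (LINT k|lborel. g k * iexp (k * x)) \<le> (LINT k|lborel. norm (g k * iexp (k * x)))"
    by (rule integral_norm_bound)
  then show ?thesis unfolding inv_fourier_integral_def
    by (simp add: norm_mult norm_divide norm_exp_i_times divide_right_mono)
qed

lemma inv_fourier_add:
  assumes "integrable lborel g" "integrable lborel h"
  shows "ift (\<lambda>k. g k + h k) x = ift g x + ift h x"
  unfolding inv_fourier_integral_def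
  using integrable_mult_iexp[OF assms(1)] integrable_mult_iexp[OF assms(2)]
  by (simp add: ring_distribs)

lemma inv_fourier_cmult: "ift (\<lambda>k. a * g k) x = a * ift g x"
  unfolding inv_fourier_integral_def by (simp add: mult.assoc mult.left_commute)

lemma inv_fourier_diff:
  assumes "integrable lborel g" "integrable lborel h"
  shows "ift (\<lambda>k. g k - h k) x = ift g x - ift h x"
  unfolding inv_fourier_integral_def
  using integrable_mult_iexp[OF assms(1)] integrable_mult_iexp[OF assms(2)]
  by (simp add: ring_distribs)

lemma inv_fourier_cong_AE:
  assumes "AE k in lborel. g k = h k" "g \<in> borel_measurable lborel" "h \<in> borel_measurable lborel"
  shows "ift g = ift h"
proof
  fix x
  have "(LINT k|lborel. g k * iexp (k * x)) = (LINT k|lborel. h k * iexp (k * x))"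
  proof (rule integral_cong_AE)
    show "AE k in lborel. g k * iexp (k * x) = h k * iexp (k * x)"
      using assms(1) by eventually_elim simp
  qed (use assms in auto)
  then show "ift g x = ift h x"
    by (simp add: inv_fourier_integral_def)
qed

text \<open>Levy's inversion theorem concerns characteristic functions of probability laws, so p is
  divided by its mass m. A law with a density has no atoms, hence the formula holds for all end
  points. If m = 0, both sides vanish.\<close>

lemma Levy_Inversion_density:
  fixes p :: "real \<Rightarrow> real"
  assumes p: "integrable lborel p" "\<And>x. p x \<ge> 0" and ab: "a \<le> b"
  shows "(\<lambda>T::nat. 1 / (2 * pi) * (CLBINT t=-real T..real T. (iexp (-(t * a)) - iexp (-(t * b))) / (\<i> * t) *
      (CLBINT x. p x *\<^sub>R iexp (t * x)))) \<longlonglongrightarrow> complex_of_real (LBINT x:{a<..b}. p x)"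
proof -
  define m where "m = (LBINT x. p x)"
  have pm: "p \<in> borel_measurable borel" using p by auto
  have m0: "m \<ge> 0" unfolding m_def using p by simp
  show ?thesis
  proof (cases "m = 0")
    case True
    then have ae: "AE x in lborel. p x = 0"
      using integral_nonneg_eq_0_iff_AE[OF p(1)] p(2) by (simp add: m_def)
    have 1: "(CLBINT x. p x *\<^sub>R iexp (t * x)) = 0" for t
      using ae by (intro integral_eq_zero_AE) auto
    have 2: "(LBINT x:{a<..b}. p x) = 0"
      unfolding set_lebesgue_integral_def using ae by (intro integral_eq_zero_AE) auto
    show ?thesis unfolding 1 2 by (simp add: interval_lebesgue_integral_def)
  next
    case False
    with m0 have m: "m > 0" by simp
    define M where "M = density lborel (\<lambda>x. ennreal (p x / m))"
    have em: "emeasure M A = ennreal (LBINT x. indicator A x * (p x / m))" if [measurable]: "A \<in> sets borel" for A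
    proof -
      have "emeasure M A = (\<integral>\<^sup>+x. ennreal (indicator A x * (p x / m)) \<partial>lborel)"
        unfolding M_def using pm
        by (subst emeasure_density) (auto intro!: nn_integral_cong simp: indicator_def)
      also have "\<dots> = ennreal (LBINT x. indicator A x * (p x / m))"
        using p m integrable_real_mult_indicator[of A lborel "\<lambda>x. p x / m"]
        by (intro nn_integral_eq_integral) (auto simp: mult.commute)
      finally show ?thesis .
    qed
    have "emeasure M (space M) = 1"
    proof -
      have "emeasure M UNIV = ennreal (LBINT x. (p x / m))" by (subst em) auto
      also have "(LBINT x. (p x / m)) = 1" using m by (simp add: m_def)
      finally show ?thesis by (simp add: M_def)
    qed
    then have "prob_space M" by (rule prob_spaceI)
    then interpret real_distribution M
      by (auto simp: real_distribution_def real_distribution_axioms_def M_def)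
    have meas: "measure M A = (LBINT x. indicator A x * (p x / m))" if "A \<in> sets borel" for A
      using em[OF that] p m unfolding measure_def by (simp add: enn2real_ennreal)
    have z: "measure M {c} = 0" for c
    proof -
      have "AE x in lborel. x \<noteq> c" by (rule AE_lborel_singleton)
      then have "AE x in lborel. indicator {c} x * (p x / m) = 0" by eventually_elim auto
      then show ?thesis by (subst meas) (auto intro!: integral_eq_zero_AE)
    qed
    have ch: "char M t = (CLBINT x. p x *\<^sub>R iexp (t * x)) / m" for t
    proof -
      have "char M t = (CLBINT x. (p x / m) *\<^sub>R iexp (t * x))"
        unfolding char_def M_def using pm p m by (subst integral_density) auto
      also have "\<dots> = (CLBINT x. (1 / m) *\<^sub>R (p x *\<^sub>R iexp (t * x)))"
        by (simp add: divide_inverse mult.commute)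
      also have "\<dots> = (1 / m) *\<^sub>R (CLBINT x. p x *\<^sub>R iexp (t * x))"
        by (rule integral_scaleR_right)
      finally show ?thesis by (simp add: scaleR_conv_of_real divide_simps)
    qed
    have ms: "measure M {a<..b} = (LBINT x:{a<..b}. p x) / m"
      by (subst meas) (auto simp: set_lebesgue_integral_def)
    have "(\<lambda>T::nat. m * (1 / (2 * pi) * (CLBINT t=-real T..real T. (iexp (-(t * a)) - iexp (-(t * b))) / (\<i> * t) *
        char M t))) \<longlonglongrightarrow> complex_of_real m * complex_of_real (measure M {a<..b})"
      using Levy_Inversion[OF ab z z] by (intro tendsto_mult_left) simp
    moreover have "m * (1 / (2 * pi) * (CLBINT t=-real T..real T. (iexp (-(t * a)) - iexp (-(t * b))) / (\<i> * t) *
        char M t)) = 1 / (2 * pi) * (CLBINT t=-real T..real T. (iexp (-(t * a)) - iexp (-(t * b))) / (\<i> * t) *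
      (CLBINT x. p x *\<^sub>R iexp (t * x)))" for T :: nat
    proof -
      have "(CLBINT t=-real T..real T. (iexp (-(t * a)) - iexp (-(t * b))) / (\<i> * t) * char M t)
        = (CLBINT t=-real T..real T. (iexp (-(t * a)) - iexp (-(t * b))) / (\<i> * t) *
      (CLBINT x. p x *\<^sub>R iexp (t * x)) / m)"
        by (simp add: ch)
      also have "\<dots> = (CLBINT t=-real T..real T. (iexp (-(t * a)) - iexp (-(t * b))) / (\<i> * t) *
      (CLBINT x. p x *\<^sub>R iexp (t * x))) / m"
        by (rule interval_lebesgue_integral_divide)
      finally show ?thesis using m by simp
    qed
    ultimately show ?thesis using m by (simp add: ms)
  qed
qed

lemma norm_Levy_kernel_le:
  assumes "a \<le> b"
  shows "norm ((iexp (-(t * a)) - iexp (-(t * b))) / (\<i> * complex_of_real t)) \<le> b - a"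
proof (cases "t = 0")
  case False
  then have "norm ((iexp (-t * b) - iexp (-t * a)) / (\<i> * complex_of_real (-t))) \<le> b - a"
    using assms by (intro Levy_Inversion_aux2) auto
  also have "(iexp (-t * b) - iexp (-t * a)) / (\<i> * complex_of_real (-t)) =
      (iexp (-(t * a)) - iexp (-(t * b))) / (\<i> * complex_of_real t)"
    using False by (simp add: divide_simps)
  finally show ?thesis .
qed (use assms in auto)

lemma integral_complex_combination:
  fixes a1 a2 a3 a4 :: "'a \<Rightarrow> complex"
  assumes "integrable M a1" "integrable M a2" "integrable M a3" "integrable M a4"
  shows "(LINT x|M. (a1 x - a2 x) + \<i> * (a3 x - a4 x)) =
    (integral\<^sup>L M a1 - integral\<^sup>L M a2) + \<i> * (integral\<^sup>L M a3 - integral\<^sup>L M a4)"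
  using assms by simp

text \<open>Both sides are linear in g, and g is a complex combination of four nonnegative
  densities: the positive and negative parts of its real and imaginary parts.\<close>

lemma Levy_Inversion_integrable:
  fixes g :: "real \<Rightarrow> complex"
  assumes g: "integrable lborel g" and ab: "a \<le> b"
  shows "(\<lambda>T::nat. 1 / (2 * pi) * (LINT t|lborel. indicator {-real T..real T} t *\<^sub>R
      ((iexp (-(t * a)) - iexp (-(t * b))) / (\<i> * t) * (LINT x|lborel. g x * iexp (x * t)))))
      \<longlonglongrightarrow> (LINT x:{a<..b}|lborel. g x)"
proof -
  let ?K = "\<lambda>t. (iexp (-(t * a)) - iexp (-(t * b))) / (\<i> * complex_of_real t)"
  let ?E = "\<lambda>p t. CLBINT x. p x *\<^sub>R iexp (t * x)"
  let ?I = "\<lambda>T p. LINT t|lborel. indicator {-real T..real T} t *\<^sub>R (?K t * ?E p t)"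
  define p1 where "p1 = (\<lambda>x. max 0 (Re (g x)))"
  define p2 where "p2 = (\<lambda>x. max 0 (- Re (g x)))"
  define p3 where "p3 = (\<lambda>x. max 0 (Im (g x)))"
  define p4 where "p4 = (\<lambda>x. max 0 (- Im (g x)))"
  note pd = p1_def p2_def p3_def p4_def
  have pi: "integrable lborel p1" "integrable lborel p2" "integrable lborel p3" "integrable lborel p4"
    unfolding pd using g by (auto intro!: integrable_max)
  have gd: "g x = of_real (p1 x) - of_real (p2 x) + \<i> * (of_real (p3 x) - of_real (p4 x))" for x
    by (auto simp: complex_eq_iff pd max_def)
  have pe: "integrable lborel (\<lambda>x. p x *\<^sub>R iexp (t * x))" if "integrable lborel p" for p :: "real \<Rightarrow> real" and t
    using integrable_mult_iexp[of "\<lambda>x. complex_of_real (p x)" t] that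
    by (simp add: scaleR_conv_of_real mult.commute)
  have cE: "continuous_on UNIV (?E p)" if "integrable lborel p" for p :: "real \<Rightarrow> real"
    by (rule continuous_on_LINT[where G = "\<lambda>x. norm (p x)"])
      (use that in \<open>auto simp: norm_exp_i_times intro!: continuous_intros\<close>)
  have nE: "norm (?E p t) \<le> (LBINT x. \<bar>p x\<bar>)" for p :: "real \<Rightarrow> real" and t
    using integral_norm_bound[of lborel "\<lambda>x. p x *\<^sub>R iexp (t * x)"]
    by (simp add: norm_exp_i_times)
  have int: "integrable lborel (\<lambda>t. indicator {-real T..real T} t *\<^sub>R (?K t * ?E p t))"
    if p: "integrable lborel p" for p :: "real \<Rightarrow> real" and T
  proof (rule integrableI_bounded_set_indicator[where B = "(b - a) * (LBINT x. \<bar>p x\<bar>)"])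
    have [measurable]: "?E p \<in> borel_measurable borel"
      by (rule borel_measurable_continuous_onI[OF cE[OF p]])
    show "(\<lambda>t. ?K t * ?E p t) \<in> borel_measurable lborel" by measurable
    show "AE x in lborel. x \<in> {-real T..real T} \<longrightarrow> norm (?K x * ?E p x) \<le> (b - a) * (LBINT x. \<bar>p x\<bar>)"
      unfolding norm_mult using norm_Levy_kernel_le[OF ab] nE ab
      by (intro AE_I2 impI mult_mono) auto
  qed (auto simp: emeasure_lborel_Icc_eq)
  have lim: "(\<lambda>T. 1 / (2 * pi) * ?I T p) \<longlonglongrightarrow> complex_of_real (LBINT x:{a<..b}. p x)"
    if "integrable lborel p" "\<And>x. p x \<ge> 0" for p :: "real \<Rightarrow> real"
  proof -
    have "(CLBINT t=-real T..real T. ?K t * ?E p t) = ?I T p" for T :: nat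
      by (subst interval_integral_Icc) (auto simp: set_lebesgue_integral_def)
    with Levy_Inversion_density[OF that ab] show ?thesis by simp
  qed
  have G: "(LINT x|lborel. g x * iexp (x * t)) = ?E p1 t - ?E p2 t + \<i> * (?E p3 t - ?E p4 t)" for t
  proof -
    have "(LINT x|lborel. g x * iexp (x * t)) = (LINT x|lborel. (p1 x *\<^sub>R iexp (t * x) - p2 x *\<^sub>R iexp (t * x))
      + \<i> * (p3 x *\<^sub>R iexp (t * x) - p4 x *\<^sub>R iexp (t * x)))"
      by (intro Bochner_Integration.integral_cong refl, subst gd) (simp add: scaleR_conv_of_real algebra_simps)
    then show ?thesis using pi[THEN pe] by simp
  qed
  have I: "(LINT t|lborel. indicator {-real T..real T} t *\<^sub>R (?K t * (LINT x|lborel. g x * iexp (x * t))))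
     = (?I T p1 - ?I T p2) + \<i> * (?I T p3 - ?I T p4)" for T
  proof -
    have "(LINT t|lborel. indicator {-real T..real T} t *\<^sub>R (?K t * (LINT x|lborel. g x * iexp (x * t))))
     = (LINT t|lborel. (indicator {-real T..real T} t *\<^sub>R (?K t * ?E p1 t) - indicator {-real T..real T} t *\<^sub>R (?K t * ?E p2 t))
      + \<i> * (indicator {-real T..real T} t *\<^sub>R (?K t * ?E p3 t) - indicator {-real T..real T} t *\<^sub>R (?K t * ?E p4 t)))"
      by (intro Bochner_Integration.integral_cong refl, subst G) (simp only: scaleR_conv_of_real ring_distribs mult.left_commute mult.assoc)
    also have "\<dots> = (?I T p1 - ?I T p2) + \<i> * (?I T p3 - ?I T p4)"
      by (intro integral_complex_combination int pi)
    finally show ?thesis .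
  qed
  have R: "(LINT x:{a<..b}|lborel. g x) = (of_real (LBINT x:{a<..b}. p1 x) - of_real (LBINT x:{a<..b}. p2 x)) +
      \<i> * (of_real (LBINT x:{a<..b}. p3 x) - of_real (LBINT x:{a<..b}. p4 x))"
  proof -
    have s: "set_integrable lborel {a<..b} p1" "set_integrable lborel {a<..b} p2" "set_integrable lborel {a<..b} p3" "set_integrable lborel {a<..b} p4"
      using pi[THEN integrable_mult_indicator[of "{a<..b}", rotated]] by (simp_all add: set_integrable_def)
    let ?a = "\<lambda>p x. indicator {a<..b} x *\<^sub>R complex_of_real (p x)"
    have "(LINT x:{a<..b}|lborel. g x) = (LINT x|lborel. (?a p1 x - ?a p2 x) + \<i> * (?a p3 x - ?a p4 x))"
      unfolding set_lebesgue_integral_def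
      by (intro Bochner_Integration.integral_cong refl, subst gd) (simp add: scaleR_conv_of_real algebra_simps)
    also have "\<dots> = (integral\<^sup>L lborel (?a p1) - integral\<^sup>L lborel (?a p2)) + \<i> * (integral\<^sup>L lborel (?a p3) - integral\<^sup>L lborel (?a p4))"
      by (rule integral_complex_combination)
        (use s in \<open>auto simp: set_integrable_def scaleR_conv_of_real simp flip: of_real_mult\<close>)
    also have "\<dots> = (of_real (LBINT x:{a<..b}. p1 x) - of_real (LBINT x:{a<..b}. p2 x)) +
      \<i> * (of_real (LBINT x:{a<..b}. p3 x) - of_real (LBINT x:{a<..b}. p4 x))"
      by (simp only: set_integral_complex_of_real[unfolded set_lebesgue_integral_def] set_lebesgue_integral_def)
    finally show ?thesis .
  qed
  have "(\<lambda>T. (1 / (2 * pi) * ?I T p1 - 1 / (2 * pi) * ?I T p2) + \<i> * (1 / (2 * pi) * ?I T p3 - 1 / (2 * pi) * ?I T p4))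
     \<longlonglongrightarrow> (of_real (LBINT x:{a<..b}. p1 x) - of_real (LBINT x:{a<..b}. p2 x)) +
      \<i> * (of_real (LBINT x:{a<..b}. p3 x) - of_real (LBINT x:{a<..b}. p4 x))"
    by (intro tendsto_add tendsto_diff tendsto_mult_left lim pi) (auto simp: pd)
  then show ?thesis unfolding I R by (simp add: algebra_simps)
qed

text \<open>On each window (-n, n] the positive and the negative part of u - v are densities of
  finite measures that agree on half lines, hence everywhere. So the two parts coincide almost
  everywhere, and as one of them is 0 at every point, both vanish.\<close>

lemma AE_eq_if_interval_integrals_eq:
  fixes u v :: "real \<Rightarrow> real"
  assumes u: "\<And>a b. set_integrable lborel {a<..b} u" and v: "\<And>a b. set_integrable lborel {a<..b} v"
    and [measurable]: "u \<in> borel_measurable borel" "v \<in> borel_measurable borel"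
    and eq: "\<And>a b. a \<le> b \<Longrightarrow> (LBINT x:{a<..b}. u x) = (LBINT x:{a<..b}. v x)"
  shows "AE x in lborel. u x = v x"
proof -
  define d where "d x = u x - v x" for x
  have [measurable]: "d \<in> borel_measurable borel" unfolding d_def[abs_def] by measurable
  have di: "set_integrable lborel {a<..b} d" for a b
    unfolding d_def[abs_def] using u v by (rule set_integral_diff)
  have d0: "(LBINT x:{a<..b}. d x) = 0" for a b
    using eq[of a b] set_integral_diff(2)[OF u v, of a b]
    by (cases "a \<le> b") (auto simp: d_def[abs_def] set_lebesgue_integral_def)
  define P where "P n x = indicator {- real n<..real n} x * max 0 (d x)" for n x
  define Q where "Q n x = indicator {- real n<..real n} x * max 0 (- d x)" for n x
  have [measurable]: "P n \<in> borel_measurable borel" "Q n \<in> borel_measurable borel" for n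
    unfolding P_def[abs_def] Q_def[abs_def] by measurable
  have pq: "integrable lborel (\<lambda>y. indicator {x<..} y * P n y)" "integrable lborel (\<lambda>y. indicator {x<..} y * Q n y)" for x n
    by (rule Bochner_Integration.integrable_bound[OF di[of "- real n" "real n", unfolded set_integrable_def]];
      auto simp: P_def Q_def indicator_def)+
  have em: "emeasure (density lborel (\<lambda>x. ennreal (F n x))) {x<..} = ennreal (LBINT y. indicator {x<..} y * F n y)"
    if "integrable lborel (\<lambda>y. indicator {x<..} y * F n y)" "\<And>y. F n y \<ge> 0" and [measurable]: "F n \<in> borel_measurable borel"
    for F :: "nat \<Rightarrow> real \<Rightarrow> real" and n x
  proof -
    have "emeasure (density lborel (\<lambda>x. ennreal (F n x))) {x<..} = (\<integral>\<^sup>+y. ennreal (indicator {x<..} y * F n y) \<partial>lborel)"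
      by (subst emeasure_density) (auto intro!: nn_integral_cong simp: indicator_def)
    also have "\<dots> = ennreal (LBINT y. indicator {x<..} y * F n y)"
      using that by (intro nn_integral_eq_integral) auto
    finally show ?thesis .
  qed
  have eqPQ: "(LBINT y. indicator {x<..} y * P n y) = (LBINT y. indicator {x<..} y * Q n y)" for x n
  proof -
    have "(LBINT y. indicator {x<..} y * P n y) - (LBINT y. indicator {x<..} y * Q n y)
      = (LBINT y. indicator {x<..} y * P n y - indicator {x<..} y * Q n y)"
      using pq by (simp add: Bochner_Integration.integral_diff)
    also have "\<dots> = (LBINT y:{max x (- real n)<..real n}. d y)"
      unfolding set_lebesgue_integral_def
      by (intro Bochner_Integration.integral_cong) (auto simp: P_def Q_def indicator_def)
    finally show ?thesis using d0 by simp
  qed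
  have "AE x in lborel. ennreal (P n x) = ennreal (Q n x)" for n
  proof (rule sigma_finite_measure.density_unique[OF sigma_finite_lborel])
    show "density lborel (\<lambda>x. ennreal (P n x)) = density lborel (\<lambda>x. ennreal (Q n x))"
    proof (rule measure_eqI_lessThan)
      have nn: "P n y \<ge> 0" "Q n y \<ge> 0" for y by (auto simp: P_def Q_def)
      show "emeasure (density lborel (\<lambda>x. ennreal (P n x))) {x<..} < \<infinity>" for x
        by (subst em) (auto intro!: pq nn)
      show "emeasure (density lborel (\<lambda>x. ennreal (P n x))) {x<..} = emeasure (density lborel (\<lambda>x. ennreal (Q n x))) {x<..}" for x
        by (subst (1 2) em) (auto intro!: pq nn simp: eqPQ)
    qed auto
  qed auto
  then have "AE x in lborel. \<forall>n. ennreal (P n x) = ennreal (Q n x)"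
    by (simp add: AE_all_countable)
  then show ?thesis
  proof eventually_elim
    fix x assume *: "\<forall>n. ennreal (P n x) = ennreal (Q n x)"
    obtain n :: nat where "\<bar>x\<bar> < n" using reals_Archimedean2 by blast
    moreover have "P n x = Q n x" using * by (auto simp: P_def Q_def)
    ultimately have "d x = 0" by (auto simp: P_def Q_def indicator_def max_def split: if_splits)
    then show "u x = v x" by (simp add: d_def)
  qed
qed

lemma tendsto_integral_truncated:
  fixes F :: "real \<Rightarrow> complex"
  assumes F: "integrable lborel F"
  shows "(\<lambda>T::nat. LINT t|lborel. indicator {-real T..real T} t *\<^sub>R F t) \<longlonglongrightarrow> integral\<^sup>L lborel F"
  apply (rule integral_dominated_convergence[where w = "\<lambda>t. norm (F t)" and f = F
      and s = "\<lambda>(T::nat) t. indicator {-real T..real T} t *\<^sub>R F t"])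
  subgoal using F by auto
  subgoal using F by auto
  subgoal using F by auto
  subgoal
    apply (rule AE_I2)
    apply (rule tendsto_eventually)
    subgoal for t
    apply (rule eventually_mono[OF eventually_ge_at_top[of "nat \<lceil>\<bar>t\<bar>\<rceil>"]])
     by (auto simp: indicator_def)
    done
  subgoal by (rule AE_I2) (auto simp: indicator_def)
  done

lemma set_integrable_Re: "set_integrable M A f \<Longrightarrow> set_integrable M A (\<lambda>x. Re (f x))"
  and set_integrable_Im: "set_integrable M A f \<Longrightarrow> set_integrable M A (\<lambda>x. Im (f x))"
  for f :: "'a \<Rightarrow> complex"
  unfolding set_integrable_def by (auto dest: integrable_Re integrable_Im)

text \<open>Both sides are compared through their integrals over intervals (a, b]. Levy's formula
  writes the integral of g as a limit of truncated integrals of \<open>K\<close> times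
  \<open>H\<close>, where \<open>K\<close> is the transform of the indicator of (a, b]. Since
  \<open>H\<close> is integrable, the limit is a Lebesgue integral, and Fubini turns it into the
  integral of \<open>F\<close> over (a, b].\<close>

theorem fourier_inversion:
  assumes g: "integrable lborel g" and h: "integrable lborel (ift g)"
  shows "AE k in lborel. fourier_integral (ift g) k = g k"
proof -
  define H where "H t = (LINT x|lborel. g x * iexp (x * t))" for t
  define F where "F = fourier_integral (ift g)"
  have inv: "ift g t = of_real (1 / sqrt (2 * pi)) * H t" for t
    by (simp add: inv_fourier_integral_def H_def)
  have Heq: "H t = of_real (sqrt (2 * pi)) * ift g t" for t
    by (simp add: inv divide_simps flip: of_real_mult)
  have Hi: "integrable lborel H"
    unfolding Heq[abs_def] using h by simp
  have [measurable]: "H \<in> borel_measurable borel" using Hi by simp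
  have Feq: "F s = 1 / (2 * pi) * (LINT t|lborel. iexp (-(t * s)) * H t)" for s
  proof -
    have "F s = of_real (1 / sqrt (2 * pi)) * (LINT t|lborel. of_real (1 / sqrt (2 * pi)) * (iexp (-(t * s)) * H t))"
      unfolding F_def fourier_integral_def inv by (simp add: ac_simps)
    also have "\<dots> = of_real (1 / sqrt (2 * pi) * (1 / sqrt (2 * pi))) * (LINT t|lborel. iexp (-(t * s)) * H t)"
      by (subst integral_mult_right_zero) (simp only: of_real_mult mult.assoc)
    also have "1 / sqrt (2 * pi) * (1 / sqrt (2 * pi)) = 1 / (2 * pi)"
      by simp
    finally show ?thesis .
  qed
  have Fcont: "continuous_on UNIV F"
    unfolding F_def fourier_integral_eq[abs_def]
    by (intro continuous_on_compose2[OF continuous_on_inv_fourier[OF h, of UNIV]] continuous_intros) auto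
  then have [measurable]: "F \<in> borel_measurable borel" by (rule borel_measurable_continuous_onI)
  have gm[measurable]: "g \<in> borel_measurable borel" using g by simp
  have gs: "set_integrable lborel {a<..b} g" for a b
    unfolding set_integrable_def using g by (intro integrable_mult_indicator) auto
  have Fs: "set_integrable lborel {a<..b} F" for a b
    by (rule set_integrable_subset[of _ "{a..b}"])
       (auto intro!: borel_integrable_atLeastAtMost' continuous_on_subset[OF Fcont])
  have eq: "(LINT x:{a<..b}|lborel. g x) = (LINT x:{a<..b}|lborel. F x)" if ab: "a \<le> b" for a b
  proof -
    define K where "K t = (iexp (-(t * a)) - iexp (-(t * b))) / (\<i> * complex_of_real t)" for t
    have [measurable]: "K \<in> borel_measurable borel" unfolding K_def[abs_def] by measurable
    have Kle: "norm (K t) \<le> b - a" for t unfolding K_def by (rule norm_Levy_kernel_le[OF ab])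
    \<comment> \<open>At t = 0 the quotient has the value 0 instead of b - a; a single point does
      not affect the integrals over t.\<close>
    have K: "K t = (LINT s|lborel. indicator {a<..b} s *\<^sub>R iexp (-(t * s)))" if "t \<noteq> 0" for t
    proof -
      have neg_diff: "y / (- \<i> * t) - x / (- \<i> * t) = (x - y) / (\<i> * t)" for x y :: complex
        by (simp add: diff_divide_distrib)
      have ii: "\<i> * (z * \<i>) = - z" for z by (simp add: complex_eq_iff)
      have "(CLBINT s=a..b. iexp (-(t * s))) = iexp (-(t * b)) / (- \<i> * t) - iexp (-(t * a)) / (- \<i> * t)"
      proof (rule interval_integral_FTC_finite)
        fix s
        have "((\<lambda>s. exp (- (\<i> * (of_real t * of_real s))) / (- \<i> * t)) has_vector_derivative
           exp (- (\<i> * (of_real t * of_real s)))) (at s within {min a b..max a b})"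
          by (rule has_vector_derivative_real_field[where f = "\<lambda>z. exp (- (\<i> * (of_real t * z))) / (- \<i> * t)"])
            (use that in \<open>auto intro!: derivative_eq_intros simp: ii\<close>)
        then show "((\<lambda>s. iexp (-(t * s)) / (- \<i> * t)) has_vector_derivative iexp (-(t * s))) (at s within {min a b..max a b})"
          by simp
      qed (auto intro!: continuous_intros)
      then have "(LINT s:{a<..b}|lborel. iexp (-(t * s))) = iexp (-(t * b)) / (- \<i> * t) - iexp (-(t * a)) / (- \<i> * t)"
        unfolding interval_integral_Ioc[OF ab] .
      also have "\<dots> = (iexp (-(t * a)) - iexp (-(t * b))) / (\<i> * complex_of_real t)"
        by (rule neg_diff)
      finally show ?thesis unfolding set_lebesgue_integral_def K_def by (rule sym)
    qed
    have KH: "integrable lborel (\<lambda>t. K t * H t)"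
    proof (rule Bochner_Integration.integrable_bound)
      show "integrable lborel (\<lambda>t. (b - a) * norm (H t))" using Hi by simp
      show "AE t in lborel. norm (K t * H t) \<le> norm ((b - a) * norm (H t))"
        using ab by (intro AE_I2) (simp add: norm_mult mult_right_mono Kle)
    qed measurable
    have "(\<lambda>T::nat. LINT t|lborel. indicator {-real T..real T} t *\<^sub>R (K t * H t)) \<longlonglongrightarrow> (LINT t|lborel. K t * H t)"
      by (rule tendsto_integral_truncated[OF KH])
    from tendsto_mult_left[OF this, of "1 / (2 * pi)"]
    have "(LINT x:{a<..b}|lborel. g x) = 1 / (2 * pi) * (LINT t|lborel. K t * H t)"
      using Levy_Inversion_integrable[OF g ab] unfolding H_def[symmetric] K_def[symmetric] by (rule LIMSEQ_unique[rotated])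
    also have "(LINT t|lborel. K t * H t) = (LINT t|lborel. LINT s|lborel. indicator {a<..b} s *\<^sub>R (iexp (-(t * s)) * H t))"
    proof (rule integral_cong_AE)
      show "AE t in lborel. K t * H t = (LINT s|lborel. indicator {a<..b} s *\<^sub>R (iexp (-(t * s)) * H t))"
        using AE_lborel_singleton[of 0]
      proof eventually_elim
        case (elim t)
        show ?case unfolding K[OF elim] by (subst integral_mult_left_zero[symmetric]) (simp add: mult.assoc)
      qed
    qed auto
    also have "\<dots> = (LINT s|lborel. LINT t|lborel. indicator {a<..b} s *\<^sub>R (iexp (-(t * s)) * H t))"
    proof (rule lborel_pair.Fubini_integral[symmetric])
      show "integrable (lborel \<Otimes>\<^sub>M lborel) (\<lambda>(t, s). indicator {a<..b} s *\<^sub>R (iexp (-(t * s)) * H t))"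
      proof (rule lborel_pair.Fubini_integrable)
        have "(\<lambda>t. LINT s|lborel. norm (case (t, s) of (t, s) \<Rightarrow> indicator {a<..b} s *\<^sub>R (iexp (-(t * s)) * H t)))
          = (\<lambda>t. (b - a) * norm (H t))"
          using ab by (simp add: norm_mult fun_eq_iff)
        then show "integrable lborel (\<lambda>t. LINT s|lborel. norm (case (t, s) of (t, s) \<Rightarrow> indicator {a<..b} s *\<^sub>R (iexp (-(t * s)) * H t)))"
          using Hi by simp
        show "AE t in lborel. integrable lborel (\<lambda>s. case (t, s) of (t, s) \<Rightarrow> indicator {a<..b} s *\<^sub>R (iexp (-(t * s)) * H t))"
        proof (rule AE_I2, simp only: prod.case)
          fix t
          show "integrable lborel (\<lambda>s. indicator {a<..b} s *\<^sub>R (iexp (-(t * s)) * H t))"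
            using ab by (intro integrableI_bounded_set_indicator[where B = "norm (H t)"]) (auto simp: norm_mult)
        qed
      qed measurable
    qed
    also have "1 / (2 * pi) * \<dots> = (LINT x:{a<..b}|lborel. F x)"
      unfolding set_lebesgue_integral_def Feq by (simp add: scaleR_conv_of_real mult.left_commute)
    finally show ?thesis .
  qed
  have "AE x in lborel. Re (g x) = Re (F x)"
  proof (rule AE_eq_if_interval_integrals_eq)
    show "(LBINT x:{a<..b}. Re (g x)) = (LBINT x:{a<..b}. Re (F x))" if "a \<le> b" for a b
      using arg_cong[OF eq[OF that], of Re] gs[of a b] Fs[of a b] unfolding set_lebesgue_integral_def set_integrable_def
      by (simp flip: integral_Re)
  qed (use set_integrable_Re[OF gs] set_integrable_Re[OF Fs] in auto)
  moreover have "AE x in lborel. Im (g x) = Im (F x)"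
  proof (rule AE_eq_if_interval_integrals_eq)
    show "(LBINT x:{a<..b}. Im (g x)) = (LBINT x:{a<..b}. Im (F x))" if "a \<le> b" for a b
      using arg_cong[OF eq[OF that], of Im] gs[of a b] Fs[of a b] unfolding set_lebesgue_integral_def set_integrable_def
      by (simp flip: integral_Im)
  qed (use set_integrable_Im[OF gs] set_integrable_Im[OF Fs] in auto)
  ultimately show ?thesis unfolding F_def[symmetric] by eventually_elim (simp add: complex_eq_iff)
qed

text \<open>In the second branch of \<open>fourier\<close> the choice returns some g' with the same
  inverse transform as g. The difference g' - g has inverse transform 0, which is integrable, so the
  inversion theorem applies to the difference although it does not apply to g.\<close>

lemma AE_fourier_inv_fourier:
  assumes g: "integrable lborel g"
  shows "AE k in lborel. fourier (ift g) k = g k"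
    and "fourier (ift g) \<in> borel_measurable borel"
proof -
  have "(AE k in lborel. fourier (ift g) k = g k) \<and>
     fourier (ift g) \<in> borel_measurable borel"
  proof (cases "integrable lborel (ift g)")
    case True
    have "continuous_on UNIV (fourier_integral (ift g))"
      unfolding fourier_integral_eq[abs_def]
      by (intro continuous_on_compose2[OF continuous_on_inv_fourier[OF True, of UNIV]] continuous_intros) auto
    with True show ?thesis
      using fourier_inversion[OF g True]
      by (auto simp: fourier_def intro: borel_measurable_continuous_onI)
  next
    case False
    define g' where "g' = fourier (ift g)"
    have "g' = (SOME g'. integrable lborel g' \<and> ift g = ift g')"
      using False by (simp add: g'_def fourier_def)
    then have g': "integrable lborel g'" "ift g = ift g'"
      using someI[of "\<lambda>g'. integrable lborel g' \<and> ift g = ift g'" g] g by auto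
    have z: "ift (\<lambda>k. g' k - g k) = (\<lambda>_. 0)"
      using inv_fourier_diff[OF g'(1) g] g'(2) by auto
    have "AE k in lborel. fourier_integral (ift (\<lambda>k. g' k - g k)) k = g' k - g k"
      using g g' z by (intro fourier_inversion) auto
    then have "AE k in lborel. g' k = g k"
      by eventually_elim (simp add: z fourier_integral_def)
    then have "(AE k in lborel. g' k = g k) \<and> g' \<in> borel_measurable borel" using g'(1) by simp
    then show ?thesis unfolding g'_def .
  qed
  then show "AE k in lborel. fourier (ift g) k = g k"
    and "fourier (ift g) \<in> borel_measurable borel" by auto
qed

text \<open>All operators of the equation are evaluated by this rule; it holds whichever branch of
  \<open>fourier\<close> is taken, so operators can be iterated.\<close>

lemma multiplier_inv_fourier:
  assumes g: "integrable lborel g" and [measurable]: "m \<in> borel_measurable borel"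
  shows "multiplier m (ift g) = ift (\<lambda>k. m k * g k)"
proof -
  note [measurable] = AE_fourier_inv_fourier(2)[OF g] borel_measurable_integrable[OF g]
  have "AE k in lborel. m k * fourier (ift g) k = m k * g k"
    using AE_fourier_inv_fourier(1)[OF g] by eventually_elim simp
  then show ?thesis unfolding multiplier_def by (rule inv_fourier_cong_AE) measurable
qed

lemma integrable_pair_iexp:
  fixes f g :: "real \<Rightarrow> complex" and \<phi> :: "real \<Rightarrow> real \<Rightarrow> real"
  assumes f: "integrable lborel f" and g: "integrable lborel g"
    and [measurable]: "(\<lambda>(x, y). \<phi> x y) \<in> borel_measurable (borel \<Otimes>\<^sub>M borel)"
  shows "integrable (lborel \<Otimes>\<^sub>M lborel) (\<lambda>(x, y). c * (f x * g y * iexp (\<phi> x y)))"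
proof -
  note [measurable] = borel_measurable_integrable[OF f] borel_measurable_integrable[OF g]
  have "integrable (lborel \<Otimes>\<^sub>M lborel) (\<lambda>(x, y). f x * g y)"
  proof (rule lborel_pair.Fubini_integrable)
    show "integrable lborel (\<lambda>x. LINT y|lborel. norm (case (x, y) of (x, y) \<Rightarrow> f x * g y))"
      using f g by (simp add: norm_mult)
  qed (use g in auto)
  then have "integrable (lborel \<Otimes>\<^sub>M lborel) (\<lambda>z. c * (case z of (x, y) \<Rightarrow> f x * g y))"
    by (rule integrable_mult_right)
  then show ?thesis
    by (rule Bochner_Integration.integrable_bound) (auto simp: norm_mult norm_exp_i_times)
qed

section \<open>Plancherel's inequality by Gaussian regularization\<close>

lemma integral_gaussian_iexp:
  assumes "\<sigma> > 0"
  shows "(LINT x|lborel. of_real (exp (- (x / \<sigma>)\<^sup>2 / 2)) * iexp (x * t))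
    = complex_of_real (2 * pi * normal_density 0 (1 / \<sigma>) t)"
proof -
  have "complex_of_real (exp (- ((\<sigma> * t)\<^sup>2) / 2)) = char std_normal_distribution (\<sigma> * t)"
    by (simp add: char_std_normal_distribution)
  also have "\<dots> = (CLBINT x. std_normal_density x *\<^sub>R iexp (\<sigma> * t * x))"
    unfolding char_def by (subst integral_density) auto
  also have "\<dots> = (1 / sqrt (2 * pi)) *\<^sub>R (CLBINT x. of_real (exp (- x\<^sup>2 / 2)) * iexp (\<sigma> * t * x))"
    by (subst integral_scaleR_right[symmetric]) (simp add: std_normal_density_def scaleR_conv_of_real)
  finally have 1: "(CLBINT x. of_real (exp (- x\<^sup>2 / 2)) * iexp (\<sigma> * t * x)) =
      of_real (sqrt (2 * pi) * exp (- ((\<sigma> * t)\<^sup>2) / 2))"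
    by (simp add: scaleR_conv_of_real divide_simps mult.commute)
  have "(LINT x|lborel. of_real (exp (- (x / \<sigma>)\<^sup>2 / 2)) * iexp (x * t))
    = \<bar>\<sigma>\<bar> *\<^sub>R (LINT x|lborel. of_real (exp (- ((0 + \<sigma> * x) / \<sigma>)\<^sup>2 / 2)) * iexp ((0 + \<sigma> * x) * t))"
    using assms by (intro lborel_integral_real_affine) auto
  also have "\<dots> = \<sigma> *\<^sub>R (CLBINT x. of_real (exp (- x\<^sup>2 / 2)) * iexp (\<sigma> * t * x))"
    using assms by (simp add: ac_simps)
  also have "\<dots> = of_real (\<sigma> * sqrt (2 * pi) * exp (- ((\<sigma> * t)\<^sup>2) / 2))"
    unfolding 1 by (simp add: scaleR_conv_of_real)
  also have "\<sigma> * sqrt (2 * pi) * exp (- ((\<sigma> * t)\<^sup>2) / 2) = 2 * pi * normal_density 0 (1 / \<sigma>) t"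
    using assms by (simp add: normal_density_def real_sqrt_mult real_sqrt_divide power_mult_distrib power_divide divide_simps
        mult.commute mult.left_commute)
  finally show ?thesis .
qed

lemma nn_integral_lborel_shift:
  fixes a :: real
  assumes [measurable]: "f \<in> borel_measurable borel"
  shows "(\<integral>\<^sup>+x. f (x - a) \<partial>lborel) = (\<integral>\<^sup>+x. f x \<partial>lborel)"
    and "(\<integral>\<^sup>+x. f (a - x) \<partial>lborel) = (\<integral>\<^sup>+x. f x \<partial>lborel)"
proof -
  show "(\<integral>\<^sup>+x. f (x - a) \<partial>lborel) = (\<integral>\<^sup>+x. f x \<partial>lborel)"
    by (subst nn_integral_real_affine[where c = 1 and t = "-a" and f = f]) auto
  show "(\<integral>\<^sup>+x. f (a - x) \<partial>lborel) = (\<integral>\<^sup>+x. f x \<partial>lborel)"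
    by (subst nn_integral_real_affine[where c = "-1" and t = "a" and f = f]) auto
qed

lemma norm_LINT_le_nn_integral:
  fixes f :: "'a \<Rightarrow> complex"
  shows "ennreal (norm (integral\<^sup>L M f)) \<le> (\<integral>\<^sup>+x. ennreal (norm (f x)) \<partial>M)"
  by (cases "integrable M f") (auto intro: integral_norm_bound_ennreal simp: not_integrable_integral_eq)

text \<open>The Gaussian weight makes every use of Fubini legitimate. It turns the left side into
  the quadratic form of g with kernel \<Gamma>(k - m) / (2 pi), where \<Gamma> is a nonnegative even
  function of mass 2 pi. Schur's test, here just 2ab <= a^2 + b^2 under the integral, bounds this
  form by the square integral of g.\<close>

lemma plancherel_gaussian:
  assumes g: "integrable lborel g" and \<sigma>: "\<sigma> > 0"
  shows "(\<integral>\<^sup>+x. ennreal (exp (- (x / \<sigma>)\<^sup>2 / 2) * (norm (ift g x))\<^sup>2) \<partial>lborel)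
    \<le> (\<integral>\<^sup>+k. ennreal ((norm (g k))\<^sup>2) \<partial>lborel)"
proof -
  let ?c = "complex_of_real (1 / sqrt (2 * pi))"
  let ?cr = "1 / sqrt (2 * pi)"
  have c2: "?cr * ?cr = 1 / (2 * pi)" by simp
  define G where "G = ift g"
  define \<gamma> where "\<gamma> x = complex_of_real (exp (- (x / \<sigma>)\<^sup>2 / 2))" for x
  define \<Gamma> where "\<Gamma> t = 2 * pi * normal_density 0 (1 / \<sigma>) t" for t
  have \<Gamma>0: "\<Gamma> t \<ge> 0" for t by (simp add: \<Gamma>_def)
  have [measurable]: "g \<in> borel_measurable borel" using g by simp
  have [measurable]: "G \<in> borel_measurable borel" unfolding G_def using g by measurable
  have [measurable]: "(\<lambda>x. cnj (G x)) \<in> borel_measurable borel" unfolding G_def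
    by (intro borel_measurable_continuous_onI continuous_on_cnj continuous_on_inv_fourier g)
  have [measurable]: "\<gamma> \<in> borel_measurable borel" unfolding \<gamma>_def[abs_def] by measurable
  have [measurable]: "\<Gamma> \<in> borel_measurable borel" unfolding \<Gamma>_def[abs_def] by measurable
  obtain B where B: "\<And>x. norm (G x) \<le> B" using norm_inv_fourier_le[OF g] unfolding G_def by blast
  have "integrable lborel (\<lambda>x. exp (- (x / \<sigma>)\<^sup>2 / 2))"
  proof -
    have "(\<lambda>x. exp (- (x / \<sigma>)\<^sup>2 / 2)) = (\<lambda>x. sqrt (2 * pi * \<sigma>\<^sup>2) * normal_density 0 \<sigma> x)"
      using \<sigma> by (auto simp: normal_density_def power_divide fun_eq_iff)
    then show ?thesis using \<sigma> by simp
  qed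
  then have \<gamma>i: "integrable lborel \<gamma>" unfolding \<gamma>_def by simp
  have \<gamma>t: "(LINT x|lborel. \<gamma> x * iexp (x * t)) = of_real (\<Gamma> t)" for t
    unfolding \<gamma>_def \<Gamma>_def using integral_gaussian_iexp[OF \<sigma>] by simp
  have \<Gamma>i: "(\<integral>\<^sup>+t. ennreal (\<Gamma> t) \<partial>lborel) = ennreal (2 * pi)"
  proof (subst nn_integral_eq_integral)
    show "integrable lborel \<Gamma>" unfolding \<Gamma>_def using \<sigma> by simp
    show "ennreal (integral\<^sup>L lborel \<Gamma>) = ennreal (2 * pi)" unfolding \<Gamma>_def using \<sigma> by simp
  qed (use \<Gamma>0 in auto)
  define I where "I k = (LINT x|lborel. \<gamma> x * cnj (G x) * iexp (x * k))" for k
  have I: "I k = ?c * (LINT m|lborel. cnj (g m) * of_real (\<Gamma> (k - m)))" for k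
  proof -
    have "I k = (LINT x|lborel. LINT m|lborel. ?c * (\<gamma> x * cnj (g m) * iexp (x * (k - m))))"
      unfolding I_def
    proof (intro Bochner_Integration.integral_cong refl)
      fix x
      have "cnj (G x) = ?c * (LINT m|lborel. cnj (g m * iexp (m * x)))"
        unfolding G_def inv_fourier_integral_def by (subst Bochner_Integration.integral_cnj) simp
      then have "\<gamma> x * cnj (G x) * iexp (x * k) = (?c * \<gamma> x * iexp (x * k)) * (LINT m|lborel. cnj (g m * iexp (m * x)))"
        by (simp add: ac_simps)
      also have "\<dots> = (LINT m|lborel. (?c * \<gamma> x * iexp (x * k)) * cnj (g m * iexp (m * x)))"
        by (rule integral_mult_right_zero[symmetric])
      also have "\<dots> = (LINT m|lborel. ?c * (\<gamma> x * cnj (g m) * iexp (x * (k - m))))"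
        by (intro Bochner_Integration.integral_cong refl)
          (simp add: exp_cnj ring_distribs exp_diff exp_minus divide_inverse mult.commute mult.left_commute)
      finally show "\<gamma> x * cnj (G x) * iexp (x * k) = (LINT m|lborel. ?c * (\<gamma> x * cnj (g m) * iexp (x * (k - m))))" .
    qed
    also have "\<dots> = (LINT m|lborel. LINT x|lborel. ?c * (\<gamma> x * cnj (g m) * iexp (x * (k - m))))"
    proof (rule lborel_pair.Fubini_integral[symmetric])
      show "integrable (lborel \<Otimes>\<^sub>M lborel) (\<lambda>(x, m). ?c * (\<gamma> x * cnj (g m) * iexp (x * (k - m))))"
        using g by (intro integrable_pair_iexp \<gamma>i) auto
    qed
    also have "\<dots> = (LINT m|lborel. ?c * (cnj (g m) * of_real (\<Gamma> (k - m))))"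
      unfolding \<gamma>t[symmetric] by (simp add: ac_simps flip: integral_mult_right_zero)
    finally show ?thesis by (simp only: integral_mult_right_zero)
  qed
  have J: "(LINT x|lborel. \<gamma> x * cnj (G x) * G x) = ?c * (LINT k|lborel. g k * I k)"
  proof -
    have "(LINT x|lborel. \<gamma> x * cnj (G x) * G x) = (LINT x|lborel. LINT k|lborel. ?c * ((\<gamma> x * cnj (G x)) * g k * iexp (x * k)))"
    proof (intro Bochner_Integration.integral_cong refl)
      fix x
      have "\<gamma> x * cnj (G x) * G x = (?c * \<gamma> x * cnj (G x)) * (LINT k|lborel. g k * iexp (k * x))"
        unfolding G_def inv_fourier_integral_def by (simp add: ac_simps)
      also have "\<dots> = (LINT k|lborel. (?c * \<gamma> x * cnj (G x)) * (g k * iexp (k * x)))"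
        by (rule integral_mult_right_zero[symmetric])
      finally show "\<gamma> x * cnj (G x) * G x = (LINT k|lborel. ?c * ((\<gamma> x * cnj (G x)) * g k * iexp (x * k)))"
        by (simp add: ac_simps)
    qed
    also have "\<dots> = (LINT k|lborel. LINT x|lborel. ?c * ((\<gamma> x * cnj (G x)) * g k * iexp (x * k)))"
    proof (rule lborel_pair.Fubini_integral[symmetric])
      have "integrable lborel (\<lambda>x. \<gamma> x * cnj (G x))"
      proof (rule Bochner_Integration.integrable_bound)
        show "integrable lborel (\<lambda>x. of_real B * \<gamma> x)" using \<gamma>i by simp
        show "AE x in lborel. norm (\<gamma> x * cnj (G x)) \<le> norm (of_real B * \<gamma> x)"
          using order_trans[OF B abs_ge_self] by (intro AE_I2) (simp add: norm_mult mult.commute mult_right_mono)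
      qed measurable
      then show "integrable (lborel \<Otimes>\<^sub>M lborel) (\<lambda>(x, k). ?c * ((\<gamma> x * cnj (G x)) * g k * iexp (x * k)))"
        using g by (intro integrable_pair_iexp) auto
    qed
    also have "\<dots> = (LINT k|lborel. ?c * (g k * I k))"
      unfolding I_def by (simp add: ac_simps flip: integral_mult_right_zero)
    finally show ?thesis by (simp only: integral_mult_right_zero)
  qed
  have nI: "ennreal (norm (g k * I k)) \<le> (\<integral>\<^sup>+m. ennreal (?cr * (norm (g k) * norm (g m) * \<Gamma> (k - m))) \<partial>lborel)" for k
  proof -
    have "g k * I k = (LINT m|lborel. ?c * g k * (cnj (g m) * of_real (\<Gamma> (k - m))))"
      unfolding I by (simp only: integral_mult_right_zero) (simp add: ac_simps)
    then have "ennreal (norm (g k * I k)) \<le> (\<integral>\<^sup>+m. ennreal (norm (?c * g k * (cnj (g m) * of_real (\<Gamma> (k - m))))) \<partial>lborel)"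
      by (simp only: norm_LINT_le_nn_integral)
    then show ?thesis using \<Gamma>0 by (simp add: norm_mult norm_divide ac_simps)
  qed
  \<comment> \<open>The prefactor 1 / (2 pi) halved by 2ab <= a^2 + b^2. Against the mass 2 pi of
    \<Gamma> each of the two squares contributes 1/2.\<close>
  let ?d = "1 / (4 * pi)"
  have half: "(\<integral>\<^sup>+k. \<integral>\<^sup>+m. ennreal (?d * ((norm (g k))\<^sup>2 * \<Gamma> (k - m))) \<partial>lborel \<partial>lborel) =
      ennreal (1 / 2) * (\<integral>\<^sup>+k. ennreal ((norm (g k))\<^sup>2) \<partial>lborel)"
  proof -
    have "(\<integral>\<^sup>+m. ennreal (?d * ((norm (g k))\<^sup>2 * \<Gamma> (k - m))) \<partial>lborel) = ennreal (1 / 2) * ennreal ((norm (g k))\<^sup>2)" for k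
    proof -
      have "(\<integral>\<^sup>+m. ennreal (?d * ((norm (g k))\<^sup>2 * \<Gamma> (k - m))) \<partial>lborel) =
        (\<integral>\<^sup>+m. ennreal (?d * (norm (g k))\<^sup>2) * ennreal (\<Gamma> (k - m)) \<partial>lborel)"
        using \<Gamma>0 by (intro nn_integral_cong) (simp add: ennreal_mult[symmetric] mult.assoc)
      also have "\<dots> = ennreal (?d * (norm (g k))\<^sup>2) * (\<integral>\<^sup>+m. ennreal (\<Gamma> m) \<partial>lborel)"
        by (subst nn_integral_cmult) (auto simp: nn_integral_lborel_shift(2)[of "\<lambda>x. ennreal (\<Gamma> x)"])
      also have "\<dots> = ennreal (?d * (norm (g k))\<^sup>2 * (2 * pi))"
        unfolding \<Gamma>i by (subst ennreal_mult[symmetric]) auto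
      also have "?d * (norm (g k))\<^sup>2 * (2 * pi) = 1 / 2 * (norm (g k))\<^sup>2" by simp
      also have "ennreal (1 / 2 * (norm (g k))\<^sup>2) = ennreal (1 / 2) * ennreal ((norm (g k))\<^sup>2)"
        by (rule ennreal_mult) auto
      finally show ?thesis .
    qed
    then show ?thesis by (simp add: nn_integral_cmult)
  qed
  have half': "(\<integral>\<^sup>+k. \<integral>\<^sup>+m. ennreal (?d * ((norm (g m))\<^sup>2 * \<Gamma> (k - m))) \<partial>lborel \<partial>lborel) =
      ennreal (1 / 2) * (\<integral>\<^sup>+k. ennreal ((norm (g k))\<^sup>2) \<partial>lborel)"
  proof -
    have sym: "\<Gamma> (k - m) = \<Gamma> (m - k)" for k m
      by (simp add: \<Gamma>_def normal_density_def power2_commute)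
    have "(\<integral>\<^sup>+k. \<integral>\<^sup>+m. ennreal (?d * ((norm (g m))\<^sup>2 * \<Gamma> (k - m))) \<partial>lborel \<partial>lborel) =
      (\<integral>\<^sup>+m. \<integral>\<^sup>+k. ennreal (?d * ((norm (g m))\<^sup>2 * \<Gamma> (k - m))) \<partial>lborel \<partial>lborel)"
      by (rule lborel_pair.Fubini'[symmetric]) measurable
    then show ?thesis using half by (simp add: sym)
  qed
  have \<gamma>B: "integrable lborel (\<lambda>x. exp (- (x / \<sigma>)\<^sup>2 / 2) * (norm (G x))\<^sup>2)"
  proof (rule Bochner_Integration.integrable_bound)
    show "integrable lborel (\<lambda>x. B\<^sup>2 * norm (\<gamma> x))" using \<gamma>i by simp
    show "AE x in lborel. norm (exp (- (x / \<sigma>)\<^sup>2 / 2) * (norm (G x))\<^sup>2) \<le> norm (B\<^sup>2 * norm (\<gamma> x))"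
      using B by (intro AE_I2) (auto simp: \<gamma>_def norm_mult mult.commute intro!: mult_right_mono power_mono)
  qed measurable
  have "(\<integral>\<^sup>+x. ennreal (exp (- (x / \<sigma>)\<^sup>2 / 2) * (norm (G x))\<^sup>2) \<partial>lborel)
    = ennreal (LBINT x. exp (- (x / \<sigma>)\<^sup>2 / 2) * (norm (G x))\<^sup>2)"
    by (rule nn_integral_eq_integral[OF \<gamma>B]) auto
  also have "\<dots> = ennreal (norm (LINT x|lborel. \<gamma> x * cnj (G x) * G x))"
  proof -
    have "(LINT x|lborel. \<gamma> x * cnj (G x) * G x) = (LINT x|lborel. complex_of_real (exp (- (x / \<sigma>)\<^sup>2 / 2) * (norm (G x))\<^sup>2))"
      unfolding \<gamma>_def by (intro Bochner_Integration.integral_cong refl) (simp only: of_real_mult mult.assoc complex_norm_square mult.commute[of "cnj _"])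
    also have "\<dots> = complex_of_real (LBINT x. exp (- (x / \<sigma>)\<^sup>2 / 2) * (norm (G x))\<^sup>2)"
      by (rule integral_complex_of_real)
    finally show ?thesis by (simp del: of_real_mult)
  qed
  also have "\<dots> = ennreal ?cr * ennreal (norm (LINT k|lborel. g k * I k))"
    unfolding J by (simp add: norm_mult norm_divide flip: ennreal_mult)
  also have "\<dots> \<le> ennreal ?cr * (\<integral>\<^sup>+k. ennreal (norm (g k * I k)) \<partial>lborel)"
    by (intro mult_left_mono norm_LINT_le_nn_integral) simp
  also have "\<dots> \<le> ennreal ?cr * (\<integral>\<^sup>+k. \<integral>\<^sup>+m. ennreal (?cr * (norm (g k) * norm (g m) * \<Gamma> (k - m))) \<partial>lborel \<partial>lborel)"
    by (intro mult_left_mono nn_integral_mono nI) simp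
  also have "\<dots> = (\<integral>\<^sup>+k. \<integral>\<^sup>+m. ennreal ?cr * ennreal (?cr * (norm (g k) * norm (g m) * \<Gamma> (k - m))) \<partial>lborel \<partial>lborel)"
    by (simp add: nn_integral_cmult del: ennreal_mult')
  also have "\<dots> \<le> (\<integral>\<^sup>+k. \<integral>\<^sup>+m. ennreal (?d * ((norm (g k))\<^sup>2 * \<Gamma> (k - m))) + ennreal (?d * ((norm (g m))\<^sup>2 * \<Gamma> (k - m))) \<partial>lborel \<partial>lborel)"
  proof (intro nn_integral_mono)
    fix k m :: real
    have "2 * (norm (g k) * norm (g m)) \<le> (norm (g k))\<^sup>2 + (norm (g m))\<^sup>2"
      using sum_squares_bound[of "norm (g k)" "norm (g m)"] by simp
    from mult_right_mono[OF this \<Gamma>0[of "k - m"]]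
    have "norm (g k) * norm (g m) * \<Gamma> (k - m) \<le> ((norm (g k))\<^sup>2 * \<Gamma> (k - m) + (norm (g m))\<^sup>2 * \<Gamma> (k - m)) / 2"
      by (simp add: algebra_simps)
    from mult_left_mono[OF this, of "1 / (2 * pi)"]
    have "1 / (2 * pi) * (norm (g k) * norm (g m) * \<Gamma> (k - m)) \<le>
        ?d * ((norm (g k))\<^sup>2 * \<Gamma> (k - m)) + ?d * ((norm (g m))\<^sup>2 * \<Gamma> (k - m))"
      by (simp add: algebra_simps add_divide_distrib)
    moreover have "ennreal ?cr * ennreal (?cr * (norm (g k) * norm (g m) * \<Gamma> (k - m))) = ennreal (1 / (2 * pi) * (norm (g k) * norm (g m) * \<Gamma> (k - m)))"
      unfolding c2[symmetric] using \<Gamma>0 by (subst ennreal_mult[symmetric]) (simp_all only: mult.assoc, auto)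
    ultimately show "ennreal ?cr * ennreal (?cr * (norm (g k) * norm (g m) * \<Gamma> (k - m))) \<le>
       ennreal (?d * ((norm (g k))\<^sup>2 * \<Gamma> (k - m))) + ennreal (?d * ((norm (g m))\<^sup>2 * \<Gamma> (k - m)))"
      using \<Gamma>0 by (subst ennreal_plus[symmetric]) (auto intro!: ennreal_leI simp del: ennreal_plus)
  qed
  also have "\<dots> = (\<integral>\<^sup>+k. \<integral>\<^sup>+m. ennreal (?d * ((norm (g k))\<^sup>2 * \<Gamma> (k - m))) \<partial>lborel \<partial>lborel) +
     (\<integral>\<^sup>+k. \<integral>\<^sup>+m. ennreal (?d * ((norm (g m))\<^sup>2 * \<Gamma> (k - m))) \<partial>lborel \<partial>lborel)"
    by (simp add: nn_integral_add)
  also have "\<dots> = (ennreal (1/2) + ennreal (1/2)) * (\<integral>\<^sup>+k. ennreal ((norm (g k))\<^sup>2) \<partial>lborel)"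
    unfolding half half' by (rule distrib_right[symmetric])
  also have "ennreal (1/2) + ennreal (1/2) = ennreal (1/2 + 1/2)" by (rule ennreal_plus[symmetric]) auto
  finally show ?thesis by (simp add: G_def)
qed

text \<open>The Gaussian bound does not depend on the width, so Fatou's lemma applies as the width
  tends to infinity.\<close>

lemma plancherel_le:
  assumes g: "integrable lborel g"
  shows "(\<integral>\<^sup>+x. ennreal ((norm (ift g x))\<^sup>2) \<partial>lborel) \<le> (\<integral>\<^sup>+k. ennreal ((norm (g k))\<^sup>2) \<partial>lborel)"
proof -
  let ?u = "\<lambda>n x. ennreal (exp (- (x / real (Suc n))\<^sup>2 / 2) * (norm (ift g x))\<^sup>2)"
  have lim: "(\<lambda>n. ?u n x) \<longlonglongrightarrow> ennreal ((norm (ift g x))\<^sup>2)" for x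
  proof -
    have "(\<lambda>n. x / real (Suc n)) \<longlonglongrightarrow> 0"
      by (intro LIMSEQ_Suc lim_const_over_n)
    then have "(\<lambda>n. exp (- (x / real (Suc n))\<^sup>2 / 2) * (norm (ift g x))\<^sup>2) \<longlonglongrightarrow> exp (- 0\<^sup>2 / 2) * (norm (ift g x))\<^sup>2"
      by (intro tendsto_intros) auto
    then show ?thesis by (intro tendsto_ennrealI) simp
  qed
  have "(\<integral>\<^sup>+x. ennreal ((norm (ift g x))\<^sup>2) \<partial>lborel) = (\<integral>\<^sup>+x. liminf (\<lambda>n. ?u n x) \<partial>lborel)"
    by (intro nn_integral_cong lim_imp_Liminf[OF _ lim, symmetric]) simp
  also have "\<dots> \<le> liminf (\<lambda>n. \<integral>\<^sup>+x. ?u n x \<partial>lborel)"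
    using g by (intro nn_integral_liminf) measurable
  also have "\<dots> \<le> liminf (\<lambda>n::nat. \<integral>\<^sup>+k. ennreal ((norm (g k))\<^sup>2) \<partial>lborel)"
    by (intro Liminf_mono always_eventually allI plancherel_gaussian[OF g]) auto
  finally show ?thesis by (simp add: Liminf_const)
qed

section \<open>Convolutions and integrable kernels\<close>

lemma nn_integral_inverse_one_plus_square:
  "(\<integral>\<^sup>+x. ennreal (1 / (1 + x\<^sup>2)) \<partial>lborel) = ennreal pi"
  and integrable_inverse_one_plus_square: "integrable lborel (\<lambda>x::real. 1 / (1 + x\<^sup>2))"
  and integral_inverse_one_plus_square: "(LBINT x. 1 / (1 + x\<^sup>2)) = pi"
proof -
  show i: "integrable lborel (\<lambda>x::real. 1 / (1 + x\<^sup>2))"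
    using integrable_inverse_1_plus_square by (simp add: set_integrable_def inverse_eq_divide einterval_def)
  show v: "(LBINT x. 1 / (1 + x\<^sup>2)) = pi"
    using LBINT_inverse_1_plus_square
    by (simp add: interval_lebesgue_integral_def set_lebesgue_integral_def inverse_eq_divide einterval_def)
  show "(\<integral>\<^sup>+x. ennreal (1 / (1 + x\<^sup>2)) \<partial>lborel) = ennreal pi"
    by (subst nn_integral_eq_integral[OF i]) (auto simp: v)
qed

text \<open>By Plancherel, the Lipschitz bound controls \<open>x\<close> times the transform in \<open>L\<^sup>2\<close>;
  difference quotients are used so that no derivative of \<open>n\<close> has to exist.\<close>

lemma nn_integral_inv_fourier_Lipschitz:
  fixes n :: "real \<Rightarrow> complex" and G :: "real \<Rightarrow> real"
  assumes n: "integrable lborel n" and [measurable]: "G \<in> borel_measurable borel"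
    and G: "\<And>k. norm (n k) \<le> G k"
    and Lip: "\<And>h k. 0 < h \<Longrightarrow> h \<le> 1 \<Longrightarrow> norm (n (k + h) - n k) \<le> h * G k"
  shows "L1n (ift n)
     \<le> ennreal pi + 2 * (\<integral>\<^sup>+k. ennreal ((G k)\<^sup>2) \<partial>lborel)"
proof -
  define f where "f = ift n"
  have [measurable]: "f \<in> borel_measurable borel" unfolding f_def using n by measurable
  have G0: "G k \<ge> 0" for k using G[of k] norm_ge_zero[of "n k"] by linarith
  let ?G2 = "\<integral>\<^sup>+k. ennreal ((G k)\<^sup>2) \<partial>lborel"
  have f2: "(\<integral>\<^sup>+x. ennreal ((norm (f x))\<^sup>2) \<partial>lborel) \<le> ?G2"
    unfolding f_def using G
    by (intro order_trans[OF plancherel_le[OF n]] nn_integral_mono ennreal_leI power_mono) auto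
  \<comment> \<open>Shifting n by h = 1 / (j + 1) multiplies its transform by exp (-ixh). So
    \<open>q j\<close> is the squared factor by which the difference quotient of n with step h acts
    on the transform; it tends to x^2.\<close>
  define q where "q j x = (norm ((iexp (- (x / real (Suc j))) - 1) * real (Suc j)))\<^sup>2" for j x
  have qf: "(\<integral>\<^sup>+x. ennreal (q j x * (norm (f x))\<^sup>2) \<partial>lborel) \<le> ?G2" for j
  proof -
    define h where "h = 1 / real (Suc j)"
    have h: "0 < h" "h \<le> 1" by (auto simp: h_def divide_simps)
    have ni: "integrable lborel (\<lambda>k. n (k + h))"
      using lborel_integrable_real_affine[OF n, of 1 h] by (simp add: add.commute)
    have shift: "ift (\<lambda>k. n (k + h)) x = iexp (- (x * h)) * f x" for x
    proof -
      have "(LINT k|lborel. n (k + h) * iexp (k * x)) = (LINT k|lborel. iexp (- (x * h)) * (n (h + 1 * k) * iexp ((h + 1 * k) * x)))"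
        by (intro Bochner_Integration.integral_cong refl)
           (simp add: add.commute ring_distribs exp_add exp_minus divide_inverse mult.commute mult.left_commute)
      also have "\<dots> = iexp (- (x * h)) * (LINT k|lborel. n (h + 1 * k) * iexp ((h + 1 * k) * x))"
        by (rule integral_mult_right_zero)
      also have "(LINT k|lborel. n (h + 1 * k) * iexp ((h + 1 * k) * x)) = (LINT k|lborel. n k * iexp (k * x))"
        using lborel_integral_real_affine[of 1 "\<lambda>k. n k * iexp (k * x)" h] by simp
      finally show ?thesis unfolding f_def inv_fourier_integral_def by simp
    qed
    have eq: "ift (\<lambda>k. (n (k + h) - n k) * of_real (1 / h)) x = (iexp (- (x / real (Suc j))) - 1) * real (Suc j) * f x" for x
    proof -
      have "ift (\<lambda>k. of_real (1 / h) * (n (k + h) - n k)) x = of_real (1 / h) * (iexp (- (x * h)) * f x - f x)"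
        unfolding inv_fourier_cmult using n ni by (simp add: inv_fourier_diff shift f_def)
      then show ?thesis by (simp add: h_def mult.commute algebra_simps)
    qed
    have "(\<integral>\<^sup>+x. ennreal (q j x * (norm (f x))\<^sup>2) \<partial>lborel)
      = (\<integral>\<^sup>+x. ennreal ((norm (ift (\<lambda>k. (n (k + h) - n k) * of_real (1 / h)) x))\<^sup>2) \<partial>lborel)"
      unfolding eq q_def norm_mult power_mult_distrib ..
    also have "\<dots> \<le> (\<integral>\<^sup>+k. ennreal ((norm ((n (k + h) - n k) * of_real (1 / h)))\<^sup>2) \<partial>lborel)"
      using n ni by (intro plancherel_le) auto
    also have "\<dots> \<le> ?G2"
    proof (intro nn_integral_mono ennreal_leI power_mono)
      fix k
      have "norm ((n (k + h) - n k) * of_real (1 / h)) = norm (n (k + h) - n k) / h"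
        using h by (simp add: norm_mult norm_divide)
      also have "\<dots> \<le> G k" using Lip[OF h, of k] h by (simp add: divide_le_eq mult.commute)
      finally show "norm ((n (k + h) - n k) * of_real (1 / h)) \<le> G k" .
    qed auto
    finally show ?thesis .
  qed
  have qlim: "(\<lambda>j. q j x) \<longlonglongrightarrow> x\<^sup>2" for x
  proof -
    have "((\<lambda>z. exp (- (\<i> * of_real x) * z)) has_field_derivative (- (\<i> * of_real x))) (at 0)"
      by (auto intro!: derivative_eq_intros)
    then have "((\<lambda>z. (exp (- (\<i> * of_real x) * z) - 1) / z) \<longlongrightarrow> - (\<i> * of_real x)) (at 0)"
      by (simp add: has_field_derivative_iff)
    moreover have "filterlim (\<lambda>j. complex_of_real (1 / real (Suc j))) (at 0) sequentially"
    proof (rule filterlim_atI)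
      show "(\<lambda>j. complex_of_real (1 / real (Suc j))) \<longlonglongrightarrow> 0"
        using tendsto_of_real[OF LIMSEQ_Suc[OF lim_1_over_n], where 'a = complex] by simp
      show "\<forall>\<^sub>F j in sequentially. complex_of_real (1 / real (Suc j)) \<noteq> 0"
        by (intro always_eventually allI) (simp del: of_nat_Suc)
    qed
    ultimately have "(\<lambda>j. (exp (- (\<i> * of_real x) * complex_of_real (1 / real (Suc j))) - 1) / complex_of_real (1 / real (Suc j))) \<longlonglongrightarrow> - (\<i> * of_real x)"
      by (rule filterlim_compose)
    then have "(\<lambda>j. (norm ((exp (- (\<i> * of_real x) * complex_of_real (1 / real (Suc j))) - 1) / complex_of_real (1 / real (Suc j))))\<^sup>2) \<longlonglongrightarrow> (norm (- (\<i> * complex_of_real x)))\<^sup>2"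
      by (intro tendsto_intros)
    then show ?thesis by (simp add: q_def norm_mult)
  qed
  have [measurable]: "q j \<in> borel_measurable borel" for j unfolding q_def[abs_def] by measurable
  have x2f: "(\<integral>\<^sup>+x. ennreal (x\<^sup>2 * (norm (f x))\<^sup>2) \<partial>lborel) \<le> ?G2"
  proof -
    have "(\<integral>\<^sup>+x. ennreal (x\<^sup>2 * (norm (f x))\<^sup>2) \<partial>lborel) = (\<integral>\<^sup>+x. liminf (\<lambda>j. ennreal (q j x * (norm (f x))\<^sup>2)) \<partial>lborel)"
      by (intro nn_integral_cong lim_imp_Liminf[symmetric] tendsto_ennrealI tendsto_mult_right qlim) simp
    also have "\<dots> \<le> liminf (\<lambda>j. \<integral>\<^sup>+x. ennreal (q j x * (norm (f x))\<^sup>2) \<partial>lborel)"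
      by (intro nn_integral_liminf) measurable
    also have "\<dots> \<le> liminf (\<lambda>j::nat. ?G2)"
      by (intro Liminf_mono always_eventually allI qf)
    finally show ?thesis by (simp add: Liminf_const)
  qed
  have "L1n f \<le> (\<integral>\<^sup>+x. (ennreal (1 / (1 + x\<^sup>2)) + ennreal (x\<^sup>2 * (norm (f x))\<^sup>2)) + ennreal ((norm (f x))\<^sup>2) \<partial>lborel)"
  proof (intro nn_integral_mono)
    fix x
    \<comment> \<open>Where |f| exceeds 1 / (1 + x^2), multiplying 1 <= (1 + x^2) |f| by |f| gives
      |f| <= (1 + x^2) |f|^2. This replaces the Cauchy-Schwarz inequality.\<close>
    have "norm (f x) \<le> 1 / (1 + x\<^sup>2) + x\<^sup>2 * (norm (f x))\<^sup>2 + (norm (f x))\<^sup>2"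
    proof (cases "norm (f x) \<le> 1 / (1 + x\<^sup>2)")
      case True
      then show ?thesis by (smt (verit) mult_nonneg_nonneg zero_le_power2)
    next
      case False
      have p: "0 < 1 + x\<^sup>2" by (simp add: add_pos_nonneg)
      from False have "1 \<le> (1 + x\<^sup>2) * norm (f x)" using p by (simp add: divide_simps mult.commute)
      from mult_right_mono[OF this, of "norm (f x)"]
      have "norm (f x) \<le> x\<^sup>2 * (norm (f x))\<^sup>2 + (norm (f x))\<^sup>2" by (simp add: algebra_simps power2_eq_square)
      moreover have "0 \<le> 1 / (1 + x\<^sup>2)" using p by simp
      ultimately show ?thesis by linarith
    qed
    then show "ennreal (norm (f x)) \<le> (ennreal (1 / (1 + x\<^sup>2)) + ennreal (x\<^sup>2 * (norm (f x))\<^sup>2)) + ennreal ((norm (f x))\<^sup>2)"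
      by (simp add: ennreal_leI flip: ennreal_plus)
  qed
  also have "\<dots> = (\<integral>\<^sup>+x. ennreal (1 / (1 + x\<^sup>2)) \<partial>lborel) + (\<integral>\<^sup>+x. ennreal (x\<^sup>2 * (norm (f x))\<^sup>2) \<partial>lborel) + (\<integral>\<^sup>+x. ennreal ((norm (f x))\<^sup>2) \<partial>lborel)"
    by (simp add: nn_integral_add)
  also have "\<dots> \<le> ennreal pi + ?G2 + ?G2"
    unfolding nn_integral_inverse_one_plus_square by (intro add_mono x2f f2 order_refl)
  finally show ?thesis unfolding f_def by (simp add: mult_2 add.assoc)
qed

section \<open>Convolutions and their transforms\<close>

definition conv :: "(real \<Rightarrow> complex) \<Rightarrow> (real \<Rightarrow> complex) \<Rightarrow> real \<Rightarrow> complex" where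
  "conv P Q k = (LINT m|lborel. P (k - m) * Q m)"

lemma integrable_conv_pair:
  fixes P Q :: "real \<Rightarrow> complex"
  assumes P: "integrable lborel P" and Q: "integrable lborel Q"
  shows "integrable (lborel \<Otimes>\<^sub>M lborel) (\<lambda>(m, k). P (k - m) * Q m)"
    and "integrable (lborel \<Otimes>\<^sub>M lborel) (\<lambda>(k, m). P (k - m) * Q m)"
proof -
  note [measurable] = borel_measurable_integrable[OF P] borel_measurable_integrable[OF Q]
  have Ps: "integrable lborel (\<lambda>k. P (k - m))" for m
    using lborel_integrable_real_affine[OF P, of 1 "-m"] by (simp add: add.commute)
  have Pn: "(LINT k|lborel. norm (P (k - m))) = (LINT k|lborel. norm (P k))" for m
    using lborel_integral_real_affine[of 1 "\<lambda>k. norm (P k)" "-m"] by (simp add: add.commute)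
  show "integrable (lborel \<Otimes>\<^sub>M lborel) (\<lambda>(m, k). P (k - m) * Q m)"
  proof (rule lborel_pair.Fubini_integrable)
    show "integrable lborel (\<lambda>m. LINT k|lborel. norm (case (m, k) of (m, k) \<Rightarrow> P (k - m) * Q m))"
      using Q by (simp add: norm_mult Pn)
    show "AE m in lborel. integrable lborel (\<lambda>k. case (m, k) of (m, k) \<Rightarrow> P (k - m) * Q m)"
      using Ps by simp
  qed measurable
  from lborel_pair.integrable_product_swap[OF this]
  show "integrable (lborel \<Otimes>\<^sub>M lborel) (\<lambda>(k, m). P (k - m) * Q m)" by simp
qed

lemma integrable_conv:
  assumes "integrable lborel P" "integrable lborel Q"
  shows "integrable lborel (conv P Q)"
  unfolding conv_def[abs_def] using lborel_pair.integrable_fst[OF integrable_conv_pair(2)[OF assms]] .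

lemma nn_integral_conv_le:
  assumes [measurable]: "P \<in> borel_measurable borel" "Q \<in> borel_measurable borel"
  shows "L1n (conv P Q) \<le> L1n P * L1n Q"
proof -
  have "L1n (conv P Q) \<le> (\<integral>\<^sup>+k. \<integral>\<^sup>+m. ennreal (norm (P (k - m) * Q m)) \<partial>lborel \<partial>lborel)"
    unfolding conv_def by (intro nn_integral_mono norm_LINT_le_nn_integral)
  also have "\<dots> = (\<integral>\<^sup>+m. \<integral>\<^sup>+k. ennreal (norm (P (k - m) * Q m)) \<partial>lborel \<partial>lborel)"
    by (rule lborel_pair.Fubini') measurable
  also have "\<dots> = (\<integral>\<^sup>+m. (\<integral>\<^sup>+k. ennreal (norm (P (k - m))) \<partial>lborel) * ennreal (norm (Q m)) \<partial>lborel)"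
    by (simp add: norm_mult ennreal_mult nn_integral_multc)
  also have "\<dots> = L1n P * L1n Q"
    by (simp add: nn_integral_lborel_shift(1)[of "\<lambda>k. ennreal (norm (P k))"] nn_integral_cmult)
  finally show ?thesis .
qed

lemma inv_fourier_conv:
  assumes P: "integrable lborel P" and Q: "integrable lborel Q"
  shows "ift (conv P Q) x = of_real (sqrt (2 * pi)) * (ift P x * ift Q x)"
proof -
  note [measurable] = borel_measurable_integrable[OF P] borel_measurable_integrable[OF Q]
  have "(LINT k|lborel. conv P Q k * iexp (k * x)) = (LINT k|lborel. LINT m|lborel. P (k - m) * Q m * iexp (k * x))"
    unfolding conv_def by simp
  also have "\<dots> = (LINT m|lborel. LINT k|lborel. P (k - m) * Q m * iexp (k * x))"
  proof (rule lborel_pair.Fubini_integral[symmetric])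
    show "integrable (lborel \<Otimes>\<^sub>M lborel) (\<lambda>(k, m). P (k - m) * Q m * iexp (k * x))"
      by (rule Bochner_Integration.integrable_bound[OF integrable_conv_pair(2)[OF P Q]])
        (auto simp: norm_mult norm_exp_i_times)
  qed
  also have "\<dots> = (LINT m|lborel. Q m * iexp (m * x) * (LINT k|lborel. P k * iexp (k * x)))"
  proof (intro Bochner_Integration.integral_cong refl)
    fix m
    have "(LINT k|lborel. P (k - m) * Q m * iexp (k * x)) = (LINT k|lborel. Q m * iexp (m * x) * (P (- m + 1 * k) * iexp ((- m + 1 * k) * x)))"
      by (intro Bochner_Integration.integral_cong refl)
        (simp add: ring_distribs exp_add exp_diff exp_minus divide_inverse mult.commute mult.left_commute)
    also have "\<dots> = Q m * iexp (m * x) * (LINT k|lborel. P (- m + 1 * k) * iexp ((- m + 1 * k) * x))"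
      by (rule integral_mult_right_zero)
    also have "(LINT k|lborel. P (- m + 1 * k) * iexp ((- m + 1 * k) * x)) = (LINT k|lborel. P k * iexp (k * x))"
      using lborel_integral_real_affine[of 1 "\<lambda>k. P k * iexp (k * x)" "-m"] by simp
    finally show "(LINT k|lborel. P (k - m) * Q m * iexp (k * x)) = Q m * iexp (m * x) * (LINT k|lborel. P k * iexp (k * x))" .
  qed
  also have "\<dots> = (LINT m|lborel. Q m * iexp (m * x)) * (LINT k|lborel. P k * iexp (k * x))"
    by (rule integral_mult_left_zero)
  finally have 1: "(LINT k|lborel. conv P Q k * iexp (k * x)) = (LINT m|lborel. Q m * iexp (m * x)) * (LINT k|lborel. P k * iexp (k * x))" .
  have "1 = sqrt (2 * pi) * (1 / sqrt (2 * pi))" by simp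
  then have 2: "1 = complex_of_real (sqrt (2 * pi)) * complex_of_real (1 / sqrt (2 * pi))"
    by (metis of_real_1 of_real_mult)
  have "ift (conv P Q) x =
     of_real (1 / sqrt (2 * pi)) * (1 * ((LINT m|lborel. Q m * iexp (m * x)) * (LINT k|lborel. P k * iexp (k * x))))"
    unfolding inv_fourier_integral_def 1 by simp
  then show ?thesis unfolding inv_fourier_integral_def by (subst (asm) 2) (simp only: ac_simps)
qed

text \<open>A multiplier n applied to an integrable function r is a convolution of r with the kernel
  \<open>ift n\<close>, so an integrable kernel preserves integrability in x.\<close>

lemma inv_fourier_mult_fourier:
  assumes n: "integrable lborel n" and r: "integrable lborel r"
  shows "ift (\<lambda>k. n k * fourier_integral r k) x = of_real (1 / sqrt (2 * pi)) * conv (ift n) r x"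
proof -
  note [measurable] = borel_measurable_integrable[OF n] borel_measurable_integrable[OF r]
  let ?c = "complex_of_real (1 / sqrt (2 * pi))"
  have "(LINT k|lborel. n k * fourier_integral r k * iexp (k * x)) = (LINT k|lborel. LINT y|lborel. ?c * (n k * r y * iexp (k * (x - y))))"
  proof (intro Bochner_Integration.integral_cong refl)
    fix k
    have "n k * fourier_integral r k * iexp (k * x) = (?c * n k * iexp (k * x)) * (LINT y|lborel. r y * exp (- (\<i> * of_real (k * y))))"
      unfolding fourier_integral_def by (simp only: ac_simps)
    also have "\<dots> = (LINT y|lborel. (?c * n k * iexp (k * x)) * (r y * exp (- (\<i> * of_real (k * y)))))"
      by (rule integral_mult_right_zero[symmetric])
    also have "\<dots> = (LINT y|lborel. ?c * (n k * r y * iexp (k * (x - y))))"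
      by (intro Bochner_Integration.integral_cong refl)
        (simp add: ring_distribs exp_diff exp_minus divide_inverse mult.commute mult.left_commute)
    finally show "n k * fourier_integral r k * iexp (k * x) = (LINT y|lborel. ?c * (n k * r y * iexp (k * (x - y))))" .
  qed
  also have "\<dots> = (LINT y|lborel. LINT k|lborel. ?c * (n k * r y * iexp (k * (x - y))))"
    by (rule lborel_pair.Fubini_integral[symmetric], rule integrable_pair_iexp[OF n r]) measurable
  also have "\<dots> = (LINT y|lborel. ift n (x - y) * r y)"
  proof (intro Bochner_Integration.integral_cong refl)
    fix y
    have "(LINT k|lborel. ?c * (n k * r y * iexp (k * (x - y)))) = (LINT k|lborel. (?c * r y) * (n k * iexp (k * (x - y))))"
      by (simp only: ac_simps)
    also have "\<dots> = (?c * r y) * (LINT k|lborel. n k * iexp (k * (x - y)))"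
      by (rule integral_mult_right_zero)
    finally show "(LINT k|lborel. ?c * (n k * r y * iexp (k * (x - y)))) = ift n (x - y) * r y"
      unfolding inv_fourier_integral_def by (simp only: ac_simps)
  qed
  finally show ?thesis unfolding inv_fourier_integral_def[of "\<lambda>k. n k * fourier_integral r k"] conv_def by simp
qed

text \<open>This is the envelope that remains of the solution's exp (-2|k|) / (1 + k^2) after one
  unit of the exponent has paid for a polynomial symbol. The other unit absorbs a further factor k,
  or cosh k in the estimates in x.\<close>

definition decays :: "real \<Rightarrow> (real \<Rightarrow> complex) \<Rightarrow> bool" where
  "decays B P \<longleftrightarrow> P \<in> borel_measurable borel \<and> (\<forall>k. norm (P k) \<le> B * exp (- \<bar>k\<bar>) / (1 + k\<^sup>2))"

lemma one_plus_square_pos: "0 < 1 + (k::real)\<^sup>2"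
  by (simp add: add_pos_nonneg)

lemma decaysD:
  assumes "decays B P"
  shows "P \<in> borel_measurable borel" "norm (P k) \<le> B * exp (- \<bar>k\<bar>) / (1 + k\<^sup>2)" "B \<ge> 0"
    "norm (P k) \<le> B / (1 + k\<^sup>2)" "norm (P k) \<le> B"
proof -
  show 1: "P \<in> borel_measurable borel" "norm (P k) \<le> B * exp (- \<bar>k\<bar>) / (1 + k\<^sup>2)" for k
    using assms by (auto simp: decays_def)
  from 1(2)[of 0] show B: "B \<ge> 0" using order_trans[OF norm_ge_zero 1(2)[of 0]] by simp
  have "B * exp (- \<bar>k\<bar>) \<le> B" using B by (simp add: mult_left_le)
  then show 2: "norm (P k) \<le> B / (1 + k\<^sup>2)"
    using 1(2)[of k] one_plus_square_pos[of k] by (meson divide_right_mono less_imp_le order_trans)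
  have "B / (1 + k\<^sup>2) \<le> B" using B one_plus_square_pos[of k] by (simp add: divide_le_eq mult_le_cancel_left1)
  with 2 show "norm (P k) \<le> B" by simp
qed

lemma integrable_decays:
  assumes "decays B P" shows "integrable lborel P"
  by (rule Bochner_Integration.integrable_bound[OF integrable_mult_right[OF integrable_inverse_one_plus_square, of B]])
    (use decaysD[OF assms] in \<open>auto intro: order_trans[OF _ abs_ge_self]\<close>)

lemma decays_mono: "decays B P \<Longrightarrow> B \<le> B' \<Longrightarrow> decays B' P"
  unfolding decays_def
  by (meson divide_right_mono exp_ge_zero mult_right_mono one_plus_square_pos order_trans less_imp_le)

lemma decays_mult:
  assumes "decays B P" "m \<in> borel_measurable borel" "\<And>k. norm (m k) \<le> A"
  shows "decays (A * B) (\<lambda>k. m k * P k)"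
  unfolding decays_def
proof (intro conjI allI)
  note [measurable] = decaysD(1)[OF assms(1)] assms(2)
  show "(\<lambda>k. m k * P k) \<in> borel_measurable borel" by measurable
  fix k
  have "norm (m k * P k) \<le> A * (B * exp (- \<bar>k\<bar>) / (1 + k\<^sup>2))"
    unfolding norm_mult using decaysD(2)[OF assms(1), of k] assms(3)[of k]
    by (intro mult_mono) (auto intro: order_trans[OF norm_ge_zero])
  then show "norm (m k * P k) \<le> A * B * exp (- \<bar>k\<bar>) / (1 + k\<^sup>2)" by (simp add: mult.assoc)
qed

lemma decays_sgn: "decays B P \<Longrightarrow> decays B (\<lambda>k. of_real (sgn k) * P k)"
  using decays_mult[of B P "\<lambda>k. of_real (sgn k)" 1] by (simp add: sgn_real_def)

lemma integrable_decays_mult: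
  assumes "decays B P"
  shows "integrable lborel (\<lambda>k. of_real k * P k)"
proof (rule Bochner_Integration.integrable_bound[OF integrable_mult_right[OF integrable_inverse_one_plus_square, of B]])
  note [measurable] = decaysD(1)[OF assms]
  show "(\<lambda>k. of_real k * P k) \<in> borel_measurable lborel" by measurable
  have "norm (of_real k * P k) \<le> B * (1 / (1 + k\<^sup>2))" for k
  proof -
    have "\<bar>k\<bar> \<le> exp \<bar>k\<bar>" using exp_ge_add_one_self[of "\<bar>k\<bar>"] by linarith
    then have "\<bar>k\<bar> * exp (- \<bar>k\<bar>) \<le> 1" by (simp add: exp_minus divide_simps)
    then have "B * (\<bar>k\<bar> * exp (- \<bar>k\<bar>)) \<le> B" using decaysD(3)[OF assms] by (rule mult_left_le)
    have "norm (of_real k * P k) \<le> \<bar>k\<bar> * (B * exp (- \<bar>k\<bar>) / (1 + k\<^sup>2))"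
      unfolding norm_mult norm_of_real by (intro mult_left_mono decaysD(2)[OF assms]) auto
    also have "\<dots> = B * (\<bar>k\<bar> * exp (- \<bar>k\<bar>)) / (1 + k\<^sup>2)" by (simp add: ac_simps)
    also have "\<dots> \<le> B / (1 + k\<^sup>2)"
      using \<open>B * (\<bar>k\<bar> * exp (- \<bar>k\<bar>)) \<le> B\<close> one_plus_square_pos[of k] by (intro divide_right_mono) auto
    finally show ?thesis by simp
  qed
  then show "AE k in lborel. norm (of_real k * P k) \<le> norm (B * (1 / (1 + k\<^sup>2)))"
    using decaysD(3)[OF assms] by (intro AE_I2) simp
qed

lemma integrable_conv_kernel:
  assumes P: "decays A P" and Q: "integrable lborel Q"
  shows "integrable lborel (\<lambda>m. P (k - m) * Q m)"
proof (rule Bochner_Integration.integrable_bound[OF integrable_mult_right[OF Q, of "of_real A"]])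
  note [measurable] = decaysD(1)[OF P] borel_measurable_integrable[OF Q]
  show "(\<lambda>m. P (k - m) * Q m) \<in> borel_measurable lborel" by measurable
  show "AE m in lborel. norm (P (k - m) * Q m) \<le> norm (of_real A * Q m)"
    unfolding norm_mult using decaysD(3,5)[OF P] by (intro AE_I2 mult_right_mono) auto
qed

text \<open>Leibniz' rule on the Fourier side: k = (k - m) + m puts the factor on one of the two
  arguments, where the exponential absorbs it.\<close>

lemma integrable_mult_conv:
  assumes P: "decays A P" and Q: "decays B Q"
  shows "integrable lborel (\<lambda>k. of_real k * conv P Q k)"
proof -
  have "of_real k * conv P Q k = conv (\<lambda>k. of_real k * P k) Q k + conv P (\<lambda>k. of_real k * Q k) k" for k
  proof -
    have i1: "integrable lborel (\<lambda>m. P (k - m) * (of_real m * Q m))"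
      by (rule integrable_conv_kernel[OF P integrable_decays_mult[OF Q]])
    have i0: "integrable lborel (\<lambda>m. P (k - m) * Q m)"
      by (rule integrable_conv_kernel[OF P integrable_decays[OF Q]])
    have i2: "integrable lborel (\<lambda>m. of_real (k - m) * P (k - m) * Q m)"
      using Bochner_Integration.integrable_diff[OF integrable_mult_right[OF i0, of "of_real k"] i1]
      by (simp add: algebra_simps)
    have "conv (\<lambda>k. of_real k * P k) Q k + conv P (\<lambda>k. of_real k * Q k) k = (LINT m|lborel. of_real k * (P (k - m) * Q m))"
      unfolding conv_def by (subst Bochner_Integration.integral_add[symmetric, OF i2 i1]) (simp add: algebra_simps)
    then show ?thesis unfolding conv_def by simp
  qed
  then show ?thesis
    using integrable_conv integrable_decays_mult[OF P] integrable_decays[OF Q] integrable_decays[OF P] integrable_decays_mult[OF Q]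
    by simp
qed

lemma has_vector_derivative_inv_fourier:
  assumes g: "integrable lborel g" and kg: "integrable lborel (\<lambda>k. of_real k * g k)"
  shows "(ift g has_vector_derivative ift (\<lambda>k. \<i> * of_real k * g k) x) (at x)"
proof -
  note [measurable] = borel_measurable_integrable[OF g]
  have "((\<lambda>x. LINT k|lborel. g k * iexp (k * x)) has_vector_derivative (LINT k|lborel. \<i> * of_real k * g k * iexp (k * x))) (at x within UNIV)"
  proof (rule has_vector_derivative_LINT[where F' = "\<lambda>x k. \<i> * of_real k * g k * iexp (k * x)"])
    fix s k :: real
    have "((\<lambda>s. g k * exp (\<i> * (of_real k * of_real s))) has_vector_derivative \<i> * of_real k * g k * exp (\<i> * (of_real k * of_real s))) (at s within UNIV)"
      by (rule has_vector_derivative_real_field[where f = "\<lambda>z. g k * exp (\<i> * (of_real k * z))"])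
        (auto intro!: derivative_eq_intros)
    then show "((\<lambda>s. g k * iexp (k * s)) has_vector_derivative \<i> * of_real k * g k * iexp (k * s)) (at s within UNIV)" by simp
    show "norm (\<i> * of_real k * g k * iexp (k * s)) \<le> norm (of_real k * g k)"
      by (simp add: norm_mult norm_exp_i_times)
  qed (use integrable_mult_iexp[OF g] kg in auto)
  from has_vector_derivative_mult_right[OF this, of "of_real (1 / sqrt (2 * pi))"]
  show ?thesis unfolding inv_fourier_integral_def[abs_def] by simp
qed

text \<open>The factor \<open>exp 1\<close> pays for moving the argument by at most 1. The Lipschitz
  bound is the mean value theorem: |sinh| <= cosh bounds the derivative of 1 / cosh by 1 / cosh
  itself.\<close>

lemma cosh_bounds:
  fixes k :: real
  shows "1 / cosh k \<le> 2 * exp (- \<bar>k\<bar>)"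
    and "0 < h \<Longrightarrow> h \<le> 1 \<Longrightarrow> 1 / cosh (k + h) \<le> 2 * exp 1 * exp (- \<bar>k\<bar>)"
    and "0 < h \<Longrightarrow> h \<le> 1 \<Longrightarrow> \<bar>1 / cosh (k + h) - 1 / cosh k\<bar> \<le> h * (2 * exp 1 * exp (- \<bar>k\<bar>))"
proof -
  have *: "1 / cosh x \<le> 2 * exp (- \<bar>x\<bar>)" for x :: real
  proof -
    have "exp \<bar>x\<bar> \<le> 2 * cosh x" by (auto simp: cosh_def abs_if)
    then have "exp \<bar>x\<bar> * exp (- \<bar>x\<bar>) \<le> 2 * cosh x * exp (- \<bar>x\<bar>)" by (intro mult_right_mono) auto
    then have "1 \<le> 2 * cosh x * exp (- \<bar>x\<bar>)" by (simp flip: exp_add)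
    then show ?thesis using cosh_real_pos[of x] by (simp add: divide_le_eq mult.commute mult.left_commute)
  qed
  have **: "1 / cosh x \<le> 2 * exp 1 * exp (- \<bar>k\<bar>)" if "\<bar>x - k\<bar> \<le> 1" for x
  proof -
    have "exp (- \<bar>x\<bar>) \<le> exp (1 + - \<bar>k\<bar>)" using that by simp
    then have "2 * exp (- \<bar>x\<bar>) \<le> 2 * exp 1 * exp (- \<bar>k\<bar>)" unfolding exp_add by simp
    then show ?thesis using *[of x] by linarith
  qed
  show "1 / cosh k \<le> 2 * exp (- \<bar>k\<bar>)" by (rule *)
  show "1 / cosh (k + h) \<le> 2 * exp 1 * exp (- \<bar>k\<bar>)" if "0 < h" "h \<le> 1"
    using that by (intro **) auto
  show "\<bar>1 / cosh (k + h) - 1 / cosh k\<bar> \<le> h * (2 * exp 1 * exp (- \<bar>k\<bar>))" if h: "0 < h" "h \<le> 1"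
  proof -
    have "\<exists>z. k < z \<and> z < k + h \<and> 1 / cosh (k + h) - 1 / cosh k = (k + h - k) * (- sinh z / (cosh z)\<^sup>2)"
    proof (rule MVT2)
      fix x show "((\<lambda>x. 1 / cosh x) has_real_derivative - sinh x / (cosh x)\<^sup>2) (at x)"
        using cosh_real_pos[of x] by (auto intro!: derivative_eq_intros simp: power2_eq_square)
    qed (use h in auto)
    then obtain z where z: "k < z" "z < k + h" and eq: "1 / cosh (k + h) - 1 / cosh k = h * (- sinh z / (cosh z)\<^sup>2)" by auto
    have "\<bar>sinh z\<bar> \<le> cosh z" by (auto simp: sinh_def cosh_def abs_if field_simps)
    then have "\<bar>sinh z\<bar> / (cosh z)\<^sup>2 \<le> cosh z / (cosh z)\<^sup>2" by (intro divide_right_mono) auto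
    also have "\<dots> = 1 / cosh z" by (simp add: power2_eq_square)
    also have "\<dots> \<le> 2 * exp 1 * exp (- \<bar>k\<bar>)" using z h by (intro **) auto
    finally have "h * (\<bar>sinh z\<bar> / (cosh z)\<^sup>2) \<le> h * (2 * exp 1 * exp (- \<bar>k\<bar>))"
      using h by (intro mult_left_mono) auto
    then show ?thesis unfolding eq using h by (simp add: abs_mult)
  qed
qed

lemma exp_neg_half_le: "exp (- (\<bar>k\<bar> / 2)) \<le> 8 / (1 + (k::real)\<^sup>2)"
proof -
  have "1 + \<bar>k\<bar> / 2 + (\<bar>k\<bar> / 2)\<^sup>2 / 2 \<le> exp (\<bar>k\<bar> / 2)"
    by (rule exp_lower_Taylor_quadratic) simp
  then have "1 + k\<^sup>2 \<le> 8 * exp (\<bar>k\<bar> / 2)" by (simp add: power_divide)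
  then show ?thesis using one_plus_square_pos[of k] by (simp add: exp_minus divide_simps)
qed

text \<open>The factor \<open>1 / cosh\<close> turns \<open>\<mu>\<close> into an admissible multiplier, and \<open>cosh k\<close> is absorbed by the
  convolution because \<open>exp (\<plusminus>k) = exp (\<plusminus>(k - m)) exp (\<plusminus>m)\<close>. The result is a product of
  an \<open>L\<^sup>1\<close> kernel and the transform of products of \<open>L\<^sup>2\<close> functions.\<close>

lemma nn_integral_inv_fourier_mult_conv:
  assumes [measurable]: "\<mu> \<in> borel_measurable borel"
    and \<mu>: "\<And>k. norm (\<mu> k) \<le> M * exp (\<bar>k\<bar> / 2)"
    and Lip: "\<And>h k. 0 < h \<Longrightarrow> h \<le> 1 \<Longrightarrow> norm (\<mu> (k + h) - \<mu> k) \<le> h * (M * exp (\<bar>k\<bar> / 2))"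
    and P: "decays B P" and Q: "decays B Q"
  shows "L1n (ift (\<lambda>k. \<mu> k * conv P Q k))
    \<le> ennreal ((pi + 2 * ((32 * exp 1 * M)\<^sup>2 * pi)) * (pi * B\<^sup>2))"
proof -
  note [measurable] = decaysD(1)[OF P] decaysD(1)[OF Q]
  have B0: "B \<ge> 0" by (rule decaysD(3)[OF P])
  have M0: "M \<ge> 0" using order_trans[OF norm_ge_zero \<mu>[of 0]] by simp
  define n where "n k = \<mu> k * of_real (1 / cosh k)" for k
  \<comment> \<open>The product rule for increments gives two terms with the factor 2
    \<open>exp 1\<close> each; the remaining 8 is the constant of
    \<open>exp_neg_half_le\<close>.\<close>
  define G where "G k = 32 * exp 1 * M * (1 / (1 + k\<^sup>2))" for k :: real
  have [measurable]: "(cosh :: real \<Rightarrow> real) \<in> borel_measurable borel"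
    by (intro borel_measurable_continuous_onI continuous_intros)
  have [measurable]: "n \<in> borel_measurable borel" unfolding n_def[abs_def] by measurable
  have [measurable]: "G \<in> borel_measurable borel" unfolding G_def[abs_def] by measurable
  have GB: "4 * exp 1 * M * exp (- (\<bar>k\<bar> / 2)) \<le> G k" for k
    using mult_left_mono[OF exp_neg_half_le[of k], of "4 * exp 1 * M"] M0 by (simp add: G_def)
  have ee: "exp (\<bar>k\<bar> / 2) * exp (- \<bar>k\<bar>) = exp (- (\<bar>k\<bar> / 2))" for k :: real
    by (simp flip: exp_add)
  have e1: "1 \<le> 2 * exp (1::real)" using exp_ge_add_one_self[of "1::real"] by linarith
  have nG: "norm (n k) \<le> G k" for k
  proof -
    have "norm (n k) = norm (\<mu> k) * (1 / cosh k)"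
      using cosh_real_pos[of k] by (simp add: n_def norm_mult norm_divide)
    also have "\<dots> \<le> (M * exp (\<bar>k\<bar> / 2)) * (2 * exp (- \<bar>k\<bar>))"
      using M0 cosh_real_pos[of k] by (intro mult_mono \<mu> cosh_bounds) auto
    also have "\<dots> = 2 * M * exp (- (\<bar>k\<bar> / 2))" by (simp flip: ee)
    also have "\<dots> \<le> 4 * exp 1 * M * exp (- (\<bar>k\<bar> / 2))"
      using M0 e1 by (intro mult_right_mono) auto
    finally show ?thesis using GB[of k] by linarith
  qed
  have nL: "norm (n (k + h) - n k) \<le> h * G k" if h: "0 < h" "h \<le> 1" for h k
  proof -
    have "n (k + h) - n k = (\<mu> (k + h) - \<mu> k) * of_real (1 / cosh (k + h)) + \<mu> k * of_real (1 / cosh (k + h) - 1 / cosh k)"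
      unfolding n_def of_real_diff left_diff_distrib right_diff_distrib by simp
    then have "norm (n (k + h) - n k) \<le> norm (\<mu> (k + h) - \<mu> k) * (1 / cosh (k + h)) + norm (\<mu> k) * \<bar>1 / cosh (k + h) - 1 / cosh k\<bar>"
      using norm_triangle_ineq[of "(\<mu> (k + h) - \<mu> k) * of_real (1 / cosh (k + h))" "\<mu> k * of_real (1 / cosh (k + h) - 1 / cosh k)"]
        cosh_real_pos[of "k + h"]
      by (simp only: norm_mult norm_of_real) simp
    also have "\<dots> \<le> (h * (M * exp (\<bar>k\<bar> / 2))) * (2 * exp 1 * exp (- \<bar>k\<bar>)) + (M * exp (\<bar>k\<bar> / 2)) * (h * (2 * exp 1 * exp (- \<bar>k\<bar>)))"
      using h M0 cosh_real_pos[of "k + h"] by (intro add_mono mult_mono \<mu> Lip cosh_bounds) auto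
    also have "\<dots> = h * (4 * exp 1 * M * exp (- (\<bar>k\<bar> / 2)))" by (simp flip: ee)
    also have "\<dots> \<le> h * G k" using h GB[of k] by (intro mult_left_mono) auto
    finally show ?thesis .
  qed
  have ni: "integrable lborel n"
  proof (rule Bochner_Integration.integrable_bound)
    show "integrable lborel G" unfolding G_def using integrable_inverse_one_plus_square by (rule integrable_mult_right)
    show "AE k in lborel. norm (n k) \<le> norm (G k)"
      using nG by (intro AE_I2) (auto intro: order_trans[OF _ abs_ge_self])
  qed measurable
  have sqle: "(1 / (1 + k\<^sup>2))\<^sup>2 \<le> 1 / (1 + k\<^sup>2)" for k :: real
    unfolding power2_eq_square[of "1 / _"] using one_plus_square_pos[of k] by (intro mult_left_le) (auto simp: divide_le_eq)
  have sqi: "(\<integral>\<^sup>+k. ennreal ((A * (1 / (1 + k\<^sup>2)))\<^sup>2) \<partial>lborel) \<le> ennreal (A\<^sup>2 * pi)" for A :: real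
  proof -
    have "(\<integral>\<^sup>+k. ennreal ((A * (1 / (1 + k\<^sup>2)))\<^sup>2) \<partial>lborel) \<le> (\<integral>\<^sup>+k. ennreal (A\<^sup>2) * ennreal (1 / (1 + k\<^sup>2)) \<partial>lborel)"
    proof (intro nn_integral_mono)
      fix k :: real
      have "(A * (1 / (1 + k\<^sup>2)))\<^sup>2 \<le> A\<^sup>2 * (1 / (1 + k\<^sup>2))"
        unfolding power_mult_distrib by (intro mult_left_mono sqle) simp
      from ennreal_leI[OF this] show "ennreal ((A * (1 / (1 + k\<^sup>2)))\<^sup>2) \<le> ennreal (A\<^sup>2) * ennreal (1 / (1 + k\<^sup>2))"
        using one_plus_square_pos[of k] by (subst ennreal_mult[symmetric]) auto
    qed
    also have "\<dots> = ennreal (A\<^sup>2) * ennreal pi"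
      by (subst nn_integral_cmult) (simp_all only: nn_integral_inverse_one_plus_square, measurable)
    finally show ?thesis by (simp add: ennreal_mult)
  qed
  have nI: "L1n (ift n) \<le> ennreal (pi + 2 * ((32 * exp 1 * M)\<^sup>2 * pi))"
  proof -
    have "L1n (ift n) \<le> ennreal pi + 2 * (\<integral>\<^sup>+k. ennreal ((G k)\<^sup>2) \<partial>lborel)"
      by (rule nn_integral_inv_fourier_Lipschitz[OF ni _ nG nL]) measurable
    also have "\<dots> \<le> ennreal pi + 2 * ennreal ((32 * exp 1 * M)\<^sup>2 * pi)"
      unfolding G_def by (intro add_left_mono mult_left_mono sqi) simp
    also have "\<dots> = ennreal (pi + 2 * ((32 * exp 1 * M)\<^sup>2 * pi))"
      by (simp add: ennreal_plus ennreal_mult)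
    finally show ?thesis .
  qed
  \<comment> \<open>The tilt by exp (sk) with |s| = 1 uses up exactly the exponential of
    \<open>decays\<close>. What is left, B / (1 + k^2), is both integrable and square
    integrable.\<close>
  define tw where "tw s P k = of_real (exp (s * k)) * P k" for s :: real and P :: "real \<Rightarrow> complex" and k
  have tw: "tw s P \<in> borel_measurable borel" "norm (tw s P k) \<le> B * (1 / (1 + k\<^sup>2))" "integrable lborel (tw s P)"
     "(\<integral>\<^sup>+x. ennreal ((norm (ift (tw s P) x))\<^sup>2) \<partial>lborel) \<le> ennreal (B\<^sup>2 * pi)"
    if "decays B P" "\<bar>s\<bar> = 1" for s P k
  proof -
    note [measurable] = decaysD(1)[OF that(1)]
    show m[measurable]: "tw s P \<in> borel_measurable borel" unfolding tw_def[abs_def] by measurable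
    show b: "norm (tw s P k) \<le> B * (1 / (1 + k\<^sup>2))" for k
    proof -
      have "s * k \<le> \<bar>k\<bar>" using that(2) abs_ge_self[of "s * k"] by (simp add: abs_mult)
      then have "norm (tw s P k) \<le> exp \<bar>k\<bar> * (B * exp (- \<bar>k\<bar>) / (1 + k\<^sup>2))"
        unfolding tw_def norm_mult using decaysD(2)[OF that(1), of k] by (intro mult_mono) auto
      also have "\<dots> = B * (exp \<bar>k\<bar> * exp (- \<bar>k\<bar>)) / (1 + k\<^sup>2)" by (simp only: ac_simps times_divide_eq_right)
      finally show ?thesis by (simp flip: exp_add)
    qed
    show i: "integrable lborel (tw s P)"
      by (rule Bochner_Integration.integrable_bound[OF integrable_mult_right[OF integrable_inverse_one_plus_square, of B]])
        (use b decaysD(3)[OF that(1)] in auto)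
    have "(\<integral>\<^sup>+x. ennreal ((norm (ift (tw s P) x))\<^sup>2) \<partial>lborel) \<le> (\<integral>\<^sup>+k. ennreal ((B * (1 / (1 + k\<^sup>2)))\<^sup>2) \<partial>lborel)"
      by (intro order_trans[OF plancherel_le[OF i]] nn_integral_mono ennreal_leI power_mono b) auto
    also note sqi
    finally show "(\<integral>\<^sup>+x. ennreal ((norm (ift (tw s P) x))\<^sup>2) \<partial>lborel) \<le> ennreal (B\<^sup>2 * pi)" .
  qed
  define R where "R k = 1 / 2 * (conv (tw 1 P) (tw 1 Q) k + conv (tw (-1) P) (tw (-1) Q) k)" for k
  have ci: "integrable lborel (conv (tw s P) (tw s Q))" if "\<bar>s\<bar> = 1" for s
    using that by (intro integrable_conv tw P Q)
  have Ri: "integrable lborel R" unfolding R_def using ci[of 1] ci[of "-1"] by simp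
  have Req: "R k = of_real (cosh k) * conv P Q k" for k
  proof -
    have "conv (tw s P) (tw s Q) k = of_real (exp (s * k)) * conv P Q k" for s
    proof -
      have "conv (tw s P) (tw s Q) k = (LINT m|lborel. of_real (exp (s * k)) * (P (k - m) * Q m))"
        unfolding conv_def tw_def
      proof (intro Bochner_Integration.integral_cong refl)
        fix m
        have "s * k = s * (k - m) + s * m" by (simp add: algebra_simps)
        then have "of_real (exp (s * k)) = complex_of_real (exp (s * (k - m))) * of_real (exp (s * m))"
          by (simp only: exp_add of_real_mult)
        then show "of_real (exp (s * (k - m))) * P (k - m) * (of_real (exp (s * m)) * Q m) = of_real (exp (s * k)) * (P (k - m) * Q m)"
          by simp
      qed
      then show ?thesis by (simp add: conv_def)
    qed
    then show ?thesis by (simp add: R_def cosh_def algebra_simps add_divide_distrib)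
  qed
  have rb: "L1n (ift R) \<le> ennreal (sqrt (2 * pi) * (B\<^sup>2 * pi))"
  proof -
    let ?p = "\<lambda>s x. norm (ift (tw s P) x)" and ?q = "\<lambda>s x. norm (ift (tw s Q) x)"
    \<comment> \<open>One factor 1/2 comes from cosh, the other from ab <= (a^2 + b^2) / 2.\<close>
    let ?c = "sqrt (2 * pi) / 4"
    have m: "ift (tw s P) \<in> borel_measurable borel" "ift (tw s Q) \<in> borel_measurable borel" if "\<bar>s\<bar> = 1" for s
      using borel_measurable_inv_fourier[OF tw(3)[OF P that]] borel_measurable_inv_fourier[OF tw(3)[OF Q that]] by auto
    note [measurable] = m(1)[of 1, simplified] m(1)[of "-1", simplified] m(2)[of 1, simplified] m(2)[of "-1", simplified]
    have "L1n (ift R) \<le>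
      (\<integral>\<^sup>+x. ennreal ?c * (ennreal ((?p 1 x)\<^sup>2) + ennreal ((?q 1 x)\<^sup>2) + ennreal ((?p (-1) x)\<^sup>2) + ennreal ((?q (-1) x)\<^sup>2)) \<partial>lborel)"
    proof (intro nn_integral_mono)
      fix x
      have am: "a * b \<le> (a\<^sup>2 + b\<^sup>2) / 2" for a b :: real using sum_squares_bound[of a b] by simp
      have "ift R x = 1 / 2 * (ift (conv (tw 1 P) (tw 1 Q)) x + ift (conv (tw (-1) P) (tw (-1) Q)) x)"
        unfolding R_def inv_fourier_cmult by (simp add: inv_fourier_add ci)
      also have "\<dots> = 1 / 2 * (of_real (sqrt (2 * pi)) * (ift (tw 1 P) x * ift (tw 1 Q) x)
         + of_real (sqrt (2 * pi)) * (ift (tw (-1) P) x * ift (tw (-1) Q) x))"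
        by (simp add: inv_fourier_conv tw P Q)
      finally have "norm (ift R x) \<le> 1 / 2 * (sqrt (2 * pi) * (?p 1 x * ?q 1 x) + sqrt (2 * pi) * (?p (-1) x * ?q (-1) x))"
        by (simp only: norm_mult norm_divide norm_one norm_numeral)
           (intro mult_left_mono order_trans[OF norm_triangle_ineq], simp_all add: norm_mult)
      also have "\<dots> = sqrt (2 * pi) / 2 * (?p 1 x * ?q 1 x + ?p (-1) x * ?q (-1) x)" by (simp add: algebra_simps)
      also have "\<dots> \<le> sqrt (2 * pi) / 2 * (((?p 1 x)\<^sup>2 + (?q 1 x)\<^sup>2) / 2 + ((?p (-1) x)\<^sup>2 + (?q (-1) x)\<^sup>2) / 2)"
        by (intro mult_left_mono add_mono am) auto
      also have "\<dots> = ?c * ((?p 1 x)\<^sup>2 + (?q 1 x)\<^sup>2 + (?p (-1) x)\<^sup>2 + (?q (-1) x)\<^sup>2)" by (simp add: algebra_simps add_divide_distrib)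
      finally have "ennreal (norm (ift R x)) \<le> ennreal (?c * ((?p 1 x)\<^sup>2 + (?q 1 x)\<^sup>2 + (?p (-1) x)\<^sup>2 + (?q (-1) x)\<^sup>2))"
        by (rule ennreal_leI)
      then show "ennreal (norm (ift R x)) \<le> ennreal ?c * (ennreal ((?p 1 x)\<^sup>2) + ennreal ((?q 1 x)\<^sup>2) + ennreal ((?p (-1) x)\<^sup>2) + ennreal ((?q (-1) x)\<^sup>2))"
        by (subst (asm) ennreal_mult) (auto simp: ennreal_plus)
    qed
    also have "\<dots> = ennreal ?c * ((\<integral>\<^sup>+x. ennreal ((?p 1 x)\<^sup>2) \<partial>lborel) + (\<integral>\<^sup>+x. ennreal ((?q 1 x)\<^sup>2) \<partial>lborel)
        + (\<integral>\<^sup>+x. ennreal ((?p (-1) x)\<^sup>2) \<partial>lborel) + (\<integral>\<^sup>+x. ennreal ((?q (-1) x)\<^sup>2) \<partial>lborel))"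
      by (simp add: nn_integral_cmult nn_integral_add)
    also have "\<dots> \<le> ennreal ?c * (ennreal (B\<^sup>2 * pi) + ennreal (B\<^sup>2 * pi) + ennreal (B\<^sup>2 * pi) + ennreal (B\<^sup>2 * pi))"
      by (intro mult_left_mono add_mono tw P Q) auto
    also have "\<dots> = ennreal ?c * ennreal (B\<^sup>2 * pi + B\<^sup>2 * pi + B\<^sup>2 * pi + B\<^sup>2 * pi)"
      by (simp only: ennreal_plus add_nonneg_nonneg mult_nonneg_nonneg zero_le_power2 pi_ge_zero)
    also have "\<dots> = ennreal (?c * (B\<^sup>2 * pi + B\<^sup>2 * pi + B\<^sup>2 * pi + B\<^sup>2 * pi))"
      by (rule ennreal_mult[symmetric]) auto
    finally show ?thesis by (simp add: mult.commute)
  qed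
  have invRi: "integrable lborel (ift R)"
    using rb Ri by (intro integrableI_bounded) (auto intro: le_less_trans)
  have eq: "ift (\<lambda>k. \<mu> k * conv P Q k) = ift (\<lambda>k. n k * fourier_integral (ift R) k)"
  proof (rule inv_fourier_cong_AE)
    show "AE k in lborel. \<mu> k * conv P Q k = n k * fourier_integral (ift R) k"
      using fourier_inversion[OF Ri invRi] by eventually_elim (simp add: n_def Req)
    have [measurable]: "conv P Q \<in> borel_measurable borel"
      using integrable_conv[OF integrable_decays[OF P] integrable_decays[OF Q]] by simp
    show "(\<lambda>k. \<mu> k * conv P Q k) \<in> borel_measurable lborel" by measurable
    have "continuous_on UNIV (fourier_integral (ift R))"
      unfolding fourier_integral_eq[abs_def]
      by (intro continuous_on_compose2[OF continuous_on_inv_fourier[OF invRi, of UNIV]] continuous_intros) auto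
    then have [measurable]: "fourier_integral (ift R) \<in> borel_measurable borel"
      by (rule borel_measurable_continuous_onI)
    show "(\<lambda>k. n k * fourier_integral (ift R) k) \<in> borel_measurable lborel" by measurable
  qed
  have "L1n (ift (\<lambda>k. \<mu> k * conv P Q k))
    = (\<integral>\<^sup>+x. ennreal (1 / sqrt (2 * pi)) * ennreal (norm (conv (ift n) (ift R) x)) \<partial>lborel)"
    unfolding eq inv_fourier_mult_fourier[OF ni invRi]
    by (intro nn_integral_cong) (simp add: norm_mult norm_divide flip: ennreal_mult)
  also have "\<dots> = ennreal (1 / sqrt (2 * pi)) * L1n (conv (ift n) (ift R))"
  proof (rule nn_integral_cmult)
    have [measurable]: "ift n \<in> borel_measurable borel" "ift R \<in> borel_measurable borel"
      using ni Ri by auto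
    show "(\<lambda>x. ennreal (norm (conv (ift n) (ift R) x))) \<in> borel_measurable lborel"
      unfolding conv_def by measurable
  qed
  also have "\<dots> \<le> ennreal (1 / sqrt (2 * pi)) * (ennreal (pi + 2 * ((32 * exp 1 * M)\<^sup>2 * pi)) * ennreal (sqrt (2 * pi) * (B\<^sup>2 * pi)))"
    using ni Ri by (intro mult_left_mono order_trans[OF nn_integral_conv_le] mult_mono nI rb) auto
  also have "\<dots> = ennreal ((1 / sqrt (2 * pi)) * ((pi + 2 * ((32 * exp 1 * M)\<^sup>2 * pi)) * (sqrt (2 * pi) * (B\<^sup>2 * pi))))"
    by (simp only: ennreal_mult[symmetric] mult_nonneg_nonneg real_sqrt_ge_zero zero_le_power2 pi_ge_zero add_nonneg_nonneg zero_le_numeral divide_nonneg_nonneg zero_le_one)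
  also have "(1 / sqrt (2 * pi)) * ((pi + 2 * ((32 * exp 1 * M)\<^sup>2 * pi)) * (sqrt (2 * pi) * (B\<^sup>2 * pi))) =
     (pi + 2 * ((32 * exp 1 * M)\<^sup>2 * pi)) * (pi * B\<^sup>2)" by simp
  finally show ?thesis .
qed

section \<open>Multipliers and propagators of the linear problem\<close>

text \<open>The predicate quantifies over an index set so that the constants are uniform, for instance in time.\<close>

definition tame :: "'i set \<Rightarrow> ('i \<Rightarrow> real \<Rightarrow> 'b::real_normed_vector) \<Rightarrow> bool" where
  "tame I f \<longleftrightarrow> (\<exists>C N. C \<ge> 0 \<and> (\<forall>i\<in>I. \<forall>k. norm (f i k) \<le> C * (1 + \<bar>k\<bar>) ^ N \<and>
     (\<forall>h. 0 < h \<longrightarrow> h \<le> 1 \<longrightarrow> norm (f i (k + h) - f i k) \<le> h * (C * (1 + \<bar>k\<bar>) ^ N))))"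

lemma tameI:
  assumes "C \<ge> 0" "\<And>i k. i \<in> I \<Longrightarrow> norm (f i k) \<le> C * (1 + \<bar>k\<bar>) ^ N"
    "\<And>i k h. i \<in> I \<Longrightarrow> 0 < h \<Longrightarrow> h \<le> 1 \<Longrightarrow> norm (f i (k + h) - f i k) \<le> h * (C * (1 + \<bar>k\<bar>) ^ N)"
  shows "tame I f"
  unfolding tame_def using assms by blast

lemma tameE:
  assumes "tame I f"
  obtains C N where "C \<ge> 0" "\<And>i k. i \<in> I \<Longrightarrow> norm (f i k) \<le> C * (1 + \<bar>k\<bar>) ^ N"
    "\<And>i k h. i \<in> I \<Longrightarrow> 0 < h \<Longrightarrow> h \<le> 1 \<Longrightarrow> norm (f i (k + h) - f i k) \<le> h * (C * (1 + \<bar>k\<bar>) ^ N)"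
  using assms unfolding tame_def by blast

lemma tame_const: "tame I (\<lambda>i k. c)"
  by (rule tameI[of "norm c" _ _ 0]) auto

lemma tame_id: "tame I (\<lambda>i k. k)"
  by (rule tameI[of 1 _ _ 1]) (auto simp: mult_le_cancel_left1)

lemma tame_abs: "tame I (\<lambda>i k. \<bar>k\<bar>)"
proof (rule tameI[of 1 _ _ 1])
  fix k h :: real assume h: "0 < h"
  have "\<bar>\<bar>k + h\<bar> - \<bar>k\<bar>\<bar> \<le> h" using h by linarith
  also have "\<dots> \<le> h * (1 * (1 + \<bar>k\<bar>) ^ 1)" using h by (simp add: mult_le_cancel_left1)
  finally show "norm (\<bar>k + h\<bar> - \<bar>k\<bar>) \<le> h * (1 * (1 + \<bar>k\<bar>) ^ 1)" by simp
qed auto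

lemma tame_of_real: "tame I f \<Longrightarrow> tame I (\<lambda>i k. of_real (f i k) :: complex)"
  unfolding tame_def of_real_diff[symmetric] norm_of_real by simp

lemma power_le_power_add: "(1 + \<bar>k::real\<bar>) ^ m \<le> (1 + \<bar>k\<bar>) ^ (m + n)" "(1 + \<bar>k\<bar>) ^ n \<le> (1 + \<bar>k\<bar>) ^ (m + n)"
  by (intro power_increasing; simp)+

lemma tame_add:
  assumes "tame I f" "tame I g" shows "tame I (\<lambda>i k. f i k + g i k)"
proof -
  from assms(1) obtain C N where f: "C \<ge> 0" "\<And>i k. i \<in> I \<Longrightarrow> norm (f i k) \<le> C * (1 + \<bar>k\<bar>) ^ N"
    "\<And>i k h. i \<in> I \<Longrightarrow> 0 < h \<Longrightarrow> h \<le> 1 \<Longrightarrow> norm (f i (k + h) - f i k) \<le> h * (C * (1 + \<bar>k\<bar>) ^ N)"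
    by (rule tameE) blast
  from assms(2) obtain C' N' where g: "C' \<ge> 0" "\<And>i k. i \<in> I \<Longrightarrow> norm (g i k) \<le> C' * (1 + \<bar>k\<bar>) ^ N'"
    "\<And>i k h. i \<in> I \<Longrightarrow> 0 < h \<Longrightarrow> h \<le> 1 \<Longrightarrow> norm (g i (k + h) - g i k) \<le> h * (C' * (1 + \<bar>k\<bar>) ^ N')"
    by (rule tameE) blast
  have le: "C * (1 + \<bar>k\<bar>) ^ N + C' * (1 + \<bar>k\<bar>) ^ N' \<le> (C + C') * (1 + \<bar>k\<bar>) ^ (N + N')" for k :: real
    unfolding distrib_right using f(1) g(1) power_le_power_add by (intro add_mono mult_left_mono) auto
  show ?thesis
  proof (rule tameI[of "C + C'" _ _ "N + N'"])
    show "norm (f i k + g i k) \<le> (C + C') * (1 + \<bar>k\<bar>) ^ (N + N')" if "i \<in> I" for i k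
      by (rule order_trans[OF norm_triangle_ineq order_trans[OF add_mono[OF f(2)[OF that] g(2)[OF that]] le]])
    fix i k h assume that: "i \<in> I" "0 < (h::real)" "h \<le> 1"
    have "norm (f i (k + h) + g i (k + h) - (f i k + g i k)) \<le> norm (f i (k + h) - f i k) + norm (g i (k + h) - g i k)"
      by (rule norm_diff_triangle_ineq)
    also have "\<dots> \<le> h * (C * (1 + \<bar>k\<bar>) ^ N) + h * (C' * (1 + \<bar>k\<bar>) ^ N')"
      by (intro add_mono f g that)
    also have "\<dots> \<le> h * ((C + C') * (1 + \<bar>k\<bar>) ^ (N + N'))"
      unfolding distrib_left[symmetric] using that by (intro mult_left_mono le) auto
    finally show "norm (f i (k + h) + g i (k + h) - (f i k + g i k)) \<le> h * ((C + C') * (1 + \<bar>k\<bar>) ^ (N + N'))" .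
  qed (use f g in auto)
qed

lemma tame_mult:
  fixes f g :: "'i \<Rightarrow> real \<Rightarrow> 'b::real_normed_algebra"
  assumes "tame I f" "tame I g" shows "tame I (\<lambda>i k. f i k * g i k)"
proof -
  from assms(1) obtain C N where f: "C \<ge> 0" "\<And>i k. i \<in> I \<Longrightarrow> norm (f i k) \<le> C * (1 + \<bar>k\<bar>) ^ N"
    "\<And>i k h. i \<in> I \<Longrightarrow> 0 < h \<Longrightarrow> h \<le> 1 \<Longrightarrow> norm (f i (k + h) - f i k) \<le> h * (C * (1 + \<bar>k\<bar>) ^ N)"
    by (rule tameE) blast
  from assms(2) obtain C' N' where g: "C' \<ge> 0" "\<And>i k. i \<in> I \<Longrightarrow> norm (g i k) \<le> C' * (1 + \<bar>k\<bar>) ^ N'"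
    "\<And>i k h. i \<in> I \<Longrightarrow> 0 < h \<Longrightarrow> h \<le> 1 \<Longrightarrow> norm (g i (k + h) - g i k) \<le> h * (C' * (1 + \<bar>k\<bar>) ^ N')"
    by (rule tameE) blast
  \<comment> \<open>The power of 2 arises where the first factor is evaluated at k + h: 1 + |k + h|
    <= 2 (1 + |k|).\<close>
  let ?K = "(2 ^ N + 1) * (C * C')"
  show ?thesis
  proof (rule tameI[of ?K _ _ "N + N'"])
    show "?K \<ge> 0" using f g by simp
    fix i k assume i: "i \<in> I"
    have "norm (f i k * g i k) \<le> norm (f i k) * norm (g i k)" by (rule norm_mult_ineq)
    also have "\<dots> \<le> (C * (1 + \<bar>k\<bar>) ^ N) * (C' * (1 + \<bar>k\<bar>) ^ N')"
      using f(1) by (intro mult_mono f g i) auto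
    also have "\<dots> = 1 * ((C * C') * (1 + \<bar>k\<bar>) ^ (N + N'))" by (simp add: power_add)
    also have "\<dots> \<le> (2 ^ N + 1) * ((C * C') * (1 + \<bar>k\<bar>) ^ (N + N'))"
      using f(1) g(1) by (intro mult_right_mono) auto
    finally show "norm (f i k * g i k) \<le> ?K * (1 + \<bar>k\<bar>) ^ (N + N')" by (simp only: mult.assoc)
    fix h :: real assume h: "0 < h" "h \<le> 1"
    have "(1 + \<bar>k + h\<bar>) ^ N \<le> (2 * (1 + \<bar>k\<bar>)) ^ N" using h by (intro power_mono) auto
    then have f2: "norm (f i (k + h)) \<le> C * (2 ^ N * (1 + \<bar>k\<bar>) ^ N)"
      using f(2)[OF i, of "k + h"] mult_left_mono[OF _ f(1)] unfolding power_mult_distrib by (rule_tac order_trans) auto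
    have "f i (k + h) * g i (k + h) - f i k * g i k = f i (k + h) * (g i (k + h) - g i k) + (f i (k + h) - f i k) * g i k"
      by (simp add: algebra_simps)
    then have "norm (f i (k + h) * g i (k + h) - f i k * g i k) \<le> norm (f i (k + h)) * norm (g i (k + h) - g i k) + norm (f i (k + h) - f i k) * norm (g i k)"
      by (metis norm_triangle_le add_mono norm_mult_ineq)
    also have "\<dots> \<le> (C * (2 ^ N * (1 + \<bar>k\<bar>) ^ N)) * (h * (C' * (1 + \<bar>k\<bar>) ^ N')) + (h * (C * (1 + \<bar>k\<bar>) ^ N)) * (C' * (1 + \<bar>k\<bar>) ^ N')"
      using f(1) h by (intro add_mono mult_mono f2 f g i) auto
    also have "\<dots> = h * (?K * (1 + \<bar>k\<bar>) ^ (N + N'))" by (simp add: power_add algebra_simps)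
    finally show "norm (f i (k + h) * g i (k + h) - f i k * g i k) \<le> h * (?K * (1 + \<bar>k\<bar>) ^ (N + N'))" .
  qed
qed

text \<open>This serves bounded oscillating functions of a growing quantity: only their increments
  have to be compared with those of a tame function g.\<close>

lemma tame_dominated:
  fixes f :: "'i \<Rightarrow> real \<Rightarrow> 'b::real_normed_vector" and g :: "'i \<Rightarrow> real \<Rightarrow> 'c::real_normed_vector"
  assumes g: "tame I g" and "\<And>i k. i \<in> I \<Longrightarrow> norm (f i k) \<le> A"
    and Lip: "\<And>i k h. i \<in> I \<Longrightarrow> norm (f i (k + h) - f i k) \<le> norm (g i (k + h) - g i k)"
  shows "tame I f"
proof -
  from g obtain C N where g: "C \<ge> 0" "\<And>i k. i \<in> I \<Longrightarrow> norm (g i k) \<le> C * (1 + \<bar>k\<bar>) ^ N"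
    "\<And>i k h. i \<in> I \<Longrightarrow> 0 < h \<Longrightarrow> h \<le> 1 \<Longrightarrow> norm (g i (k + h) - g i k) \<le> h * (C * (1 + \<bar>k\<bar>) ^ N)"
    by (rule tameE) blast
  have p: "1 \<le> (1 + \<bar>k::real\<bar>) ^ N" for k by (rule one_le_power) simp
  show ?thesis
  proof (rule tameI[of "C + \<bar>A\<bar>" _ _ N])
    fix i k assume i: "i \<in> I"
    have "A \<le> (C + \<bar>A\<bar>) * 1" using g(1) by simp
    with assms(2)[OF i] have "norm (f i k) \<le> (C + \<bar>A\<bar>) * 1" by (rule order_trans)
    also have "\<dots> \<le> (C + \<bar>A\<bar>) * (1 + \<bar>k\<bar>) ^ N" using p g(1) by (intro mult_left_mono) auto
    finally show "norm (f i k) \<le> (C + \<bar>A\<bar>) * (1 + \<bar>k\<bar>) ^ N" .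
    fix h :: real assume h: "0 < h" "h \<le> 1"
    have "norm (f i (k + h) - f i k) \<le> h * (C * (1 + \<bar>k\<bar>) ^ N)" using Lip[OF i] g(3)[OF i h] by (rule order_trans)
    also have "\<dots> \<le> h * ((C + \<bar>A\<bar>) * (1 + \<bar>k\<bar>) ^ N)" using h by (intro mult_left_mono mult_right_mono) auto
    finally show "norm (f i (k + h) - f i k) \<le> h * ((C + \<bar>A\<bar>) * (1 + \<bar>k\<bar>) ^ N)" .
  qed (use g in auto)
qed

text \<open>Polynomial growth is traded for the exponent |k| / 2, the form of bound that
  \<open>nn_integral_inv_fourier_mult_conv\<close> asks of its multiplier: the product with 1 / cosh
  then still decays.\<close>

lemma tame_exp_bounds:
  assumes "tame I f"
  obtains M where "M \<ge> 0" "\<And>i k. i \<in> I \<Longrightarrow> norm (f i k) \<le> M * exp (\<bar>k\<bar> / 2)"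
    "\<And>i k h. i \<in> I \<Longrightarrow> 0 < h \<Longrightarrow> h \<le> 1 \<Longrightarrow> norm (f i (k + h) - f i k) \<le> h * (M * exp (\<bar>k\<bar> / 2))"
proof -
  from assms obtain C N where f: "C \<ge> 0" "\<And>i k. i \<in> I \<Longrightarrow> norm (f i k) \<le> C * (1 + \<bar>k\<bar>) ^ N"
    "\<And>i k h. i \<in> I \<Longrightarrow> 0 < h \<Longrightarrow> h \<le> 1 \<Longrightarrow> norm (f i (k + h) - f i k) \<le> h * (C * (1 + \<bar>k\<bar>) ^ N)"
    by (rule tameE) blast
  \<comment> \<open>From 1 + |k| <= n exp (|k| / n), the N-th power has exponent N |k| / n; this n
    makes it at most |k| / 2, also for N = 0.\<close>
  define n where "n = 2 * real (Suc N)"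
  have n: "n \<ge> 1" by (simp add: n_def)
  have e: "C * (1 + \<bar>k\<bar>) ^ N \<le> C * n ^ N * exp (\<bar>k\<bar> / 2)" for k
  proof -
    have "1 + \<bar>k\<bar> \<le> n + \<bar>k\<bar>" using n by simp
    also have "\<dots> = n * (1 + \<bar>k\<bar> / n)" using n by (simp add: distrib_left)
    also have "\<dots> \<le> n * exp (\<bar>k\<bar> / n)" using n by (intro mult_left_mono exp_ge_add_one_self) auto
    finally have "(1 + \<bar>k\<bar>) ^ N \<le> (n * exp (\<bar>k\<bar> / n)) ^ N" by (intro power_mono) auto
    also have "\<dots> = n ^ N * exp (real N * (\<bar>k\<bar> / n))" by (simp only: power_mult_distrib exp_of_nat_mult)
    also have "\<dots> \<le> n ^ N * exp (\<bar>k\<bar> / 2)"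
    proof -
      have "real N * (\<bar>k\<bar> / n) \<le> \<bar>k\<bar> / 2"
        unfolding n_def by (simp add: divide_simps) (simp add: algebra_simps)
      then show ?thesis using n by (intro mult_left_mono) auto
    qed
    finally show ?thesis using f(1) by (simp add: mult.assoc mult_left_mono)
  qed
  show ?thesis
  proof (rule that[of "C * n ^ N"])
    show "0 \<le> C * n ^ N" using f n by simp
    show "norm (f i k) \<le> C * n ^ N * exp (\<bar>k\<bar> / 2)" if "i \<in> I" for i k
      using f(2)[OF that] e by (rule order_trans)
    show "norm (f i (k + h) - f i k) \<le> h * (C * n ^ N * exp (\<bar>k\<bar> / 2))" if "i \<in> I" "0 < h" "h \<le> 1" for i k h
      using f(3)[OF that] mult_left_mono[OF e, of h] that by (meson less_imp_le order_trans)
  qed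
qed

lemma norm_iexp_diff_le: "norm (iexp x - iexp y) \<le> \<bar>x - y\<bar>"
proof -
  have "iexp x - iexp y = iexp y * (iexp (x - y) - 1)"
    by (simp add: algebra_simps exp_diff)
  then have "norm (iexp x - iexp y) = norm (iexp (x - y) - 1)" by (simp add: norm_mult)
  also have "\<dots> \<le> \<bar>x - y\<bar>" using iexp_approx1[of "x - y" 0] by simp
  finally show ?thesis .
qed

lemma tame_iexp:
  fixes g :: "'i \<Rightarrow> real \<Rightarrow> real"
  assumes "tame I g" shows "tame I (\<lambda>i k. iexp (g i k))"
  by (rule tame_dominated[OF assms, of _ 1]) (use norm_iexp_diff_le in auto)

section \<open>Trigonometric functions that depend only on the square of the frequency\<close>

lemma le_half_imp_le: "a \<le> b / 2 \<Longrightarrow> 0 \<le> b \<Longrightarrow> a \<le> b" for a b :: real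
  by linarith

text \<open>The bound is in terms of squares because it is applied to the frequency
  \<open>Om\<close>, which behaves like sqrt |k| near 0 and is not Lipschitz there, whereas its
  square is tame. It comes from the product formula for cos a - cos b and |sin x| <= |x|.\<close>

lemma cos_diff_le: "\<bar>cos a - cos b\<bar> \<le> \<bar>a\<^sup>2 - b\<^sup>2\<bar> / (2::real)"
proof -
  have "\<bar>cos a - cos b\<bar> = 2 * (\<bar>sin ((a + b) / 2)\<bar> * \<bar>sin ((b - a) / 2)\<bar>)"
    by (simp add: cos_diff_cos abs_mult)
  also have "\<dots> \<le> 2 * (\<bar>(a + b) / 2\<bar> * \<bar>(b - a) / 2\<bar>)"
    by (intro mult_left_mono mult_mono abs_sin_x_le_abs_x) auto
  also have "\<dots> = \<bar>(a + b) * (b - a)\<bar> / 2" by (simp add: abs_mult)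
  also have "(a + b) * (b - a) = b\<^sup>2 - a\<^sup>2" by (simp add: power2_eq_square algebra_simps)
  finally show ?thesis by (simp add: abs_minus_commute)
qed

text \<open>The solution of y'' + w^2 y = 0 with y(0) = 0 and y'(0) = 1. It is an even function of
  w, and the value at w = 0 is the continuous one.\<close>

definition sinq :: "real \<Rightarrow> real \<Rightarrow> real" where
  "sinq w t = (if w = 0 then t else sin (w * t) / w)"

lemma sinq_sinc: "sinq w t = t * sinc (w * t)"
  by (simp add: sinq_def)

lemma sinq_mult: "w * sinq w t = sin (w * t)"
  by (simp add: sinq_def)

lemma sinq_0 [simp]: "sinq w 0 = 0"
  by (simp add: sinq_def)

lemma sinq_minus: "sinq w (- t) = - sinq w t"
  by (simp add: sinq_def)

lemma sinq_has_derivative: "(sinq w has_real_derivative cos (w * t)) (at t within X)"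
proof (cases "w = 0")
  case True
  then show ?thesis by (simp add: sinq_def[abs_def])
next
  case False
  then have "((\<lambda>t. sin (w * t) / w) has_real_derivative cos (w * t)) (at t within X)"
    by (auto intro!: derivative_eq_intros)
  with False show ?thesis by (simp add: sinq_def[abs_def])
qed

lemma abs_sinq_le: "\<bar>sinq w t\<bar> \<le> \<bar>t\<bar>"
  using abs_sin_x_le_abs_x[of "w * t"] by (auto simp: sinq_def abs_mult divide_le_eq mult.commute)

lemma sinq_diff: "sinq w (t - u) = sinq w t * cos (w * u) - cos (w * t) * sinq w u"
  by (auto simp: sinq_def right_diff_distrib sin_diff diff_divide_distrib)

lemma continuous_on_sinq [continuous_intros]:
  assumes "continuous_on X f" "continuous_on X g"
  shows "continuous_on X (\<lambda>x. sinq (f x) (g x))"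
  unfolding sinq_sinc by (intro continuous_intros assms)

text \<open>The difference vanishes at t = 0 and its time derivative is a difference of cosines, so
  the mean value theorem in t reduces the claim to \<open>cos_diff_le\<close>.\<close>

lemma sinq_Lipschitz:
  assumes t: "0 \<le> t" "t \<le> 1"
  shows "\<bar>sinq w t - sinq v t\<bar> \<le> \<bar>w\<^sup>2 - v\<^sup>2\<bar> / 2"
proof (cases "t = 0")
  case False
  with t have "0 < t" by simp
  from MVT2[OF this, of "\<lambda>t. sinq w t - sinq v t" "\<lambda>t. cos (w * t) - cos (v * t)"]
  obtain z where z: "0 < z" "z < t" "sinq w t - sinq v t = t * (cos (w * z) - cos (v * z))"
    by (auto intro!: derivative_eq_intros sinq_has_derivative)
  have "\<bar>cos (w * z) - cos (v * z)\<bar> \<le> \<bar>(w * z)\<^sup>2 - (v * z)\<^sup>2\<bar> / 2" by (rule cos_diff_le)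
  also have "(w * z)\<^sup>2 - (v * z)\<^sup>2 = z\<^sup>2 * (w\<^sup>2 - v\<^sup>2)" by (simp add: power_mult_distrib algebra_simps)
  also have "\<bar>z\<^sup>2 * (w\<^sup>2 - v\<^sup>2)\<bar> / 2 \<le> 1 * \<bar>w\<^sup>2 - v\<^sup>2\<bar> / 2"
    unfolding abs_mult using z t by (intro divide_right_mono mult_right_mono) (auto simp: power_le_one)
  finally have "t * \<bar>cos (w * z) - cos (v * z)\<bar> \<le> 1 * (\<bar>w\<^sup>2 - v\<^sup>2\<bar> / 2)"
    using t by (intro mult_mono) auto
  then show ?thesis unfolding z(3) abs_mult using t by simp
qed simp

section \<open>Fundamental solutions of the linear problem\<close>

locale linear_wave =
  fixes \<alpha> \<beta> :: real
  assumes \<alpha>0: "\<alpha> \<ge> 0" and \<beta>0: "\<beta> \<ge> 0"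
begin

text \<open>At frequency k the linear problem is y'' = - \<open>om2\<close> y + 2i \<open>aa\<close>
  y', since \<alpha>\<Lambda> d/dx has the symbol \<alpha> |k| ik = 2i \<open>aa\<close>. Completing
  the square gives the characteristic roots i (\<open>aa\<close> + \<open>Om\<close>) and i
  (\<open>aa\<close> - \<open>Om\<close>).\<close>

definition om2 :: "real \<Rightarrow> real" where "om2 k = \<bar>k\<bar> + \<beta> * \<bar>k\<bar> ^ 3"
definition aa :: "real \<Rightarrow> real" where "aa k = \<alpha> * \<bar>k\<bar> * k / 2"
definition Om :: "real \<Rightarrow> real" where "Om k = sqrt ((aa k)\<^sup>2 + om2 k)"

text \<open>The fundamental solutions: \<open>PS\<close> has initial value 0 and velocity 1,
  \<open>PA\<close> has initial value 1 and velocity 0. \<open>PS'\<close> is the time derivative of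
  \<open>PS\<close>; that of \<open>PA\<close> is - \<open>om2\<close> \<open>PS\<close>.\<close>

definition PS :: "real \<Rightarrow> real \<Rightarrow> complex" where
  "PS t k = iexp (aa k * t) * of_real (sinq (Om k) t)"
definition PS' :: "real \<Rightarrow> real \<Rightarrow> complex" where
  "PS' t k = iexp (aa k * t) * (of_real (cos (Om k * t)) + \<i> * of_real (aa k * sinq (Om k) t))"
definition PA :: "real \<Rightarrow> real \<Rightarrow> complex" where
  "PA t k = iexp (aa k * t) * (of_real (cos (Om k * t)) - \<i> * of_real (aa k * sinq (Om k) t))"

lemma om2_nonneg: "om2 k \<ge> 0" using \<beta>0 by (simp add: om2_def)

lemma Om_square: "(Om k)\<^sup>2 = (aa k)\<^sup>2 + om2 k"
  unfolding Om_def using om2_nonneg by (simp add: real_sqrt_pow2)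

lemma abs_aa_le_Om: "\<bar>aa k\<bar> \<le> Om k"
  unfolding Om_def using om2_nonneg[of k] by (intro real_le_rsqrt) simp

text \<open>The symbol \<open>aa\<close> grows quadratically when \<alpha> > 0, but
  |\<open>aa\<close>| <= \<open>Om\<close> and \<open>sinq\<close> contains 1 / \<open>Om\<close>.
  This is why \<open>PS'\<close> and \<open>PA\<close> are bounded uniformly in k.\<close>

lemma abs_aa_sinq_le: "\<bar>aa k * sinq (Om k) t\<bar> \<le> 1"
proof -
  have "\<bar>aa k * sinq (Om k) t\<bar> \<le> \<bar>Om k * sinq (Om k) t\<bar>"
    unfolding abs_mult using abs_aa_le_Om[of k] by (intro mult_right_mono) auto
  then show ?thesis by (simp add: sinq_mult) (meson abs_sin_le_one order_trans)
qed

lemma norm_PS_le: "norm (PS t k) \<le> \<bar>t\<bar>"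
  unfolding PS_def using abs_sinq_le by (simp add: norm_mult norm_exp_i_times)

lemma norm_PS'_le: "norm (PS' t k) \<le> 2"
proof -
  have "norm (of_real (cos (Om k * t)) + \<i> * complex_of_real (aa k * sinq (Om k) t)) \<le> \<bar>cos (Om k * t)\<bar> + \<bar>aa k * sinq (Om k) t\<bar>"
    by (rule order_trans[OF norm_triangle_ineq]) (simp add: norm_mult abs_mult)
  also have "\<dots> \<le> 1 + 1" by (intro add_mono abs_aa_sinq_le abs_cos_le_one)
  finally show ?thesis unfolding PS'_def by (simp only: norm_mult norm_exp_i_times)
qed

lemma norm_PA_le: "norm (PA t k) \<le> 2"
proof -
  have "norm (of_real (cos (Om k * t)) - \<i> * complex_of_real (aa k * sinq (Om k) t)) \<le> \<bar>cos (Om k * t)\<bar> + \<bar>aa k * sinq (Om k) t\<bar>"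
    by (rule order_trans[OF norm_triangle_ineq4]) (simp add: norm_mult abs_mult)
  also have "\<dots> \<le> 1 + 1" by (intro add_mono abs_aa_sinq_le abs_cos_le_one)
  finally show ?thesis unfolding PA_def by (simp only: norm_mult norm_exp_i_times)
qed

lemma propagator_0: "PS 0 k = 0" "PS' 0 k = 1" "PA 0 k = 1"
  by (simp_all add: PS_def PS'_def PA_def)

lemma continuous_on_propagators [continuous_intros]:
  fixes f g :: "'a::metric_space \<Rightarrow> real"
  assumes "continuous_on X f" "continuous_on X g"
  shows "continuous_on X (\<lambda>x. PS (f x) (g x))" "continuous_on X (\<lambda>x. PS' (f x) (g x))"
    "continuous_on X (\<lambda>x. PA (f x) (g x))"
  unfolding PS_def PS'_def PA_def om2_def aa_def Om_def by (auto intro!: continuous_intros assms)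

lemma continuous_on_symbols [continuous_intros]:
  fixes g :: "'a::metric_space \<Rightarrow> real"
  assumes "continuous_on X g"
  shows "continuous_on X (\<lambda>x. om2 (g x))" "continuous_on X (\<lambda>x. aa (g x))"
  unfolding om2_def aa_def by (auto intro!: continuous_intros assms)

lemma parity: "aa (- k) = - aa k" "om2 (- k) = om2 k" "Om (- k) = Om k"
  by (simp_all add: aa_def om2_def Om_def)

lemma propagator_cnj: "PS t (- k) = cnj (PS t k)" "PS' t (- k) = cnj (PS' t k)" "PA t (- k) = cnj (PA t k)"
  unfolding PS_def PS'_def PA_def parity by (simp_all add: exp_cnj)

lemma iexp_has_vector_derivative:
  "((\<lambda>t. iexp (a * t)) has_vector_derivative \<i> * of_real a * iexp (a * t)) (at t within X)"
proof -
  have "((\<lambda>t. exp (\<i> * (of_real a * of_real t))) has_vector_derivative \<i> * of_real a * exp (\<i> * (of_real a * of_real t))) (at t within X)"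
    by (rule has_vector_derivative_real_field[where f = "\<lambda>z. exp (\<i> * (of_real a * z))"])
      (auto intro!: derivative_eq_intros)
  then show ?thesis by simp
qed

lemma of_real_has_vector_derivative:
  "(f has_real_derivative f') (at t within X) \<Longrightarrow> ((\<lambda>t. complex_of_real (f t)) has_vector_derivative of_real f') (at t within X)"
  by (simp add: has_real_derivative_iff_has_vector_derivative has_vector_derivative_of_real)

lemma cos_has_real_derivative: "((\<lambda>t. cos (w * t)) has_real_derivative - (w\<^sup>2 * sinq w t)) (at t within X)"
  using sinq_mult[of w t] by (auto intro!: derivative_eq_intros simp: power2_eq_square)

lemma PS_has_vector_derivative: "((\<lambda>t. PS t k) has_vector_derivative PS' t k) (at t within X)"
  unfolding PS_def PS'_def
  by (rule has_vector_derivative_eq_rhs[OF has_vector_derivative_mult[OF iexp_has_vector_derivative of_real_has_vector_derivative[OF sinq_has_derivative]]])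
    (simp add: algebra_simps)

lemma PS'_has_vector_derivative:
  "((\<lambda>t. PS' t k) has_vector_derivative (- of_real (om2 k) * PS t k + 2 * \<i> * of_real (aa k) * PS' t k)) (at t within X)"
proof -
  let ?E = "iexp (aa k * t)" and ?a = "complex_of_real (aa k)" and ?s = "complex_of_real (sinq (Om k) t)" and ?c = "complex_of_real (cos (Om k * t))"
  have O: "complex_of_real ((Om k)\<^sup>2) = ?a * ?a + of_real (om2 k)"
    unfolding Om_square by (simp add: power2_eq_square)
  have d: "((\<lambda>t. of_real (cos (Om k * t)) + \<i> * of_real (aa k * sinq (Om k) t)) has_vector_derivative
     (of_real (- ((Om k)\<^sup>2 * sinq (Om k) t)) + \<i> * of_real (aa k * cos (Om k * t)))) (at t within X)"
    by (intro has_vector_derivative_add has_vector_derivative_mult_right of_real_has_vector_derivative cos_has_real_derivative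
        DERIV_cmult sinq_has_derivative)
  have e: "?E * (of_real (- ((Om k)\<^sup>2 * sinq (Om k) t)) + \<i> * of_real (aa k * cos (Om k * t))) +
      \<i> * ?a * ?E * (?c + \<i> * of_real (aa k * sinq (Om k) t)) =
     - of_real (om2 k) * (?E * ?s) + 2 * \<i> * ?a * (?E * (?c + \<i> * of_real (aa k * sinq (Om k) t)))"
    unfolding of_real_minus of_real_mult O by (simp add: algebra_simps)
  show ?thesis unfolding PS_def PS'_def
    by (rule has_vector_derivative_eq_rhs[OF has_vector_derivative_mult[OF iexp_has_vector_derivative d] e])
qed

lemma PA_has_vector_derivative: "((\<lambda>t. PA t k) has_vector_derivative - of_real (om2 k) * PS t k) (at t within X)"
proof -
  let ?E = "iexp (aa k * t)" and ?a = "complex_of_real (aa k)" and ?s = "complex_of_real (sinq (Om k) t)" and ?c = "complex_of_real (cos (Om k * t))"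
  have O: "complex_of_real ((Om k)\<^sup>2) = ?a * ?a + of_real (om2 k)"
    unfolding Om_square by (simp add: power2_eq_square)
  have d: "((\<lambda>t. of_real (cos (Om k * t)) - \<i> * of_real (aa k * sinq (Om k) t)) has_vector_derivative
     (of_real (- ((Om k)\<^sup>2 * sinq (Om k) t)) - \<i> * of_real (aa k * cos (Om k * t)))) (at t within X)"
    by (intro has_vector_derivative_diff has_vector_derivative_mult_right of_real_has_vector_derivative cos_has_real_derivative
        DERIV_cmult sinq_has_derivative)
  have e: "?E * (of_real (- ((Om k)\<^sup>2 * sinq (Om k) t)) - \<i> * of_real (aa k * cos (Om k * t))) +
      \<i> * ?a * ?E * (?c - \<i> * of_real (aa k * sinq (Om k) t)) = - of_real (om2 k) * (?E * ?s)"
    unfolding of_real_minus of_real_mult O by (simp add: algebra_simps)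
  show ?thesis unfolding PS_def PA_def
    by (rule has_vector_derivative_eq_rhs[OF has_vector_derivative_mult[OF iexp_has_vector_derivative d] e])
qed

text \<open>Addition theorems that separate t from u. They allow Duhamel's integrals to be written
  with integrands free of the upper limit t.\<close>

lemma propagator_diff:
  "PS (t - u) k = PA t k * PS (- u) k + PS t k * PS' (- u) k"
  "PS' (t - u) k = - of_real (om2 k) * PS t k * PS (- u) k + PS' t k * PS' (- u) k"
proof -
  let ?a = "complex_of_real (aa k)"
  let ?s = "\<lambda>t. complex_of_real (sinq (Om k) t)" and ?c = "\<lambda>t. complex_of_real (cos (Om k * t))"
  define e where "e x = iexp (aa k * x)" for x
  have E: "e (t - u) = e t * e (- u)"
    unfolding e_def exp_add[symmetric] by (simp add: algebra_simps)
  have D: "PS x k = e x * ?s x" "PS' x k = e x * (?c x + \<i> * (?a * ?s x))" "PA x k = e x * (?c x - \<i> * (?a * ?s x))" for x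
    unfolding PS_def PS'_def PA_def e_def of_real_mult by (rule refl)+
  have s: "?s (t - u) = ?s t * ?c u - ?c t * ?s u" unfolding sinq_diff by simp
  have c: "?c (t - u) = ?c t * ?c u + (?a * ?a + of_real (om2 k)) * (?s t * ?s u)"
  proof -
    have "cos (Om k * (t - u)) = cos (Om k * t) * cos (Om k * u) + (Om k * sinq (Om k) t) * (Om k * sinq (Om k) u)"
      unfolding sinq_mult by (simp add: right_diff_distrib cos_diff)
    also have "(Om k * sinq (Om k) t) * (Om k * sinq (Om k) u) = (Om k)\<^sup>2 * (sinq (Om k) t * sinq (Om k) u)"
      by (simp add: power2_eq_square ac_simps)
    finally show ?thesis unfolding Om_square by (simp add: power2_eq_square)
  qed
  have m: "?s (- u) = - ?s u" "?c (- u) = ?c u" by (simp_all add: sinq_minus)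
  show "PS (t - u) k = PA t k * PS (- u) k + PS t k * PS' (- u) k"
    unfolding D E m s by (simp add: algebra_simps)
  show "PS' (t - u) k = - of_real (om2 k) * PS t k * PS (- u) k + PS' t k * PS' (- u) k"
    unfolding D E m s c by (simp add: algebra_simps)
qed

lemma tame_aa: "tame I (\<lambda>i. aa)"
  unfolding aa_def[abs_def] divide_inverse by (intro tame_mult tame_const tame_abs tame_id)

lemma tame_om2: "tame I (\<lambda>i. om2)"
  unfolding om2_def[abs_def] power3_eq_cube by (intro tame_add tame_mult tame_const tame_abs)

lemma tame_Om_square: "tame I (\<lambda>i k. (Om k)\<^sup>2)"
  unfolding Om_square unfolding power2_eq_square by (intro tame_add tame_mult tame_aa tame_om2)

lemma tame_cos_Om: "tame {0..1} (\<lambda>t k. cos (Om k * t))"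
proof (rule tame_dominated[OF tame_Om_square])
  show "norm (cos (Om k * t)) \<le> 1" for t k by simp
  fix t k h :: real assume t: "t \<in> {0..1}"
  have "\<bar>cos (Om (k + h) * t) - cos (Om k * t)\<bar> \<le> \<bar>(Om (k + h) * t)\<^sup>2 - (Om k * t)\<^sup>2\<bar> / 2" by (rule cos_diff_le)
  also have "(Om (k + h) * t)\<^sup>2 - (Om k * t)\<^sup>2 = t\<^sup>2 * ((Om (k + h))\<^sup>2 - (Om k)\<^sup>2)" by (simp add: power_mult_distrib algebra_simps)
  also have "\<bar>t\<^sup>2 * ((Om (k + h))\<^sup>2 - (Om k)\<^sup>2)\<bar> / 2 \<le> 1 * \<bar>(Om (k + h))\<^sup>2 - (Om k)\<^sup>2\<bar> / 2"
    unfolding abs_mult using t by (intro divide_right_mono mult_right_mono) (auto simp: power_le_one)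
  finally show "norm (cos (Om (k + h) * t) - cos (Om k * t)) \<le> norm ((Om (k + h))\<^sup>2 - (Om k)\<^sup>2)"
    unfolding real_norm_def mult_1 by (rule le_half_imp_le) simp
qed

lemma tame_sinq_Om: "tame {0..1} (\<lambda>t k. sinq (Om k) t)"
proof (rule tame_dominated[OF tame_Om_square])
  show "norm (sinq (Om k) t) \<le> 1" if "t \<in> {0..1}" for t k using abs_sinq_le[of "Om k" t] that by auto
  show "norm (sinq (Om (k + h)) t - sinq (Om k) t) \<le> norm ((Om (k + h))\<^sup>2 - (Om k)\<^sup>2)" if "t \<in> {0..1}" for t k h
  proof -
    from that have "\<bar>sinq (Om (k + h)) t - sinq (Om k) t\<bar> \<le> \<bar>(Om (k + h))\<^sup>2 - (Om k)\<^sup>2\<bar> / 2"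
      by (intro sinq_Lipschitz) auto
    then show ?thesis unfolding real_norm_def by (rule le_half_imp_le) simp
  qed
qed

lemma tame_time: "tame {0..1} (\<lambda>t k. t :: real)"
  by (rule tameI[of 1 _ _ 0]) auto

lemma tame_propagators: "tame {0..1} PS" "tame {0..1} PS'" "tame {0..1} PA"
proof -
  have E: "tame {0..1} (\<lambda>t k. iexp (aa k * t))"
    by (intro tame_iexp tame_mult tame_aa tame_time)
  note T = E tame_mult tame_add tame_of_real tame_const tame_cos_Om tame_sinq_Om tame_aa
  show "tame {0..1} PS" unfolding PS_def[abs_def] by (intro T)
  show "tame {0..1} PS'" unfolding PS'_def[abs_def] by (intro T)
  have "PA = (\<lambda>t k. iexp (aa k * t) * (of_real (cos (Om k * t)) + (- \<i>) * of_real (aa k * sinq (Om k) t)))"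
    by (simp add: PA_def[abs_def])
  then show "tame {0..1} PA" by (simp only:) (intro T)
qed

end

section \<open>The nonlinearity in weighted spaces\<close>

text \<open>The common constant 27 = 3^3 comes from exp x >= (1 + x/3)^3.\<close>

lemma monomial_le_exp:
  fixes x :: real assumes "x \<ge> 0"
  shows "x \<le> 27 * exp x" "x\<^sup>2 \<le> 27 * exp x" "x ^ 3 \<le> 27 * exp x"
proof -
  have "(1 + x / 3) ^ 3 \<le> exp (x / 3) ^ 3"
    using assms exp_ge_add_one_self[of "x / 3"] by (intro power_mono) auto
  also have "\<dots> = exp x" by (simp flip: exp_of_nat_mult)
  also have "(1 + x / 3) ^ 3 = 1 + x + x\<^sup>2 / 3 + x ^ 3 / 27"
    by (simp add: power3_eq_cube power2_eq_square field_simps)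
  finally have *: "1 + x + x\<^sup>2 / 3 + x ^ 3 / 27 \<le> exp x" .
  show "x \<le> 27 * exp x" "x\<^sup>2 \<le> 27 * exp x" "x ^ 3 \<le> 27 * exp x"
    using * assms zero_le_power[OF assms, of 3] zero_le_power2[of x] by linarith+
qed

text \<open>The envelope under which transforms are measured: the norm of P is the least B with |P
  k| <= B \<open>wt \<tau> k\<close>.\<close>

definition wt :: "real \<Rightarrow> real \<Rightarrow> real" where "wt \<tau> k = exp (- \<tau> * \<bar>k\<bar>) / (1 + k\<^sup>2)"

lemma wt_pos: "wt \<tau> k > 0" using one_plus_square_pos[of k] by (simp add: wt_def)

lemma wt_minus: "wt \<tau> (- k) = wt \<tau> k" by (simp add: wt_def)

lemma wt_0: "wt 0 k = 1 / (1 + k\<^sup>2)" by (simp add: wt_def)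

lemma wt_split: "wt (\<sigma> + \<tau>) k = exp (- \<sigma> * \<bar>k\<bar>) * wt \<tau> k"
proof -
  have "- (\<sigma> + \<tau>) * \<bar>k\<bar> = - \<sigma> * \<bar>k\<bar> + - \<tau> * \<bar>k\<bar>" by (simp add: algebra_simps)
  then show ?thesis unfolding wt_def by (simp only: exp_add times_divide_eq_right)
qed

lemma continuous_on_wt [continuous_intros]:
  fixes f g :: "'a::metric_space \<Rightarrow> real"
  assumes "continuous_on X f" "continuous_on X g" shows "continuous_on X (\<lambda>x. wt (f x) (g x))"
  unfolding wt_def using one_plus_square_pos
  by (intro continuous_intros assms) (metis less_irrefl)

text \<open>Since k = (k - m) + m, one has 1 + k^2 <= 2 (1 + (k - m)^2) + 2 (1 + m^2), an inequality
  equivalent to 0 <= 1 + (k - 2m)^2 + 2. Dividing by the three factors leaves the envelope at k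
  times two functions of m of integral pi each, whence 4 pi.\<close>

lemma wt0_convolution:
  "wt 0 (k - m) * wt 0 m \<le> 2 * wt 0 k * (wt 0 m + wt 0 (k - m))"
  "integrable lborel (\<lambda>m. wt 0 (k - m) * wt 0 m)" "(LBINT m. wt 0 (k - m) * wt 0 m) \<le> 4 * pi * wt 0 k"
proof -
  have i: "integrable lborel (wt 0)" "(LBINT m. wt 0 m) = pi"
    unfolding wt_0 using integrable_inverse_one_plus_square integral_inverse_one_plus_square by simp_all
  have ish: "integrable lborel (\<lambda>m. wt 0 (k - m))" "(LBINT m. wt 0 (k - m)) = pi"
    using lborel_integrable_real_affine[OF i(1), of "-1" k] lborel_integral_real_affine[of "-1" "wt 0" k] i(2) by simp_all
  have b: "wt 0 (k - m) * wt 0 m \<le> 2 * wt 0 k * (wt 0 m + wt 0 (k - m))" for m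
  proof -
    let ?a = "1 + (k - m)\<^sup>2" and ?b = "1 + m\<^sup>2" and ?c = "1 + k\<^sup>2"
    have p: "?a > 0" "?b > 0" "?c > 0" by (rule one_plus_square_pos)+
    have "0 \<le> (k - 2 * m)\<^sup>2" by simp
    then have "?c \<le> 2 * ?a + 2 * ?b" by (simp add: power2_eq_square algebra_simps)
    then have "?c / (?a * ?b * ?c) \<le> (2 * ?a + 2 * ?b) / (?a * ?b * ?c)" using p by (intro divide_right_mono) auto
    also have "\<dots> = 2 * (1 / ?c) * (1 / ?b + 1 / ?a)" using p by (simp add: divide_simps)
    finally show ?thesis using p unfolding wt_0 by (simp add: divide_simps)
  qed
  then show "wt 0 (k - m) * wt 0 m \<le> 2 * wt 0 k * (wt 0 m + wt 0 (k - m))" .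
  have bi: "integrable lborel (\<lambda>m. 2 * wt 0 k * (wt 0 m + wt 0 (k - m)))" using i ish by simp
  show pi: "integrable lborel (\<lambda>m. wt 0 (k - m) * wt 0 m)"
  proof (rule Bochner_Integration.integrable_bound[OF bi])
    have [measurable]: "wt 0 \<in> borel_measurable borel" using i by simp
    show "(\<lambda>m. wt 0 (k - m) * wt 0 m) \<in> borel_measurable lborel" by measurable
    show "AE m in lborel. norm (wt 0 (k - m) * wt 0 m) \<le> norm (2 * wt 0 k * (wt 0 m + wt 0 (k - m)))"
      using b wt_pos[of 0] by (intro AE_I2) (smt (verit) mult_nonneg_nonneg real_norm_def less_imp_le)
  qed
  have "(LBINT m. wt 0 (k - m) * wt 0 m) \<le> (LBINT m. 2 * wt 0 k * (wt 0 m + wt 0 (k - m)))"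
    by (intro integral_mono pi bi b)
  also have "\<dots> = 4 * pi * wt 0 k" using i ish by simp
  finally show "(LBINT m. wt 0 (k - m) * wt 0 m) \<le> 4 * pi * wt 0 k" .
qed

section \<open>The quadratic term on the Fourier side\<close>

context linear_wave begin

text \<open>The symbol form of \<Lambda>f + \<beta>\<Lambda>^3 f - \<alpha>\<Lambda>f_tx, for
  transforms P of f and V of f_t. It is the linear part of the equation with the opposite sign and
  also the second argument of the merged commutator.\<close>

definition qsym :: "(real \<Rightarrow> complex) \<Rightarrow> (real \<Rightarrow> complex) \<Rightarrow> real \<Rightarrow> complex" where
  "qsym P V m = of_real (om2 m) * P m - 2 * \<i> * of_real (aa m) * V m"

text \<open>The first term is the integrand of -H((H f_t)^2)_x, where the factors -i of the three
  Hilbert transforms and the i of the derivative combine to 1. In the second, |k| is the symbol of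
  d/dx H acting on the product, and k sgn m belongs to d/dx outside and H inside. The two pairs of
  arguments make the expression bilinear, so that \<open>nl_diff\<close> follows from the usual
  splitting of a difference of squares.\<close>

definition nlk :: "(real \<Rightarrow> complex) \<Rightarrow> (real \<Rightarrow> complex) \<Rightarrow> (real \<Rightarrow> complex) \<Rightarrow> (real \<Rightarrow> complex) \<Rightarrow> real \<Rightarrow> real \<Rightarrow> complex" where
  "nlk P1 V1 P2 V2 k m = of_real (\<bar>k\<bar> * (sgn (k - m) * sgn m)) * (V1 (k - m) * V2 m) +
      of_real (\<bar>k\<bar> - k * sgn m) * (P1 (k - m) * qsym P2 V2 m)"

definition nl :: "(real \<Rightarrow> complex) \<Rightarrow> (real \<Rightarrow> complex) \<Rightarrow> (real \<Rightarrow> complex) \<Rightarrow> (real \<Rightarrow> complex) \<Rightarrow> real \<Rightarrow> complex" where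
  "nl P1 V1 P2 V2 k = of_real (1 / sqrt (2 * pi)) * (LINT m|lborel. nlk P1 V1 P2 V2 k m)"

definition Cq :: real where "Cq = 27 * (1 + \<beta> + \<alpha>)"

lemma Cq_nonneg: "Cq \<ge> 0" using \<alpha>0 \<beta>0 by (simp add: Cq_def)

definition bounded_by :: "real \<Rightarrow> real \<Rightarrow> (real \<Rightarrow> complex) \<Rightarrow> bool" where
  "bounded_by B \<tau> P \<longleftrightarrow> P \<in> borel_measurable borel \<and> (\<forall>k. norm (P k) \<le> B * wt \<tau> k)"

lemma bounded_byD:
  assumes "bounded_by B \<tau> P"
  shows "P \<in> borel_measurable borel" "norm (P k) \<le> B * wt \<tau> k" "B \<ge> 0"
proof -
  show 1: "P \<in> borel_measurable borel" "norm (P k) \<le> B * wt \<tau> k" for k using assms by (auto simp: bounded_by_def)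
  show "B \<ge> 0" using order_trans[OF norm_ge_zero 1(2)[of 0]] by (simp add: wt_def)
qed

lemma norm_qsym_le:
  assumes P: "bounded_by B \<tau> P" and V: "bounded_by B \<tau> V"
  shows "norm (qsym P V m) \<le> Cq * exp \<bar>m\<bar> * (B * wt \<tau> m)"
proof -
  have "norm (qsym P V m) \<le> norm (of_real (om2 m) * P m) + norm (2 * \<i> * of_real (aa m) * V m)"
    unfolding qsym_def by (rule norm_triangle_ineq4)
  also have "\<dots> = om2 m * norm (P m) + \<alpha> * \<bar>m\<bar>\<^sup>2 * norm (V m)"
    using om2_nonneg[of m] \<alpha>0 by (simp add: norm_mult aa_def abs_mult power2_eq_square)
  also have "\<dots> \<le> om2 m * (B * wt \<tau> m) + \<alpha> * \<bar>m\<bar>\<^sup>2 * (B * wt \<tau> m)"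
    using om2_nonneg[of m] \<alpha>0 bounded_byD(2)[OF P] bounded_byD(2)[OF V] by (intro add_mono mult_left_mono) auto
  also have "\<dots> = (om2 m + \<alpha> * \<bar>m\<bar>\<^sup>2) * (B * wt \<tau> m)" by (simp add: distrib_right)
  also have "\<dots> \<le> (Cq * exp \<bar>m\<bar>) * (B * wt \<tau> m)"
  proof (intro mult_right_mono)
    have "om2 m + \<alpha> * \<bar>m\<bar>\<^sup>2 \<le> 27 * exp \<bar>m\<bar> + \<beta> * (27 * exp \<bar>m\<bar>) + \<alpha> * (27 * exp \<bar>m\<bar>)"
      unfolding om2_def using \<alpha>0 \<beta>0 by (intro add_mono mult_left_mono monomial_le_exp) auto
    then show "om2 m + \<alpha> * \<bar>m\<bar>\<^sup>2 \<le> Cq * exp \<bar>m\<bar>" by (simp add: Cq_def algebra_simps)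
    show "0 \<le> B * wt \<tau> m" using bounded_byD(3)[OF P] wt_pos[of \<tau> m] by simp
  qed
  finally show ?thesis by simp
qed

lemma qsym_measurable:
  assumes [measurable]: "P \<in> borel_measurable borel" "V \<in> borel_measurable borel"
  shows "qsym P V \<in> borel_measurable borel"
  unfolding qsym_def[abs_def] om2_def aa_def by measurable

lemma nlk_measurable:
  assumes [measurable]: "P1 \<in> borel_measurable borel" "V1 \<in> borel_measurable borel" "P2 \<in> borel_measurable borel" "V2 \<in> borel_measurable borel"
  shows "nlk P1 V1 P2 V2 k \<in> borel_measurable borel"
proof -
  note [measurable] = qsym_measurable[OF assms(3,4)]
  show ?thesis unfolding nlk_def[abs_def] by measurable
qed

text \<open>The commutator kernel \<open>\<bar>k\<bar> - k sgn m\<close> vanishes unless \<open>k\<close> and \<open>m\<close> have opposite signs, and then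
  \<open>\<bar>k - m\<bar> = \<bar>k\<bar> + \<bar>m\<bar>\<close>: the exponential weight gains the factor \<open>exp (- 2 \<tau> \<bar>m\<bar>)\<close>, which
  absorbs all derivatives acting on the second argument. Only the factor \<open>\<bar>k\<bar>\<close> is lost.\<close>

lemma norm_nlk_le:
  assumes P1: "bounded_by B1 \<tau> P1" and V1: "bounded_by B1 \<tau> V1" and P2: "bounded_by B2 \<tau> P2" and V2: "bounded_by B2 \<tau> V2"
    and \<tau>: "\<tau> \<ge> 1"
  shows "norm (nlk P1 V1 P2 V2 k m) \<le> (1 + 2 * Cq) * (B1 * B2) * (\<bar>k\<bar> * exp (- \<tau> * \<bar>k\<bar>)) * (wt 0 (k - m) * wt 0 m)"
proof -
  have B: "B1 \<ge> 0" "B2 \<ge> 0" using bounded_byD(3)[OF P1] bounded_byD(3)[OF P2] by auto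
  have w: "wt \<tau> x = exp (- \<tau> * \<bar>x\<bar>) * wt 0 x" for x using wt_split[of \<tau> 0 x] by simp
  have w0: "wt 0 x \<ge> 0" for x using wt_pos[of 0 x] by simp
  have s1: "\<bar>sgn (x::real)\<bar> \<le> 1" for x by (simp add: sgn_real_def)
  let ?W = "wt 0 (k - m) * wt 0 m" and ?E = "exp (- \<tau> * \<bar>k\<bar>)"
  have 1: "norm (of_real (\<bar>k\<bar> * (sgn (k - m) * sgn m)) * (V1 (k - m) * V2 m)) \<le> \<bar>k\<bar> * (B1 * B2 * (?E * ?W))"
  proof -
    have "norm (of_real (\<bar>k\<bar> * (sgn (k - m) * sgn m)) * (V1 (k - m) * V2 m)) = (\<bar>k\<bar> * (\<bar>sgn (k - m)\<bar> * \<bar>sgn m\<bar>)) * (norm (V1 (k - m)) * norm (V2 m))"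
      by (simp only: norm_mult norm_of_real abs_mult abs_abs)
    also have "\<dots> \<le> (\<bar>k\<bar> * (1 * 1)) * ((B1 * wt \<tau> (k - m)) * (B2 * wt \<tau> m))"
      using B wt_pos[of \<tau>] by (intro mult_mono bounded_byD(2)[OF V1] bounded_byD(2)[OF V2] s1 order_refl) (auto simp: less_imp_le)
    also have "\<dots> = \<bar>k\<bar> * (B1 * B2 * (exp (- \<tau> * \<bar>k - m\<bar> + - \<tau> * \<bar>m\<bar>) * ?W))"
      unfolding w exp_add by (simp only: ac_simps mult_1)
    also have "\<dots> \<le> \<bar>k\<bar> * (B1 * B2 * (?E * ?W))"
    proof -
      have "\<bar>k\<bar> \<le> \<bar>k - m\<bar> + \<bar>m\<bar>" by linarith
      then have "\<tau> * \<bar>k\<bar> \<le> \<tau> * (\<bar>k - m\<bar> + \<bar>m\<bar>)" using \<tau> by (intro mult_left_mono) auto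
      then have "exp (- \<tau> * \<bar>k - m\<bar> + - \<tau> * \<bar>m\<bar>) \<le> ?E" by (simp add: distrib_left)
      then show ?thesis using B w0 by (intro mult_left_mono mult_right_mono) auto
    qed
    finally show ?thesis .
  qed
  have 2: "norm (of_real (\<bar>k\<bar> - k * sgn m) * (P1 (k - m) * qsym P2 V2 m)) \<le> 2 * \<bar>k\<bar> * (Cq * (B1 * B2 * (?E * ?W)))"
  proof (cases "\<bar>k\<bar> = k * sgn m")
    case True
    then show ?thesis using B w0 Cq_nonneg by simp
  next
    case False
    \<comment> \<open>The case m = 0 belongs here as well: sgn 0 = 0 leaves the kernel |k|, but the
      moduli still add up.\<close>
    then have km: "\<bar>k - m\<bar> = \<bar>k\<bar> + \<bar>m\<bar>" by (auto simp: sgn_real_def abs_if split: if_splits)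
    have "norm (of_real (\<bar>k\<bar> - k * sgn m) * (P1 (k - m) * qsym P2 V2 m)) = \<bar>\<bar>k\<bar> - k * sgn m\<bar> * (norm (P1 (k - m)) * norm (qsym P2 V2 m))"
      by (simp only: norm_mult norm_of_real)
    also have "\<dots> \<le> 2 * \<bar>k\<bar> * ((B1 * wt \<tau> (k - m)) * (Cq * exp \<bar>m\<bar> * (B2 * wt \<tau> m)))"
    proof (intro mult_mono bounded_byD(2)[OF P1] norm_qsym_le[OF P2 V2])
      show "\<bar>\<bar>k\<bar> - k * sgn m\<bar> \<le> 2 * \<bar>k\<bar>" by (auto simp: sgn_real_def abs_if)
    qed (use B wt_pos[of \<tau>] in \<open>auto simp: less_imp_le\<close>)
    also have "\<dots> = 2 * \<bar>k\<bar> * (Cq * (B1 * B2 * (exp (- \<tau> * \<bar>k - m\<bar> + - \<tau> * \<bar>m\<bar> + \<bar>m\<bar>) * ?W)))"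
      unfolding w exp_add by (simp only: ac_simps)
    also have "\<dots> \<le> 2 * \<bar>k\<bar> * (Cq * (B1 * B2 * (?E * ?W)))"
    proof -
      \<comment> \<open>The gained exp (-2\<tau>|m|) outweighs the exp |m| of
        \<open>norm_qsym_le\<close> because \<tau> >= 1.\<close>
      have "\<bar>m\<bar> \<le> \<tau> * \<bar>m\<bar>" using \<tau> by (simp add: mult_le_cancel_right1)
      moreover have "0 \<le> \<tau> * \<bar>m\<bar>" using \<tau> by simp
      ultimately have "exp (- \<tau> * \<bar>k - m\<bar> + - \<tau> * \<bar>m\<bar> + \<bar>m\<bar>) \<le> ?E" unfolding km by (simp add: distrib_left)
      then show ?thesis using B w0 Cq_nonneg by (intro mult_left_mono mult_right_mono) auto
    qed
    finally show ?thesis .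
  qed
  have "norm (nlk P1 V1 P2 V2 k m) \<le> \<bar>k\<bar> * (B1 * B2 * (?E * ?W)) + 2 * \<bar>k\<bar> * (Cq * (B1 * B2 * (?E * ?W)))"
    unfolding nlk_def by (rule order_trans[OF norm_triangle_ineq add_mono[OF 1 2]])
  also have "\<dots> = (1 + 2 * Cq) * (B1 * B2) * (\<bar>k\<bar> * ?E) * ?W" by (simp add: algebra_simps)
  finally show ?thesis .
qed

lemma nlk_integrable:
  assumes P1: "bounded_by B1 \<tau> P1" and V1: "bounded_by B1 \<tau> V1" and P2: "bounded_by B2 \<tau> P2" and V2: "bounded_by B2 \<tau> V2"
    and \<tau>: "\<tau> \<ge> 1"
  shows "integrable lborel (nlk P1 V1 P2 V2 k)"
proof (rule Bochner_Integration.integrable_bound)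
  show "integrable lborel (\<lambda>m. (1 + 2 * Cq) * (B1 * B2) * (\<bar>k\<bar> * exp (- \<tau> * \<bar>k\<bar>)) * (wt 0 (k - m) * wt 0 m))"
    by (intro integrable_mult_right wt0_convolution)
  show "nlk P1 V1 P2 V2 k \<in> borel_measurable lborel"
    using nlk_measurable[OF bounded_byD(1)[OF P1] bounded_byD(1)[OF V1] bounded_byD(1)[OF P2] bounded_byD(1)[OF V2]] by simp
  show "AE m in lborel. norm (nlk P1 V1 P2 V2 k m) \<le> norm ((1 + 2 * Cq) * (B1 * B2) * (\<bar>k\<bar> * exp (- \<tau> * \<bar>k\<bar>)) * (wt 0 (k - m) * wt 0 m))"
    unfolding real_norm_def using norm_nlk_le[OF assms] by (intro AE_I2 order_trans[OF _ abs_ge_self])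
qed

definition CN :: real where "CN = 1 / sqrt (2 * pi) * ((1 + 2 * Cq) * (4 * pi))"

lemma CN_nonneg: "CN \<ge> 0" using Cq_nonneg by (simp add: CN_def)

lemma norm_nl_le:
  assumes P1: "bounded_by B1 \<tau> P1" and V1: "bounded_by B1 \<tau> V1" and P2: "bounded_by B2 \<tau> P2" and V2: "bounded_by B2 \<tau> V2"
    and \<tau>: "\<tau> \<ge> 1"
  shows "norm (nl P1 V1 P2 V2 k) \<le> CN * (B1 * B2) * (\<bar>k\<bar> * wt \<tau> k)"
proof -
  have B: "B1 \<ge> 0" "B2 \<ge> 0" using bounded_byD(3)[OF P1] bounded_byD(3)[OF P2] by auto
  let ?K = "(1 + 2 * Cq) * (B1 * B2) * (\<bar>k\<bar> * exp (- \<tau> * \<bar>k\<bar>))"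
  have "norm (LINT m|lborel. nlk P1 V1 P2 V2 k m) \<le> (LINT m|lborel. norm (nlk P1 V1 P2 V2 k m))"
    by (rule integral_norm_bound)
  also have "\<dots> \<le> (LINT m|lborel. ?K * (wt 0 (k - m) * wt 0 m))"
    by (intro integral_mono norm_nlk_le[OF assms] integrable_mult_right wt0_convolution integrable_norm nlk_integrable[OF assms])
  also have "\<dots> = ?K * (LINT m|lborel. wt 0 (k - m) * wt 0 m)" by (rule integral_mult_right_zero)
  also have "\<dots> \<le> ?K * (4 * pi * wt 0 k)"
    using B Cq_nonneg by (intro mult_left_mono wt0_convolution) auto
  also have "\<dots> = ((1 + 2 * Cq) * (4 * pi)) * (B1 * B2) * (\<bar>k\<bar> * wt \<tau> k)"
    using wt_split[of \<tau> 0 k] by simp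
  finally have *: "norm (LINT m|lborel. nlk P1 V1 P2 V2 k m) \<le> ((1 + 2 * Cq) * (4 * pi)) * (B1 * B2) * (\<bar>k\<bar> * wt \<tau> k)" .
  have "norm (nl P1 V1 P2 V2 k) = 1 / sqrt (2 * pi) * norm (LINT m|lborel. nlk P1 V1 P2 V2 k m)"
    by (simp add: nl_def norm_mult norm_divide)
  also have "\<dots> \<le> 1 / sqrt (2 * pi) * (((1 + 2 * Cq) * (4 * pi)) * (B1 * B2) * (\<bar>k\<bar> * wt \<tau> k))"
    by (intro mult_left_mono *) simp
  finally show ?thesis by (simp only: CN_def mult.assoc)
qed

lemma nl_diff:
  assumes P1: "bounded_by B \<tau> P1" and V1: "bounded_by B \<tau> V1" and P2: "bounded_by B \<tau> P2" and V2: "bounded_by B \<tau> V2"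
    and Pd: "bounded_by d \<tau> (\<lambda>k. P1 k - P2 k)" and Vd: "bounded_by d \<tau> (\<lambda>k. V1 k - V2 k)" and \<tau>: "\<tau> \<ge> 1"
  shows "norm (nl P1 V1 P1 V1 k - nl P2 V2 P2 V2 k) \<le> CN * (2 * B * d) * (\<bar>k\<bar> * wt \<tau> k)"
proof -
  have kk: "nlk P1 V1 P1 V1 k m - nlk P2 V2 P2 V2 k m = nlk P1 V1 (\<lambda>k. P1 k - P2 k) (\<lambda>k. V1 k - V2 k) k m +
     nlk (\<lambda>k. P1 k - P2 k) (\<lambda>k. V1 k - V2 k) P2 V2 k m" for m
    unfolding nlk_def qsym_def by (simp add: algebra_simps)
  have "nl P1 V1 P1 V1 k - nl P2 V2 P2 V2 k = of_real (1 / sqrt (2 * pi)) * (LINT m|lborel. nlk P1 V1 P1 V1 k m - nlk P2 V2 P2 V2 k m)"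
    unfolding nl_def using nlk_integrable[OF P1 V1 P1 V1 \<tau>] nlk_integrable[OF P2 V2 P2 V2 \<tau>]
    by (simp add: right_diff_distrib)
  also have "\<dots> = nl P1 V1 (\<lambda>k. P1 k - P2 k) (\<lambda>k. V1 k - V2 k) k + nl (\<lambda>k. P1 k - P2 k) (\<lambda>k. V1 k - V2 k) P2 V2 k"
    unfolding kk nl_def using nlk_integrable[OF P1 V1 Pd Vd \<tau>] nlk_integrable[OF Pd Vd P2 V2 \<tau>]
    by (simp add: distrib_left)
  also have "norm \<dots> \<le> CN * (B * d) * (\<bar>k\<bar> * wt \<tau> k) + CN * (d * B) * (\<bar>k\<bar> * wt \<tau> k)"
    by (rule norm_triangle_le[OF add_mono[OF norm_nl_le[OF P1 V1 Pd Vd \<tau>] norm_nl_le[OF Pd Vd P2 V2 \<tau>]]])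
  also have "\<dots> = CN * (2 * B * d) * (\<bar>k\<bar> * wt \<tau> k)" by (simp add: algebra_simps)
  finally show ?thesis .
qed

text \<open>The reflection m to -m: \<open>om2\<close> is even, \<open>aa\<close> is odd, and the
  signs occur in pairs or together with k. This symmetry makes the constructed solution real
  valued.\<close>

lemma nl_cnj:
  assumes "\<And>k. P (- k) = cnj (P k)" "\<And>k. V (- k) = cnj (V k)"
  shows "nl P V P V (- k) = cnj (nl P V P V k)"
proof -
  have e: "nlk P V P V (- k) (- m) = cnj (nlk P V P V k m)" for m
  proof -
    have d: "- k - - m = - (k - m)" by simp
    show ?thesis unfolding nlk_def qsym_def d assms parity sgn_minus by (simp del: minus_diff_eq)
  qed
  have "(LINT m|lborel. nlk P V P V (- k) m) = (LINT m|lborel. nlk P V P V (- k) (- m))"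
    using lborel_integral_real_affine[of "-1" "nlk P V P V (- k)" 0] by simp
  also have "\<dots> = cnj (LINT m|lborel. nlk P V P V k m)"
    unfolding e by (rule Bochner_Integration.integral_cnj)
  finally show ?thesis by (simp add: nl_def)
qed

lemma continuous_on_nl:
  fixes P V :: "real \<Rightarrow> real \<Rightarrow> complex"
  assumes P: "continuous_on UNIV (\<lambda>(s, k). P s k)" and V: "continuous_on UNIV (\<lambda>(s, k). V s k)"
    and b: "\<And>s. bounded_by B (\<tau> s) (P s)" "\<And>s. bounded_by B (\<tau> s) (V s)" and \<tau>: "\<And>s. \<tau> s \<ge> 1"
  shows "continuous_on UNIV (\<lambda>(s, k). nl (P s) (V s) (P s) (V s) k)"
proof -
  have B: "B \<ge> 0" using bounded_byD(3)[OF b(1)] .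
  have w1: "wt 0 x \<le> 1" for x unfolding wt_0 using one_plus_square_pos[of x] by (simp add: divide_le_eq)
  have w0: "wt 0 x \<ge> 0" for x using wt_pos[of 0 x] by simp
  have "continuous_on UNIV (\<lambda>z. LINT m|lborel. nlk (P (fst z)) (V (fst z)) (P (fst z)) (V (fst z)) (snd z) m)"
  proof (rule continuous_on_LINT[where G = "\<lambda>m. (1 + 2 * Cq) * (B * B) * wt 0 m"])
    fix z :: "real \<times> real"
    show "nlk (P (fst z)) (V (fst z)) (P (fst z)) (V (fst z)) (snd z) \<in> borel_measurable lborel"
      using nlk_measurable[OF bounded_byD(1)[OF b(1)] bounded_byD(1)[OF b(2)] bounded_byD(1)[OF b(1)] bounded_byD(1)[OF b(2)]] by simp
    fix m
    let ?k = "snd z" and ?t = "\<tau> (fst z)"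
    \<comment> \<open>This frees the majorant from k and from the time, so that one integrable
      function serves the whole plane.\<close>
    have "\<bar>?k\<bar> * exp (- ?t * \<bar>?k\<bar>) \<le> 1"
    proof -
      have "\<bar>?k\<bar> \<le> ?t * \<bar>?k\<bar>" using \<tau>[of "fst z"] by (simp add: mult_le_cancel_right1)
      also have "\<dots> \<le> exp (?t * \<bar>?k\<bar>)" using exp_ge_add_one_self[of "?t * \<bar>?k\<bar>"] by linarith
      finally show ?thesis by (simp add: exp_minus divide_simps)
    qed
    then have "(\<bar>?k\<bar> * exp (- ?t * \<bar>?k\<bar>)) * (wt 0 (?k - m) * wt 0 m) \<le> 1 * (1 * wt 0 m)"
      by (intro mult_mono w1 order_refl mult_nonneg_nonneg w0) auto
    then have "(1 + 2 * Cq) * (B * B) * ((\<bar>?k\<bar> * exp (- ?t * \<bar>?k\<bar>)) * (wt 0 (?k - m) * wt 0 m)) \<le> (1 + 2 * Cq) * (B * B) * (1 * (1 * wt 0 m))"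
      using Cq_nonneg B by (intro mult_left_mono) auto
    then show "norm (nlk (P (fst z)) (V (fst z)) (P (fst z)) (V (fst z)) (snd z) m) \<le> (1 + 2 * Cq) * (B * B) * wt 0 m"
      using norm_nlk_le[OF b(1)[of "fst z"] b(2) b(1) b(2) \<tau>, of ?k m]
      unfolding mult.assoc mult_1 by (rule order_trans[rotated])
  next
    fix z :: "real \<times> real"
    \<comment> \<open>For fixed k the only discontinuity is that of sgn (k - m) at m = k; sgn m is
      constant in the variables considered.\<close>
    show "AE m in lborel. continuous (at z within UNIV) (\<lambda>z. nlk (P (fst z)) (V (fst z)) (P (fst z)) (V (fst z)) (snd z) m)"
      using AE_lborel_singleton[of "snd z"]
    proof eventually_elim
      case (elim m)
      have c: "isCont (\<lambda>z. f (fst z) (snd z - m)) z" "isCont (\<lambda>z. f (fst z) m) z" if "continuous_on UNIV (\<lambda>(s, k). f s k)" for f :: "real \<Rightarrow> real \<Rightarrow> complex"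
      proof -
        have 1: "continuous_on UNIV (\<lambda>z::real \<times> real. (fst z, snd z - m))" "continuous_on UNIV (\<lambda>z::real \<times> real. (fst z, m))"
          by (intro continuous_intros)+
        have "continuous_on UNIV (\<lambda>z. f (fst z) (snd z - m))" "continuous_on UNIV (\<lambda>z::real \<times> real. f (fst z) m)"
          using continuous_on_compose2[OF that 1(1)] continuous_on_compose2[OF that 1(2)] by simp_all
        then show "isCont (\<lambda>z. f (fst z) (snd z - m)) z" "isCont (\<lambda>z. f (fst z) m) z"
          by (cases z; simp add: continuous_on_eq_continuous_at)+
      qed
      have sg: "isCont (\<lambda>z::real \<times> real. sgn (snd z - m)) z"
        using elim by (intro continuous_intros) auto
      have "isCont (\<lambda>z::real \<times> real. of_real (\<bar>snd z\<bar> * (S z * a)) * (V1 z * V2 z) + of_real (\<bar>snd z\<bar> - snd z * a) * (P1 z * (b * P2 z - d * V2 z))) z"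
        if "isCont S z" "isCont V1 z" "isCont V2 z" "isCont P1 z" "isCont P2 z" for a and b d :: complex and S V1 V2 P1 P2
        by (intro continuous_intros that)
      from this[OF sg c[OF V] c[OF P], of "sgn m" "of_real (om2 m)" "2 * \<i> * of_real (aa m)"]
      show ?case unfolding nlk_def qsym_def .
    qed
  next
    show "integrable lborel (\<lambda>m. (1 + 2 * Cq) * (B * B) * wt 0 m)"
      unfolding wt_0 by (intro integrable_mult_right integrable_inverse_one_plus_square)
  qed
  then show ?thesis unfolding nl_def case_prod_beta by (intro continuous_intros)
qed

end

section \<open>Mild solutions\<close>

text \<open>The substitution s = t\<sigma> moves the integral to the fixed interval [0, 1], where
  continuity in a parameter is standard.\<close>

lemma continuous_on_param_integral:
  fixes h :: "real \<Rightarrow> real \<Rightarrow> complex"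
  assumes h: "continuous_on UNIV (\<lambda>(s, k). h s k)"
  shows "continuous_on ({0..} \<times> UNIV) (\<lambda>(t, k). integral {0..t} (\<lambda>s. h s k))"
proof -
  have hk: "continuous_on X (\<lambda>s. h s k)" for X k
  proof -
    have "continuous_on X (\<lambda>s. (s, k))" by (intro continuous_intros)
    from continuous_on_compose2[OF h this] show ?thesis by simp
  qed
  have "continuous_on (({0..} \<times> UNIV) \<times> cbox 0 1) (\<lambda>(z, \<sigma>). h (fst z * \<sigma>) (snd z))"
  proof -
    have "continuous_on (({0..} \<times> UNIV) \<times> cbox 0 1) (\<lambda>y::(real \<times> real) \<times> real. (fst (fst y) * snd y, snd (fst y)))"
      by (intro continuous_intros)
    from continuous_on_compose2[OF h this] show ?thesis by (simp add: case_prod_beta)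
  qed
  from integral_continuous_on_param[OF this]
  have "continuous_on ({0..} \<times> UNIV) (\<lambda>z::real \<times> real. fst z *\<^sub>R integral (cbox 0 1) (\<lambda>\<sigma>. h (fst z * \<sigma>) (snd z)))"
    by (intro continuous_intros)
  moreover have "fst z *\<^sub>R integral (cbox 0 1) (\<lambda>\<sigma>. h (fst z * \<sigma>) (snd z)) = (case z of (t, k) \<Rightarrow> integral {0..t} (\<lambda>s. h s k))"
    if "z \<in> {0..} \<times> UNIV" for z :: "real \<times> real"
  proof -
    obtain t k where z: "z = (t, k)" by (cases z)
    show ?thesis
    proof (cases "t = 0")
      case False
      with that z have t: "t > 0" by auto
      have "((\<lambda>s. h s k) has_integral integral {0..t} (\<lambda>s. h s k)) (cbox 0 t)"
        unfolding cbox_interval by (intro integrable_integral integrable_continuous_interval hk)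
      from has_integral_affinity'[OF this t, of 0]
      have "((\<lambda>\<sigma>. h (t * \<sigma>) k) has_integral (integral {0..t} (\<lambda>s. h s k) /\<^sub>R t)) (cbox 0 1)"
        using t by simp
      from integral_unique[OF this] show ?thesis using t z by simp
    qed (use z in simp)
  qed
  ultimately show ?thesis by (rule continuous_on_eq)
qed

text \<open>The envelope at the earlier time s is exp (-R (t - s) |k|) times the one at time t. The
  integral of |k| exp (-R (t - s) |k|) over s is at most 1/R for every k, so the factor |k| lost by
  the nonlinearity is recovered pointwise.\<close>

lemma norm_duhamel_le:
  fixes K h :: "real \<Rightarrow> complex"
  assumes t: "0 \<le> t" and R: "R > 0" and H: "H \<ge> 0"
    and K: "continuous_on {0..t} (\<lambda>s. K (t - s))" "\<And>s. s \<in> {0..t} \<Longrightarrow> norm (K (t - s)) \<le> 2"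
    and h: "continuous_on {0..t} h" "\<And>s. s \<in> {0..t} \<Longrightarrow> norm (h s) \<le> H * (\<bar>k\<bar> * wt (c - R * s) k)"
  shows "norm (integral {0..t} (\<lambda>s. K (t - s) * h s)) \<le> 2 * H / R * wt (c - R * t) k"
proof -
  let ?w = "wt (c - R * t) k"
  let ?g = "\<lambda>s. 2 * H * ?w * (\<bar>k\<bar> * exp (- R * (t - s) * \<bar>k\<bar>))"
  have int: "((\<lambda>s. \<bar>k\<bar> * exp (- R * (t - s) * \<bar>k\<bar>)) has_integral (exp (- R * (t - t) * \<bar>k\<bar>) / R - exp (- R * (t - 0) * \<bar>k\<bar>) / R)) {0..t}"
    using R by (intro fundamental_theorem_of_calculus t)
      (auto intro!: derivative_eq_intros simp: has_real_derivative_iff_has_vector_derivative[symmetric])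
  have "norm (integral {0..t} (\<lambda>s. K (t - s) * h s)) \<le> integral {0..t} ?g"
  proof (rule integral_norm_bound_integral)
    show "(\<lambda>s. K (t - s) * h s) integrable_on {0..t}"
      by (intro integrable_continuous_interval continuous_intros K h)
    show "?g integrable_on {0..t}" by (intro integrable_continuous_interval continuous_intros)
    fix s assume s: "s \<in> {0..t}"
    have "norm (K (t - s) * h s) \<le> 2 * (H * (\<bar>k\<bar> * wt (c - R * s) k))"
      unfolding norm_mult using K(2)[OF s] h(2)[OF s] by (intro mult_mono) auto
    also have "wt (c - R * s) k = exp (- R * (t - s) * \<bar>k\<bar>) * ?w"
    proof -
      have "c - R * s = R * (t - s) + (c - R * t)" by (simp add: algebra_simps)
      then show ?thesis by (simp only: wt_split) simp
    qed
    finally show "norm (K (t - s) * h s) \<le> ?g s" by (simp only: ac_simps)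
  qed
  also have "\<dots> = 2 * H * ?w * (exp (- R * (t - t) * \<bar>k\<bar>) / R - exp (- R * (t - 0) * \<bar>k\<bar>) / R)"
    by (rule integral_unique[OF has_integral_mult_right[OF int]])
  also have "\<dots> \<le> 2 * H * ?w * (1 / R)"
    using H R wt_pos[of "c - R * t" k] by (intro mult_left_mono) auto
  finally show ?thesis by simp
qed

section \<open>Duhamel's formula, constants and the weighted space\<close>

locale wave_problem = linear_wave +
  fixes \<epsilon> D M0 :: real and \<Phi>0 \<Phi>1 :: "real \<Rightarrow> complex"
  assumes data_cont: "continuous_on UNIV \<Phi>0" "continuous_on UNIV \<Phi>1"
    and data_bound: "\<And>k. norm (\<Phi>0 k) \<le> M0" "\<And>k. norm (\<Phi>1 k) \<le> M0"
    and data_supp: "\<And>k. \<bar>k\<bar> > D \<Longrightarrow> \<Phi>0 k = 0" "\<And>k. \<bar>k\<bar> > D \<Longrightarrow> \<Phi>1 k = 0"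
    and data_cnj: "\<And>k. \<Phi>0 (- k) = cnj (\<Phi>0 k)" "\<And>k. \<Phi>1 (- k) = cnj (\<Phi>1 k)"
    and D0: "D \<ge> 0"
begin

definition NL :: "(real \<Rightarrow> real \<Rightarrow> complex) \<Rightarrow> (real \<Rightarrow> real \<Rightarrow> complex) \<Rightarrow> real \<Rightarrow> real \<Rightarrow> complex" where
  "NL P V s k = nl (P s) (V s) (P s) (V s) k"

text \<open>Variation of constants: \<open>c1\<close> and \<open>c2\<close> are the varying
  coefficients of the fundamental solutions \<open>PA\<close> and \<open>PS\<close>. Their
  integrands do not involve t, so the time derivative is given by the fundamental theorem of
  calculus alone.\<close>

definition c1 :: "(real \<Rightarrow> real \<Rightarrow> complex) \<Rightarrow> (real \<Rightarrow> real \<Rightarrow> complex) \<Rightarrow> real \<Rightarrow> real \<Rightarrow> complex" where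
  "c1 P V t k = \<Phi>0 k + of_real \<epsilon> * integral {0..t} (\<lambda>s. PS (- s) k * NL P V s k)"

definition c2 :: "(real \<Rightarrow> real \<Rightarrow> complex) \<Rightarrow> (real \<Rightarrow> real \<Rightarrow> complex) \<Rightarrow> real \<Rightarrow> real \<Rightarrow> complex" where
  "c2 P V t k = \<Phi>1 k + of_real \<epsilon> * integral {0..t} (\<lambda>s. PS' (- s) k * NL P V s k)"

definition DP :: "(real \<Rightarrow> real \<Rightarrow> complex) \<Rightarrow> (real \<Rightarrow> real \<Rightarrow> complex) \<Rightarrow> real \<Rightarrow> real \<Rightarrow> complex" where
  "DP P V t k = PA t k * c1 P V t k + PS t k * c2 P V t k"

definition DV :: "(real \<Rightarrow> real \<Rightarrow> complex) \<Rightarrow> (real \<Rightarrow> real \<Rightarrow> complex) \<Rightarrow> real \<Rightarrow> real \<Rightarrow> complex" where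
  "DV P V t k = - of_real (om2 k) * PS t k * c1 P V t k + PS' t k * c2 P V t k"

lemma slice_continuous:
  assumes "continuous_on UNIV (\<lambda>(s, k). f s k)"
  shows "continuous_on X (\<lambda>s. f s (k::real) :: complex)" "continuous_on X (\<lambda>k. f (s::real) k)"
proof -
  have "continuous_on X (\<lambda>s. (s, k))" "continuous_on X (\<lambda>k. (s, k))" by (intro continuous_intros)+
  from continuous_on_compose2[OF assms this(1)] continuous_on_compose2[OF assms this(2)]
  show "continuous_on X (\<lambda>s. f s k)" "continuous_on X (\<lambda>k. f s k)" by simp_all
qed

text \<open>The coefficients \<open>c1\<close>, \<open>c2\<close> are suited to differentiation;
  this form, with a single bounded propagator at time t - s under the integral, is the one that
  \<open>norm_duhamel_le\<close> estimates.\<close>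

lemma duhamel:
  assumes N: "continuous_on UNIV (\<lambda>(s, k). NL P V s k)"
  shows "DP P V t k = PA t k * \<Phi>0 k + PS t k * \<Phi>1 k + of_real \<epsilon> * integral {0..t} (\<lambda>s. PS (t - s) k * NL P V s k)"
    and "DV P V t k = - of_real (om2 k) * PS t k * \<Phi>0 k + PS' t k * \<Phi>1 k + of_real \<epsilon> * integral {0..t} (\<lambda>s. PS' (t - s) k * NL P V s k)"
proof -
  note Nk = slice_continuous(1)[OF N]
  have i: "(\<lambda>s. PS (- s) k * NL P V s k) integrable_on {0..t}" "(\<lambda>s. PS' (- s) k * NL P V s k) integrable_on {0..t}"
    by (intro integrable_continuous_interval continuous_intros Nk)+
  have *: "integral {0..t} (\<lambda>s. (a * PS (- s) k + b * PS' (- s) k) * NL P V s k) =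
     a * integral {0..t} (\<lambda>s. PS (- s) k * NL P V s k) + b * integral {0..t} (\<lambda>s. PS' (- s) k * NL P V s k)" for a b
  proof -
    have "integral {0..t} (\<lambda>s. (a * PS (- s) k + b * PS' (- s) k) * NL P V s k) = integral {0..t} (\<lambda>s. a * (PS (- s) k * NL P V s k) + b * (PS' (- s) k * NL P V s k))"
      by (simp only: distrib_right mult.assoc)
    also have "\<dots> = integral {0..t} (\<lambda>s. a * (PS (- s) k * NL P V s k)) + integral {0..t} (\<lambda>s. b * (PS' (- s) k * NL P V s k))"
      by (intro Henstock_Kurzweil_Integration.integral_add integrable_on_mult_right i)
    finally show ?thesis by simp
  qed
  show "DP P V t k = PA t k * \<Phi>0 k + PS t k * \<Phi>1 k + of_real \<epsilon> * integral {0..t} (\<lambda>s. PS (t - s) k * NL P V s k)"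
    unfolding DP_def c1_def c2_def propagator_diff * by (simp add: algebra_simps)
  show "DV P V t k = - of_real (om2 k) * PS t k * \<Phi>0 k + PS' t k * \<Phi>1 k + of_real \<epsilon> * integral {0..t} (\<lambda>s. PS' (t - s) k * NL P V s k)"
    unfolding DV_def c1_def c2_def propagator_diff * by (simp add: algebra_simps)
qed

lemma continuous_on_duhamel:
  assumes N: "continuous_on UNIV (\<lambda>(s, k). NL P V s k)"
  shows "continuous_on ({0..} \<times> UNIV) (\<lambda>(t, k). DP P V t k)" "continuous_on ({0..} \<times> UNIV) (\<lambda>(t, k). DV P V t k)"
proof -
  have "continuous_on UNIV (\<lambda>(s, k). PS (- s) k * NL P V s k)" "continuous_on UNIV (\<lambda>(s, k). PS' (- s) k * NL P V s k)"
    using N unfolding case_prod_beta by (intro continuous_intros; simp)+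
  note I = this[THEN continuous_on_param_integral]
  have "continuous_on ({0..} \<times> UNIV) (\<lambda>z::real \<times> real. \<Phi>0 (snd z))" "continuous_on ({0..} \<times> UNIV) (\<lambda>z::real \<times> real. \<Phi>1 (snd z))"
    by (rule continuous_on_compose2[OF data_cont(1)] continuous_on_compose2[OF data_cont(2)]; auto intro: continuous_intros)+
  with I have c: "continuous_on ({0..} \<times> UNIV) (\<lambda>z. c1 P V (fst z) (snd z))" "continuous_on ({0..} \<times> UNIV) (\<lambda>z. c2 P V (fst z) (snd z))"
    unfolding c1_def c2_def case_prod_beta by (intro continuous_intros; simp)+
  show "continuous_on ({0..} \<times> UNIV) (\<lambda>(t, k). DP P V t k)" "continuous_on ({0..} \<times> UNIV) (\<lambda>(t, k). DV P V t k)"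
    unfolding DP_def DV_def case_prod_beta by (intro continuous_intros c)+
qed

text \<open>The factor exp (3D) (1 + D^2) is an upper bound for the reciprocal of the envelope on
  [-D, D], where the exponent is at most 3; the last factor bounds both linear parts there, with D +
  \<beta> D^3 for \<open>om2\<close>. Each component of the fixed point gets half of
  \<open>BB\<close>, that is \<open>E0\<close> + 1/2. \<open>RR\<close> is so large that Duhamel's
  terms fit into the remaining 1/2 and that each component contracts by 1/4. Up to the time
  \<open>TT\<close> the exponent falls from 3 to 2, and \<open>RR\<close> >= 1 keeps the times
  within [0, 1], where the propagators are tame.\<close>

definition E0 :: real where "E0 = exp (3 * D) * (1 + D\<^sup>2) * ((3 + D + \<beta> * D ^ 3) * M0)"
definition BB :: real where "BB = 2 * E0 + 1"
definition RR :: real where "RR = 1 + 16 * \<bar>\<epsilon>\<bar> * CN * (BB\<^sup>2 + BB)"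
definition TT :: real where "TT = 1 / RR"
definition tau :: "real \<Rightarrow> real" where "tau t = 3 - RR * t"

lemma M0_nonneg: "M0 \<ge> 0" using order_trans[OF norm_ge_zero data_bound(1)] .

lemma E0_nonneg: "E0 \<ge> 0" unfolding E0_def using D0 \<beta>0 M0_nonneg by simp

lemma BB_pos: "BB > 0" using E0_nonneg by (simp add: BB_def)

lemma RR_ge: "RR \<ge> 1" "RR > 0" "8 * \<bar>\<epsilon>\<bar> * CN * BB \<le> RR / 2" "4 * \<bar>\<epsilon>\<bar> * CN * BB\<^sup>2 \<le> RR"
proof -
  have n: "0 \<le> \<bar>\<epsilon>\<bar> * CN * BB\<^sup>2" "0 \<le> \<bar>\<epsilon>\<bar> * CN * BB" using CN_nonneg BB_pos by simp_all
  have "RR = 1 + 16 * (\<bar>\<epsilon>\<bar> * CN * BB\<^sup>2) + 16 * (\<bar>\<epsilon>\<bar> * CN * BB)" by (simp add: RR_def algebra_simps)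
  with n show "RR \<ge> 1" "RR > 0" "8 * \<bar>\<epsilon>\<bar> * CN * BB \<le> RR / 2" "4 * \<bar>\<epsilon>\<bar> * CN * BB\<^sup>2 \<le> RR" by linarith+
qed

lemma TT: "0 < TT" "TT \<le> 1" using RR_ge by (auto simp: TT_def)

lemma tau_bounds: "t \<in> {0..TT} \<Longrightarrow> 2 \<le> tau t \<and> tau t \<le> 3"
  using RR_ge by (auto simp: tau_def TT_def field_simps)

lemma linear_part_le:
  assumes t: "t \<in> {0..TT}"
  shows "norm (PA t k * \<Phi>0 k + PS t k * \<Phi>1 k) \<le> E0 * wt (tau t) k"
    "norm (- of_real (om2 k) * PS t k * \<Phi>0 k + PS' t k * \<Phi>1 k) \<le> E0 * wt (tau t) k"
proof -
  have t1: "\<bar>t\<bar> \<le> 1" using t TT by auto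
  have PS1: "norm (PS t k) \<le> 1" using norm_PS_le[of t k] t1 by linarith
  have z: "E0 * wt (tau t) k \<ge> 0" using E0_nonneg wt_pos[of "tau t" k] by simp
  \<comment> \<open>Inside the band the envelope is bounded below, so every bounded quantity fits
    under it, even after multiplication by the growing symbol \<open>om2\<close>.\<close>
  have key: "norm X \<le> E0 * wt (tau t) k" if k: "\<bar>k\<bar> \<le> D" and X: "norm X \<le> (3 + D + \<beta> * D ^ 3) * M0" for X :: complex
  proof -
    have kD: "k\<^sup>2 \<le> D\<^sup>2" using k D0 by (metis abs_of_nonneg abs_le_square_iff)
    have e: "tau t * \<bar>k\<bar> \<le> 3 * D" using tau_bounds[OF t] k by (intro mult_mono) auto
    have "1 = exp (tau t * \<bar>k\<bar>) * (1 + k\<^sup>2) * wt (tau t) k"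
    proof -
      have "exp (tau t * \<bar>k\<bar>) * exp (- tau t * \<bar>k\<bar>) = 1" by (simp flip: exp_add)
      moreover have "1 = e * p * (e' / p)" if "e * e' = 1" "p \<noteq> 0" for e e' p :: real using that by simp
      ultimately show ?thesis using one_plus_square_pos[of k] unfolding wt_def by (metis less_irrefl)
    qed
    also have "\<dots> \<le> exp (3 * D) * (1 + D\<^sup>2) * wt (tau t) k"
      using e kD wt_pos[of "tau t" k] by (intro mult_right_mono mult_mono) auto
    finally have "norm X * 1 \<le> ((3 + D + \<beta> * D ^ 3) * M0) * (exp (3 * D) * (1 + D\<^sup>2) * wt (tau t) k)"
      using D0 \<beta>0 M0_nonneg by (intro mult_mono X) auto
    then show ?thesis by (simp add: E0_def ac_simps)
  qed
  show "norm (PA t k * \<Phi>0 k + PS t k * \<Phi>1 k) \<le> E0 * wt (tau t) k"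
  proof (cases "\<bar>k\<bar> \<le> D")
    case True
    have "norm (PA t k * \<Phi>0 k + PS t k * \<Phi>1 k) \<le> 2 * M0 + 1 * M0"
      by (rule norm_triangle_le) (unfold norm_mult, intro add_mono mult_mono norm_PA_le PS1 data_bound, use M0_nonneg in auto)
    also have "\<dots> = 3 * M0" by simp
    also have "\<dots> \<le> (3 + D + \<beta> * D ^ 3) * M0" using D0 \<beta>0 M0_nonneg by (intro mult_right_mono) auto
    finally show ?thesis by (rule key[OF True])
  qed (use data_supp z in auto)
  show "norm (- of_real (om2 k) * PS t k * \<Phi>0 k + PS' t k * \<Phi>1 k) \<le> E0 * wt (tau t) k"
  proof (cases "\<bar>k\<bar> \<le> D")
    case True
    have om: "norm (- complex_of_real (om2 k)) \<le> D + \<beta> * D ^ 3"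
      using om2_nonneg[of k] True D0 \<beta>0 unfolding om2_def norm_minus_cancel norm_of_real
      by (auto intro!: add_mono mult_left_mono power_mono)
    have "norm (- of_real (om2 k) * PS t k * \<Phi>0 k + PS' t k * \<Phi>1 k) \<le> (D + \<beta> * D ^ 3) * 1 * M0 + 2 * M0"
      by (rule norm_triangle_le) (unfold norm_mult, intro add_mono mult_mono norm_PS'_le om PS1 data_bound, use M0_nonneg D0 \<beta>0 in auto)
    also have "\<dots> = (2 + D + \<beta> * D ^ 3) * M0" by (simp add: algebra_simps)
    also have "\<dots> \<le> (3 + D + \<beta> * D ^ 3) * M0" using M0_nonneg by (intro mult_right_mono) auto
    finally show ?thesis by (rule key[OF True])
  qed (use data_supp z in auto)
qed

text \<open>The type of bounded continuous functions has the whole plane as domain. Clamping the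
  time extends everything continuously beyond [0, \<open>TT\<close>], so that no restricted function
  space is required.\<close>

definition cl :: "real \<Rightarrow> real" where "cl t = max 0 (min TT t)"

lemma cl: "cl t \<in> {0..TT}" "t \<in> {0..TT} \<Longrightarrow> cl t = t" "cl (cl t) = cl t"
  using TT by (auto simp: cl_def)

text \<open>A state holds the transforms of f and f_t divided by the envelope. The supremum norm of
  the type is then the weighted norm, and completeness comes with the type; \<open>PW\<close> and
  \<open>VW\<close> multiply the envelope back.\<close>

type_synonym state = "(real \<times> real) \<Rightarrow>\<^sub>C (complex \<times> complex)"

definition PW :: "state \<Rightarrow> real \<Rightarrow> real \<Rightarrow> complex" where
  "PW W t k = of_real (wt (tau (cl t)) k) * fst (apply_bcontfun W (cl t, k))"
definition VW :: "state \<Rightarrow> real \<Rightarrow> real \<Rightarrow> complex" where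
  "VW W t k = of_real (wt (tau (cl t)) k) * snd (apply_bcontfun W (cl t, k))"

lemma cl_cont [continuous_intros]:
  "continuous_on X f \<Longrightarrow> continuous_on X (\<lambda>x. cl (f x))"
  "continuous_on X f \<Longrightarrow> continuous_on X (\<lambda>x. tau (f x))"
  unfolding cl_def tau_def by (intro continuous_intros; assumption)+

lemma PW_cont: "continuous_on UNIV (\<lambda>(t, k). PW W t k)" "continuous_on UNIV (\<lambda>(t, k). VW W t k)"
proof -
  have "continuous_on UNIV (\<lambda>z::real \<times> real. apply_bcontfun W (cl (fst z), snd z))"
    by (rule continuous_on_compose2[OF continuous_on_apply_bcontfun[of UNIV W]]) (auto intro!: continuous_intros)
  then show "continuous_on UNIV (\<lambda>(t, k). PW W t k)" "continuous_on UNIV (\<lambda>(t, k). VW W t k)"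
    unfolding PW_def VW_def case_prod_beta by (intro continuous_intros; simp)+
qed

lemma PW_bounded:
  assumes "norm W \<le> B"
  shows "bounded_by B (tau (cl t)) (PW W t)" "bounded_by B (tau (cl t)) (VW W t)"
proof -
  have n: "norm (fst (apply_bcontfun W x)) \<le> B" "norm (snd (apply_bcontfun W x)) \<le> B" for x
    using norm_bounded[of W x] norm_fst_le[of "fst (apply_bcontfun W x)" "snd (apply_bcontfun W x)"]
      norm_snd_le[of "snd (apply_bcontfun W x)" "fst (apply_bcontfun W x)"] assms by auto
  have m: "PW W t \<in> borel_measurable borel" "VW W t \<in> borel_measurable borel"
    using slice_continuous(2)[OF PW_cont(1)] slice_continuous(2)[OF PW_cont(2)] by (auto intro!: borel_measurable_continuous_onI)
  show "bounded_by B (tau (cl t)) (PW W t)" "bounded_by B (tau (cl t)) (VW W t)"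
    unfolding bounded_by_def using m n wt_pos[of "tau (cl t)"]
    by (auto simp: PW_def VW_def norm_mult abs_of_pos mult.commute[of B] intro!: mult_left_mono less_imp_le)
qed

lemma NL_cont: "continuous_on UNIV (\<lambda>(s, k). NL (PW W) (VW W) s k)"
  unfolding NL_def
proof (rule continuous_on_nl[where B = "norm W" and \<tau> = "\<lambda>t. tau (cl t)"])
  show "1 \<le> tau (cl s)" for s using tau_bounds[OF cl(1)[of s]] by simp
qed (intro PW_cont PW_bounded order_refl)+

lemma NL_le:
  assumes "norm W \<le> B" "s \<in> {0..TT}"
  shows "norm (NL (PW W) (VW W) s k) \<le> CN * (B * B) * (\<bar>k\<bar> * wt (3 - RR * s) k)"
proof -
  have "norm (NL (PW W) (VW W) s k) \<le> CN * (B * B) * (\<bar>k\<bar> * wt (tau (cl s)) k)"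
    unfolding NL_def using tau_bounds[OF cl(1)[of s]] by (intro norm_nl_le PW_bounded assms) simp
  then show ?thesis unfolding cl(2)[OF assms(2)] tau_def .
qed

lemma NL_diff_le:
  assumes "norm W \<le> B" "norm W' \<le> B" "s \<in> {0..TT}"
  shows "norm (NL (PW W) (VW W) s k - NL (PW W') (VW W') s k) \<le> CN * (2 * B * dist W W') * (\<bar>k\<bar> * wt (3 - RR * s) k)"
proof -
  have d: "(\<lambda>k. PW W s k - PW W' s k) = PW (W - W') s" "(\<lambda>k. VW W s k - VW W' s k) = VW (W - W') s"
    by (auto simp: PW_def VW_def algebra_simps fun_eq_iff)
  have "norm (NL (PW W) (VW W) s k - NL (PW W') (VW W') s k) \<le> CN * (2 * B * dist W W') * (\<bar>k\<bar> * wt (tau (cl s)) k)"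
    unfolding NL_def
  proof (rule nl_diff)
    show "bounded_by (dist W W') (tau (cl s)) (\<lambda>k. PW W s k - PW W' s k)" "bounded_by (dist W W') (tau (cl s)) (\<lambda>k. VW W s k - VW W' s k)"
      unfolding d dist_norm by (rule PW_bounded[OF order_refl])+
    show "1 \<le> tau (cl s)" using tau_bounds[OF cl(1)[of s]] by simp
  qed (intro PW_bounded assms)+
  then show ?thesis unfolding cl(2)[OF assms(3)] tau_def .
qed

lemma duhamel_integral_le:
  assumes K: "K = PS \<or> K = PS'" and t: "t \<in> {0..TT}" and H: "H \<ge> 0" and h: "continuous_on {0..t} h"
    and hb: "\<And>s. s \<in> {0..TT} \<Longrightarrow> norm (h s) \<le> H * (\<bar>k\<bar> * wt (3 - RR * s) k)"
  shows "norm (of_real \<epsilon> * integral {0..t} (\<lambda>s. K (t - s) k * h s)) \<le> \<bar>\<epsilon>\<bar> * (2 * H / RR) * wt (tau t) k"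
proof -
  have "norm (integral {0..t} (\<lambda>s. K (t - s) k * h s)) \<le> 2 * H / RR * wt (3 - RR * t) k"
  proof (rule norm_duhamel_le[where K = "\<lambda>s. K s k"])
    show "continuous_on {0..t} (\<lambda>s. K (t - s) k)" using K by (auto intro!: continuous_intros)
    fix s assume s: "s \<in> {0..t}"
    then have "\<bar>t - s\<bar> \<le> 2" using t TT by auto
    then show "norm (K (t - s) k) \<le> 2" using K norm_PS_le[of "t - s" k] norm_PS'_le[of "t - s" k] by auto
    show "norm (h s) \<le> H * (\<bar>k\<bar> * wt (3 - RR * s) k)" using s t by (intro hb) auto
  qed (use t H h RR_ge in auto)
  from mult_left_mono[OF this, of "\<bar>\<epsilon>\<bar>"] show ?thesis by (simp add: norm_mult tau_def mult.assoc)
qed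

section \<open>The Picard map and its fixed point\<close>

definition picard :: "state \<Rightarrow> real \<times> real \<Rightarrow> complex \<times> complex" where
  "picard W z = (DP (PW W) (VW W) (cl (fst z)) (snd z) / of_real (wt (tau (cl (fst z))) (snd z)),
             DV (PW W) (VW W) (cl (fst z)) (snd z) / of_real (wt (tau (cl (fst z))) (snd z)))"

lemma picard_cont: "continuous_on UNIV (picard W)"
proof -
  have g: "continuous_on UNIV (\<lambda>z::real \<times> real. (cl (fst z), snd z))" by (intro continuous_intros)
  have "(\<lambda>z::real \<times> real. (cl (fst z), snd z)) ` UNIV \<subseteq> {0..} \<times> UNIV" by (auto simp: cl_def)
  from continuous_on_compose2[OF continuous_on_duhamel(1)[OF NL_cont] g this] continuous_on_compose2[OF continuous_on_duhamel(2)[OF NL_cont] g this]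
  have "continuous_on UNIV (\<lambda>z. DP (PW W) (VW W) (cl (fst z)) (snd z))" "continuous_on UNIV (\<lambda>z. DV (PW W) (VW W) (cl (fst z)) (snd z))"
    by simp_all
  then show ?thesis unfolding picard_def[abs_def] using wt_pos
    by (intro continuous_intros) (auto simp: less_le)
qed

lemma norm_Pair_le_add: "norm (a, b) \<le> norm a + norm (b :: complex)" for a :: complex
  by (simp add: norm_Pair sqrt_sum_squares_le_sum)

lemma picard_bound:
  assumes W: "norm W \<le> BB"
  shows "norm (picard W z) \<le> BB"
proof -
  let ?t = "cl (fst z)" and ?k = "snd z"
  let ?w = "wt (tau ?t) ?k"
  have w: "?w > 0" by (rule wt_pos)
  have H: "0 \<le> CN * (BB * BB)" using CN_nonneg BB_pos by simp
  have e: "E0 * ?w + \<bar>\<epsilon>\<bar> * (2 * (CN * (BB * BB)) / RR) * ?w \<le> (BB / 2) * ?w"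
  proof -
    have "\<bar>\<epsilon>\<bar> * (2 * (CN * (BB * BB)) / RR) \<le> 1 / 2"
      using RR_ge(2,4) by (simp add: divide_le_eq power2_eq_square algebra_simps)
    then have "(E0 + \<bar>\<epsilon>\<bar> * (2 * (CN * (BB * BB)) / RR)) * ?w \<le> (BB / 2) * ?w"
      using w by (intro mult_right_mono) (auto simp: BB_def)
    then show ?thesis by (simp add: distrib_right)
  qed
  have "norm (DP (PW W) (VW W) ?t ?k) \<le> (BB / 2) * ?w"
    unfolding duhamel(1)[OF NL_cont]
    by (rule order_trans[OF norm_triangle_le[OF add_mono[OF linear_part_le(1)[OF cl(1)] duhamel_integral_le[OF _ cl(1) H slice_continuous(1)[OF NL_cont] NL_le[OF W]]]] e]) simp_all
  moreover have "norm (DV (PW W) (VW W) ?t ?k) \<le> (BB / 2) * ?w"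
    unfolding duhamel(2)[OF NL_cont]
    by (rule order_trans[OF norm_triangle_le[OF add_mono[OF linear_part_le(2)[OF cl(1)] duhamel_integral_le[OF _ cl(1) H slice_continuous(1)[OF NL_cont] NL_le[OF W]]]] e]) simp_all
  ultimately have "norm (picard W z) \<le> BB / 2 + BB / 2"
    unfolding picard_def using w by (intro order_trans[OF norm_Pair_le_add] add_mono) (auto simp: norm_divide divide_le_eq)
  then show ?thesis by simp
qed

lemma picard_contraction:
  assumes W: "norm W \<le> BB" "norm W' \<le> BB"
  shows "dist (picard W z) (picard W' z) \<le> 1 / 2 * dist W W'"
proof -
  let ?t = "cl (fst z)" and ?k = "snd z"
  let ?w = "wt (tau ?t) ?k"
  let ?H = "CN * (2 * BB * dist W W')"
  have w: "?w > 0" by (rule wt_pos)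
  have H: "0 \<le> ?H" using CN_nonneg BB_pos by simp
  have e: "\<bar>\<epsilon>\<bar> * (2 * ?H / RR) \<le> 1 / 4 * dist W W'"
  proof -
    have "(16 * \<bar>\<epsilon>\<bar> * CN * BB) * dist W W' \<le> RR * dist W W'"
      using RR_ge(3) by (intro mult_right_mono) auto
    then show ?thesis using RR_ge(2) by (simp add: divide_le_eq algebra_simps)
  qed
  have i: "(\<lambda>s. K (?t - s) ?k * NL (PW U) (VW U) s ?k) integrable_on {0..?t}" if "K = PS \<or> K = PS'" for K U
    using that by (auto intro!: integrable_continuous_interval continuous_intros slice_continuous(1)[OF NL_cont])
  have d: "norm (of_real \<epsilon> * integral {0..?t} (\<lambda>s. K (?t - s) ?k * NL (PW W) (VW W) s ?k) -
      of_real \<epsilon> * integral {0..?t} (\<lambda>s. K (?t - s) ?k * NL (PW W') (VW W') s ?k)) \<le> (1 / 4 * dist W W') * ?w" if K: "K = PS \<or> K = PS'" for K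
  proof -
    have "of_real \<epsilon> * integral {0..?t} (\<lambda>s. K (?t - s) ?k * NL (PW W) (VW W) s ?k) -
      of_real \<epsilon> * integral {0..?t} (\<lambda>s. K (?t - s) ?k * NL (PW W') (VW W') s ?k) =
      of_real \<epsilon> * integral {0..?t} (\<lambda>s. K (?t - s) ?k * (NL (PW W) (VW W) s ?k - NL (PW W') (VW W') s ?k))"
      unfolding right_diff_distrib using i[OF K, of W] i[OF K, of W']
      by (simp only: Henstock_Kurzweil_Integration.integral_diff right_diff_distrib)
    also have "norm \<dots> \<le> \<bar>\<epsilon>\<bar> * (2 * ?H / RR) * ?w"
      by (rule duhamel_integral_le[OF K cl(1) H]) (intro continuous_intros slice_continuous(1)[OF NL_cont] NL_diff_le W; assumption)+
    also have "\<dots> \<le> (1 / 4 * dist W W') * ?w"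
      using w by (intro mult_right_mono e) auto
    finally show ?thesis .
  qed
  have "norm (DP (PW W) (VW W) ?t ?k - DP (PW W') (VW W') ?t ?k) \<le> (1 / 4 * dist W W') * ?w"
    using d[of PS] unfolding duhamel(1)[OF NL_cont] by simp
  moreover have "norm (DV (PW W) (VW W) ?t ?k - DV (PW W') (VW W') ?t ?k) \<le> (1 / 4 * dist W W') * ?w"
    using d[of PS'] unfolding duhamel(2)[OF NL_cont] by simp
  ultimately have "dist (picard W z) (picard W' z) \<le> 1 / 4 * dist W W' + 1 / 4 * dist W W'"
    unfolding picard_def dist_norm[of "(_, _)"] diff_Pair diff_divide_distrib[symmetric] using w
    by (intro order_trans[OF norm_Pair_le_add] add_mono) (simp_all add: norm_divide divide_le_eq)
  then show ?thesis by simp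
qed

text \<open>The symmetry of transforms of real functions. It is a closed condition preserved by
  \<open>picard\<close>, so it can be built into the complete set on which Banach's theorem is
  applied.\<close>

definition hermitian :: "state \<Rightarrow> bool" where
  "hermitian W \<longleftrightarrow> (\<forall>t k. fst (apply_bcontfun W (t, - k)) = cnj (fst (apply_bcontfun W (t, k))) \<and>
      snd (apply_bcontfun W (t, - k)) = cnj (snd (apply_bcontfun W (t, k))))"

lemma PW_cnj:
  assumes "hermitian W"
  shows "PW W t (- k) = cnj (PW W t k)" "VW W t (- k) = cnj (VW W t k)"
  using assms by (simp_all add: hermitian_def PW_def VW_def wt_minus)

lemma picard_cnj:
  assumes "hermitian W"
  shows "fst (picard W (t, - k)) = cnj (fst (picard W (t, k)))" "snd (picard W (t, - k)) = cnj (snd (picard W (t, k)))"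
proof -
  have N: "NL (PW W) (VW W) s (- k) = cnj (NL (PW W) (VW W) s k)" for s
    unfolding NL_def by (rule nl_cnj) (rule PW_cnj[OF assms])+
  have c: "c1 (PW W) (VW W) t (- k) = cnj (c1 (PW W) (VW W) t k)" "c2 (PW W) (VW W) t (- k) = cnj (c2 (PW W) (VW W) t k)" for t
    unfolding c1_def c2_def N data_cnj propagator_cnj complex_cnj_mult[symmetric] Henstock_Kurzweil_Integration.integral_cnj[symmetric]
    by simp_all
  show "fst (picard W (t, - k)) = cnj (fst (picard W (t, k)))" "snd (picard W (t, - k)) = cnj (snd (picard W (t, k)))"
    unfolding picard_def DP_def DV_def by (simp_all add: c propagator_cnj parity wt_minus)
qed

lemma fixed_point: "\<exists>W. norm W \<le> BB \<and> hermitian W \<and> apply_bcontfun W = picard W"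
proof -
  define S where "S = cball 0 BB \<inter> {W. hermitian W}"
  \<comment> \<open>Point evaluation is 1-Lipschitz in the supremum norm, which makes the symmetry a
    closed condition.\<close>
  have cf: "continuous_on UNIV (\<lambda>W::state. apply_bcontfun W x)" for x
    by (rule continuous_onI) (metis dist_bounded dist_commute le_less_trans less_imp_le)
  have "closed {W. hermitian W}"
    unfolding hermitian_def by (intro closed_Collect_all closed_Collect_conj closed_Collect_eq continuous_intros cf)
  then have closed: "closed S" unfolding S_def by (intro closed_Int closed_cball)
  have ne: "S \<noteq> {}"
  proof -
    have "0 \<in> S" using BB_pos by (simp add: S_def hermitian_def)
    then show ?thesis by blast
  qed
  define G where "G W = Bcontfun (picard W)" for W
  have FFb: "picard W \<in> bcontfun" if "W \<in> S" for W
    using that picard_bound by (intro bcontfun_normI[OF picard_cont]) (auto simp: S_def)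
  have ap: "apply_bcontfun (G W) = picard W" if "W \<in> S" for W
    unfolding G_def by (rule Bcontfun_inverse[OF FFb[OF that]])
  have GS: "G ` S \<subseteq> S"
  proof (rule image_subsetI)
    fix W assume W: "W \<in> S"
    have "norm (G W) \<le> BB" by (rule norm_bound) (use W picard_bound in \<open>auto simp: ap S_def\<close>)
    moreover have "hermitian (G W)" using picard_cnj W unfolding hermitian_def ap[OF W] S_def by auto
    ultimately show "G W \<in> S" by (simp add: S_def)
  qed
  have contr: "dist (G W) (G W') \<le> 1 / 2 * dist W W'" if "W \<in> S" "W' \<in> S" for W W'
    by (rule dist_bound) (use that picard_contraction in \<open>auto simp: ap S_def\<close>)
  obtain W where W: "W \<in> S" "G W = W"
    using Banach_fix[OF complete_eq_closed[THEN iffD2, OF closed] ne _ _ GS contr] by auto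
  then have "apply_bcontfun W = picard W" using ap[OF W(1)] by simp
  with W(1) show ?thesis by (auto simp: S_def)
qed

text \<open>From here on the moving weight is replaced by its worst case: the exponent stays at
  least 2, so \<open>wt 2\<close> bounds the solution uniformly in time.\<close>

theorem exists_mild_solution:
  obtains \<Phi> \<Psi> where "continuous_on UNIV (\<lambda>(t, k). \<Phi> t k)" "continuous_on UNIV (\<lambda>(t, k). \<Psi> t k)"
    "\<And>t. bounded_by BB 2 (\<Phi> t)" "\<And>t. bounded_by BB 2 (\<Psi> t)"
    "\<And>t k. \<Phi> t (- k) = cnj (\<Phi> t k)" "\<And>t k. \<Psi> t (- k) = cnj (\<Psi> t k)"
    "continuous_on UNIV (\<lambda>(t, k). NL \<Phi> \<Psi> t k)"
    "\<And>t k. t \<in> {0..TT} \<Longrightarrow> \<Phi> t k = DP \<Phi> \<Psi> t k" "\<And>t k. t \<in> {0..TT} \<Longrightarrow> \<Psi> t k = DV \<Phi> \<Psi> t k"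
proof -
  from fixed_point obtain W where W: "norm W \<le> BB" "hermitian W" "apply_bcontfun W = picard W" by blast
  have mono: "bounded_by B 2 P" if "bounded_by B (tau (cl t)) P" for B P t
  proof -
    have "wt (tau (cl t)) k \<le> wt 2 k" for k
      using tau_bounds[OF cl(1)[of t]] one_plus_square_pos[of k] unfolding wt_def
      by (intro divide_right_mono) (auto intro: mult_right_mono)
    with that show ?thesis unfolding bounded_by_def using bounded_byD(3)[OF that] by (meson mult_left_mono order_trans)
  qed
  show ?thesis
  proof (rule that[of "PW W" "VW W"])
    fix t k assume t: "t \<in> {0..TT}"
    have w: "complex_of_real (wt (tau t) k) \<noteq> 0" using wt_pos[of "tau t" k] by simp
    show "PW W t k = DP (PW W) (VW W) t k" "VW W t k = DV (PW W) (VW W) t k"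
      using w by (simp_all add: PW_def[of W t k] VW_def[of W t k] W(3) picard_def cl(2)[OF t] del: of_real_eq_0_iff)
  next
    show "bounded_by BB 2 (PW W t)" "bounded_by BB 2 (VW W t)" for t
      by (rule mono, rule PW_bounded[OF W(1)])+
  qed (rule PW_cont NL_cont PW_cnj[OF W(2)])+
qed

end

section \<open>Classical solutions in Wiener spaces\<close>

lemma hilbert_inv_fourier:
  assumes "decays B P"
  shows "hilbert (ift P) = ift (\<lambda>k. - \<i> * (of_real (sgn k) * P k))"
  unfolding hilbert_def by (subst multiplier_inv_fourier[OF integrable_decays[OF assms]]) (simp_all add: mult.assoc)

lemma conv_cmult: "conv (\<lambda>k. a * P k) (\<lambda>k. b * Q k) k = a * b * conv P Q k"
proof -
  have "conv (\<lambda>k. a * P k) (\<lambda>k. b * Q k) k = (LINT m|lborel. (a * b) * (P (k - m) * Q m))"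
    unfolding conv_def by (simp only: ac_simps)
  then show ?thesis by (simp add: conv_def)
qed

abbreviation ic :: complex where "ic \<equiv> complex_of_real (1 / sqrt (2 * pi))"

lemma inv_fourier_mult:
  assumes "integrable lborel P" "integrable lborel Q"
  shows "ift P x * ift Q x = ift (\<lambda>k. ic * conv P Q k) x"
proof -
  have "ic * complex_of_real (sqrt (2 * pi)) = 1"
    unfolding of_real_mult[symmetric] by simp
  then show ?thesis unfolding inv_fourier_cmult inv_fourier_conv[OF assms] mult.assoc[symmetric] by simp
qed

lemma integrable_bounded_mult:
  fixes g m :: "real \<Rightarrow> complex"
  assumes g: "integrable lborel g" and [measurable]: "m \<in> borel_measurable borel" and b: "\<And>k. norm (m k) \<le> A"
  shows "integrable lborel (\<lambda>k. m k * g k)"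
proof (rule Bochner_Integration.integrable_bound)
  show "integrable lborel (\<lambda>k. of_real A * g k)" using g by simp
  have "0 \<le> A" using order_trans[OF norm_ge_zero b] .
  then show "AE k in lborel. norm (m k * g k) \<le> norm (of_real A * g k)"
    unfolding norm_mult using b by (intro AE_I2 mult_right_mono) auto
qed (use g in measurable)

lemma integrable_abs_mult_conv:
  assumes P: "decays A P" and Q: "decays B Q"
  shows "integrable lborel (\<lambda>k. of_real \<bar>k\<bar> * conv P Q k)"
proof -
  have "integrable lborel (\<lambda>k. of_real (sgn k) * (of_real k * conv P Q k))"
    by (rule integrable_bounded_mult[OF integrable_mult_conv[OF P Q], where A = 1]) (auto simp: sgn_real_def)
  moreover have "complex_of_real (sgn k) * (of_real k * conv P Q k) = of_real \<bar>k\<bar> * conv P Q k" for k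
    by (auto simp: sgn_real_def)
  ultimately show ?thesis by simp
qed

lemma integrable_sgn_mult_conv:
  assumes P: "decays A P" and Q: "decays B Q"
  shows "integrable lborel (\<lambda>k. of_real (sgn k) * conv P Q k)"
  by (rule integrable_bounded_mult[OF integrable_conv[OF integrable_decays[OF P] integrable_decays[OF Q]], where A = 1]) (auto simp: sgn_real_def)

text \<open>The transform of the x-derivative of the commutator of the Hilbert transform with
  \<open>ift P\<close>, applied to \<open>ift Q\<close>.\<close>

definition dcomm :: "(real \<Rightarrow> complex) \<Rightarrow> (real \<Rightarrow> complex) \<Rightarrow> real \<Rightarrow> complex" where
  "dcomm P Q k = ic * (of_real \<bar>k\<bar> * conv P Q k - of_real k * conv P (\<lambda>m. of_real (sgn m) * Q m) k)"

lemma integrable_dcomm: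
  assumes P: "decays A P" and Q: "decays B Q"
  shows "integrable lborel (dcomm P Q)"
  unfolding dcomm_def using integrable_abs_mult_conv[OF P Q] integrable_mult_conv[OF P decays_sgn[OF Q]] by auto

text \<open>Products become convolutions, so the commutator is itself an inverse transform
  \<open>ift g\<close>. The decay of P and Q makes both g and kg integrable, which permits
  differentiation under the integral.\<close>

lemma commutator_has_vector_derivative:
  assumes P: "decays A P" and Q: "decays B Q"
  shows "(commutator hilbert (ift P) (ift Q) has_vector_derivative ift (dcomm P Q) x) (at x)"
proof -
  note Qs = decays_sgn[OF Q]
  note i = integrable_decays[OF P] integrable_decays[OF Q] integrable_decays[OF Qs]
  note cs = integrable_sgn_mult_conv[OF P Q] and c2 = integrable_conv[OF i(1) i(3)]
  define g where "g k = - \<i> * (ic * (of_real (sgn k) * conv P Q k - conv P (\<lambda>m. of_real (sgn m) * Q m) k))" for k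
  have c0: "integrable lborel (\<lambda>k. ic * conv P Q k)" using integrable_conv[OF i(1) i(2)] by simp
  have eq: "commutator hilbert (ift P) (ift Q) = ift g"
  proof
    fix x
    have 1: "hilbert (\<lambda>y. ift P y * ift Q y) x = ift (\<lambda>k. - \<i> * (ic * (of_real (sgn k) * conv P Q k))) x"
      unfolding inv_fourier_mult[OF i(1,2)] hilbert_def
      by (subst multiplier_inv_fourier[OF c0]) (simp_all add: ac_simps)
    have 2: "ift P x * hilbert (ift Q) x = ift (\<lambda>k. - \<i> * (ic * conv P (\<lambda>m. of_real (sgn m) * Q m) k)) x"
    proof -
      have "ift P x * hilbert (ift Q) x = - \<i> * (ift P x * ift (\<lambda>m. of_real (sgn m) * Q m) x)"
        unfolding hilbert_inv_fourier[OF Q] inv_fourier_cmult by (simp only: mult.left_commute)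
      then show ?thesis unfolding inv_fourier_mult[OF i(1,3)] inv_fourier_cmult .
    qed
    have "ift g x = ift (\<lambda>k. - \<i> * (ic * (of_real (sgn k) * conv P Q k)) - - \<i> * (ic * conv P (\<lambda>m. of_real (sgn m) * Q m) k)) x"
      unfolding g_def by (simp only: right_diff_distrib)
    also have "\<dots> = ift (\<lambda>k. - \<i> * (ic * (of_real (sgn k) * conv P Q k))) x - ift (\<lambda>k. - \<i> * (ic * conv P (\<lambda>m. of_real (sgn m) * Q m) k)) x"
      by (intro inv_fourier_diff integrable_mult_right cs c2)
    finally show "commutator hilbert (ift P) (ift Q) x = ift g x"
      unfolding commutator_def 1 2 by simp
  qed
  have kg: "\<i> * of_real k * g k = dcomm P Q k" for k
  proof -
    have "complex_of_real \<bar>k\<bar> = of_real k * of_real (sgn k)" by (auto simp: sgn_real_def)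
    moreover have "\<i> * K * (- \<i> * (C * (S * X - Y))) = C * (K * S * X - K * Y)" for K C S X Y :: complex
      by (simp add: algebra_simps)
    ultimately show ?thesis unfolding g_def dcomm_def by (simp only:)
  qed
  have gi: "integrable lborel g" unfolding g_def by (intro integrable_mult_right Bochner_Integration.integrable_diff cs c2)
  have kgi: "integrable lborel (\<lambda>k. of_real k * g k)"
  proof -
    have "of_real k * g k = - \<i> * dcomm P Q k" for k unfolding kg[symmetric] by (simp add: algebra_simps)
    then show ?thesis using integrable_dcomm[OF P Q] by simp
  qed
  show ?thesis unfolding eq using has_vector_derivative_inv_fourier[OF gi kgi, of x] unfolding kg .
qed

lemma hilbert_square_has_vector_derivative:
  assumes V: "decays B V"
  shows "((\<lambda>x. - hilbert (\<lambda>y. (hilbert (ift V) y)\<^sup>2) x) has_vector_derivative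
    ift (\<lambda>k. ic * (of_real \<bar>k\<bar> * conv (\<lambda>k. of_real (sgn k) * V k) (\<lambda>k. of_real (sgn k) * V k) k)) x) (at x)"
proof -
  define U where "U = (\<lambda>k. complex_of_real (sgn k) * V k)"
  have U: "decays B U" unfolding U_def by (rule decays_sgn[OF V])
  note i = integrable_decays[OF U]
  have ui: "integrable lborel (\<lambda>k. - \<i> * U k)" using i by simp
  have "(hilbert (ift V) y)\<^sup>2 = ift (\<lambda>k. - (ic * conv U U k)) y" for y
  proof -
    have "(hilbert (ift V) y)\<^sup>2 = ift (\<lambda>k. - \<i> * U k) y * ift (\<lambda>k. - \<i> * U k) y"
      unfolding hilbert_inv_fourier[OF V] U_def power2_eq_square ..
    also have "\<dots> = ift (\<lambda>k. ic * conv (\<lambda>k. - \<i> * U k) (\<lambda>k. - \<i> * U k) k) y"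
      by (rule inv_fourier_mult[OF ui ui])
    finally show ?thesis unfolding conv_cmult by simp
  qed
  then have sq: "(\<lambda>y. (hilbert (ift V) y)\<^sup>2) = ift (\<lambda>k. - (ic * conv U U k))" by auto
  define g where "g k = \<i> * (- (ic * (of_real (sgn k) * conv U U k)))" for k
  have ci: "integrable lborel (\<lambda>k. - (ic * conv U U k))" using integrable_conv[OF i i] by simp
  have "hilbert (\<lambda>y. (hilbert (ift V) y)\<^sup>2) x = ift (\<lambda>k. - 1 * g k) x" for x
    unfolding sq unfolding hilbert_def by (subst multiplier_inv_fourier[OF ci]) (simp_all add: g_def ac_simps)
  then have eq: "(\<lambda>x. - hilbert (\<lambda>y. (hilbert (ift V) y)\<^sup>2) x) = ift g"
    unfolding inv_fourier_cmult by auto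
  have kg: "\<i> * of_real k * g k = ic * (of_real \<bar>k\<bar> * conv U U k)" for k
  proof -
    have "complex_of_real \<bar>k\<bar> = of_real k * of_real (sgn k)" by (auto simp: sgn_real_def)
    moreover have "\<i> * K * (\<i> * (- (C * (S * X)))) = C * (K * S * X)" for K C S X :: complex
      by (simp add: algebra_simps)
    ultimately show ?thesis unfolding g_def by (simp only:)
  qed
  have gi: "integrable lborel g" unfolding g_def by (intro integrable_mult_right integrable_minus integrable_sgn_mult_conv[OF U U])
  have kgi: "integrable lborel (\<lambda>k. of_real k * g k)"
  proof -
    have "of_real k * g k = - \<i> * (ic * (of_real \<bar>k\<bar> * conv U U k))" for k unfolding kg[symmetric] by (simp add: algebra_simps)
    then show ?thesis using integrable_abs_mult_conv[OF U U] by simp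
  qed
  show ?thesis unfolding eq using has_vector_derivative_inv_fourier[OF gi kgi, of x] unfolding kg U_def .
qed

text \<open>One of the two units of the exponent absorbs the symbol m; the bound on m has the shape
  that \<open>monomial_le_exp\<close> supplies for |k|, |k|^2 and |k|^3.\<close>

lemma (in linear_wave) decays_of_bounded_by:
  assumes P: "bounded_by B 2 P" and [measurable]: "m \<in> borel_measurable borel" and m: "\<And>k. norm (m k) \<le> 27 * exp \<bar>k\<bar>"
  shows "decays (27 * B) (\<lambda>k. m k * P k)"
  unfolding decays_def
proof (intro conjI allI)
  note [measurable] = bounded_byD(1)[OF P]
  show "(\<lambda>k. m k * P k) \<in> borel_measurable borel" by measurable
  fix k
  have "norm (m k * P k) \<le> (27 * exp \<bar>k\<bar>) * (B * wt 2 k)"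
    unfolding norm_mult using m bounded_byD(2)[OF P] by (intro mult_mono) auto
  also have "wt 2 k = exp (- \<bar>k\<bar>) * (exp (- \<bar>k\<bar>) / (1 + k\<^sup>2))" using wt_split[of 1 1 k] by (simp add: wt_def)
  also have "(27 * exp \<bar>k\<bar>) * (B * (exp (- \<bar>k\<bar>) * (exp (- \<bar>k\<bar>) / (1 + k\<^sup>2)))) = (exp \<bar>k\<bar> * exp (- \<bar>k\<bar>)) * (27 * B * exp (- \<bar>k\<bar>) / (1 + k\<^sup>2))"
    by (simp only: ac_simps times_divide_eq_right)
  also have "exp \<bar>k\<bar> * exp (- \<bar>k\<bar>) = 1" by (simp flip: exp_add)
  finally show "norm (m k * P k) \<le> 27 * B * exp (- \<bar>k\<bar>) / (1 + k\<^sup>2)" by simp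
qed

text \<open>The transform of a function of time integrated over \<open>[0,t]\<close>: a bound in \<open>L\<^sup>1\<close> that is uniform
  in time survives the time integration by Tonelli.\<close>

lemma integrable_inv_fourier_time_integral:
  fixes g :: "real \<Rightarrow> real \<Rightarrow> complex"
  assumes g: "continuous_on UNIV (\<lambda>(s, k). g s k)" and t: "0 \<le> t"
    and b: "\<And>s k. s \<in> {0..t} \<Longrightarrow> norm (g s k) \<le> A * (1 / (1 + k\<^sup>2))"
    and C: "\<And>s. s \<in> {0..t} \<Longrightarrow> L1n (ift (g s)) \<le> ennreal C"
  shows "integrable lborel (\<lambda>k. integral {0..t} (\<lambda>s. g s k))"
    and "integrable lborel (ift (\<lambda>k. integral {0..t} (\<lambda>s. g s k)))"
proof -
  \<comment> \<open>Extension by 0 turns the time integral into an integral over the line, so that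
    Fubini applies to a product of Lebesgue measures.\<close>
  define G where "G s k = indicator {0..t} s *\<^sub>R g s k" for s k
  have gm: "(\<lambda>z. g (fst z) (snd z)) \<in> borel_measurable (borel \<Otimes>\<^sub>M borel)"
    unfolding borel_prod using g by (intro borel_measurable_continuous_onI) (simp add: case_prod_beta)
  have Gm[measurable]: "(\<lambda>z. G (fst z) (snd z)) \<in> borel_measurable (borel \<Otimes>\<^sub>M borel)"
    unfolding G_def using gm by measurable
  have A: "A \<ge> 0" using order_trans[OF norm_ge_zero b[of 0 0]] t by simp
  have bG: "norm (G s k) \<le> indicator {0..t} s * (A * (1 / (1 + k\<^sup>2)))" for s k
    using b[of s k] by (auto simp: G_def indicator_def)
  have Gi: "integrable (lborel \<Otimes>\<^sub>M lborel) (\<lambda>(s, k). G s k)"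
  proof (rule Bochner_Integration.integrable_bound)
    define u where "u s k = indicator {0..t} s * (A * (1 / (1 + k\<^sup>2)))" for s k :: real
    have u0: "norm (u s k) = u s k" for s k
      using A one_plus_square_pos[of k] by (simp add: u_def)
    have um: "(\<lambda>(s, k). u s k) \<in> borel_measurable (lborel \<Otimes>\<^sub>M lborel)" unfolding u_def by measurable
    show "integrable (lborel \<Otimes>\<^sub>M lborel) (\<lambda>(s, k). u s k)"
    proof (rule lborel_pair.Fubini_integrable[OF um])
      have "(LINT k|lborel. norm (u s k)) = indicator {0..t} s * (A * pi)" for s
        unfolding u0 unfolding u_def by (simp only: integral_mult_right_zero integral_inverse_one_plus_square)
      then show "integrable lborel (\<lambda>s. LINT k|lborel. norm (case (s, k) of (s, k) \<Rightarrow> u s k))"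
        using t by simp
      show "AE s in lborel. integrable lborel (\<lambda>k. case (s, k) of (s, k) \<Rightarrow> u s k)"
        unfolding u_def prod.case by (intro AE_I2 integrable_mult_right integrable_inverse_one_plus_square)
    qed
    show "(\<lambda>(s, k). G s k) \<in> borel_measurable (lborel \<Otimes>\<^sub>M lborel)" by (simp add: case_prod_beta)
    show "AE z in lborel \<Otimes>\<^sub>M lborel. norm (case z of (s, k) \<Rightarrow> G s k) \<le> norm (case z of (s, k) \<Rightarrow> u s k)"
      using bG unfolding u_def[symmetric] by (intro AE_I2) (auto intro: order_trans[OF _ abs_ge_self])
  qed
  have HK: "integral {0..t} (\<lambda>s. g s k) = (LINT s|lborel. G s k)" for k
  proof -
    have "continuous_on {0..t} (\<lambda>s. (s, k))" by (intro continuous_intros)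
    from continuous_on_compose2[OF g this] have "continuous_on {0..t} (\<lambda>s. g s k)" by simp
    then have "set_integrable lborel {0..t} (\<lambda>s. g s k)" by (rule borel_integrable_atLeastAtMost')
    from set_borel_integral_eq_integral(2)[OF this] show ?thesis by (simp add: set_lebesgue_integral_def G_def)
  qed
  show i: "integrable lborel (\<lambda>k. integral {0..t} (\<lambda>s. g s k))"
    unfolding HK using lborel_pair.integrable_snd[OF Gi] .
  define h where "h s x = ift (G s) x" for s x
  have eq: "ift (\<lambda>k. integral {0..t} (\<lambda>s. g s k)) x = (LINT s|lborel. h s x)" for x
  proof -
    have "(LINT k|lborel. (LINT s|lborel. G s k) * iexp (k * x)) = (LINT k|lborel. LINT s|lborel. G s k * iexp (k * x))" by simp
    also have "\<dots> = (LINT s|lborel. LINT k|lborel. G s k * iexp (k * x))"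
    proof (rule lborel_pair.Fubini_integral)
      show "integrable (lborel \<Otimes>\<^sub>M lborel) (\<lambda>(s, k). G s k * iexp (k * x))"
      proof (rule Bochner_Integration.integrable_bound[OF Gi])
        show "(\<lambda>(s, k). G s k * iexp (k * x)) \<in> borel_measurable (lborel \<Otimes>\<^sub>M lborel)" by (simp add: case_prod_beta) measurable
      qed (auto simp: norm_mult norm_exp_i_times)
    qed
    finally show ?thesis unfolding HK h_def inv_fourier_integral_def by simp
  qed
  \<comment> \<open>Tonelli in (s, x) requires joint measurability, which is inherited from the
    integral over k with (s, x) as parameter.\<close>
  have hm: "(\<lambda>(s, x). h s x) \<in> borel_measurable (borel \<Otimes>\<^sub>M borel)"
  proof -
    have "(\<lambda>y. G (fst (fst y)) (snd y)) \<in> borel_measurable ((borel \<Otimes>\<^sub>M borel) \<Otimes>\<^sub>M borel)"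
      using measurable_compose[OF _ Gm, of "\<lambda>y. (fst (fst y), snd y)" "(borel \<Otimes>\<^sub>M borel) \<Otimes>\<^sub>M borel"] by simp
    moreover have "(\<lambda>y. iexp (snd y * snd (fst y))) \<in> borel_measurable ((borel \<Otimes>\<^sub>M borel) \<Otimes>\<^sub>M borel)"
      by measurable
    ultimately have "(\<lambda>y. G (fst (fst y)) (snd y) * iexp (snd y * snd (fst y))) \<in> borel_measurable ((borel \<Otimes>\<^sub>M borel) \<Otimes>\<^sub>M borel)"
      by (rule borel_measurable_times)
    then have "(\<lambda>y. G (fst (fst y)) (snd y) * iexp (snd y * snd (fst y))) \<in> borel_measurable ((borel \<Otimes>\<^sub>M borel) \<Otimes>\<^sub>M lborel)"
      by (simp cong: measurable_cong_sets sets_pair_measure_cong)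
    then have "(\<lambda>(z, k). G (fst z) k * iexp (k * snd z)) \<in> borel_measurable ((borel \<Otimes>\<^sub>M borel) \<Otimes>\<^sub>M lborel)"
      by (simp add: case_prod_beta)
    from lborel.borel_measurable_lebesgue_integral[OF this]
    show ?thesis unfolding h_def inv_fourier_integral_def case_prod_beta by measurable
  qed
  have "L1n (\<lambda>x. LINT s|lborel. h s x) \<le> (\<integral>\<^sup>+x. \<integral>\<^sup>+s. ennreal (norm (h s x)) \<partial>lborel \<partial>lborel)"
    by (intro nn_integral_mono norm_LINT_le_nn_integral)
  also have "\<dots> = (\<integral>\<^sup>+s. \<integral>\<^sup>+x. ennreal (norm (h s x)) \<partial>lborel \<partial>lborel)"
    by (rule lborel_pair.Fubini') (use hm in \<open>simp add: case_prod_beta\<close>)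
  also have "\<dots> \<le> (\<integral>\<^sup>+s. ennreal C * indicator {0..t} s \<partial>lborel)"
  proof (intro nn_integral_mono)
    fix s
    show "L1n (h s) \<le> ennreal C * indicator {0..t} s"
    proof (cases "s \<in> {0..t}")
      case True
      then have "G s = g s" by (auto simp: G_def)
      then show ?thesis using C[OF True] True by (simp add: h_def)
    next
      case False
      then have "h s x = 0" for x by (simp add: h_def G_def inv_fourier_integral_def)
      then show ?thesis by simp
    qed
  qed
  also have "\<dots> < \<infinity>" using t by (subst nn_integral_cmult_indicator) (auto simp: ennreal_mult_less_top)
  finally have fin: "L1n (\<lambda>x. LINT s|lborel. h s x) < \<infinity>" .
  show "integrable lborel (ift (\<lambda>k. integral {0..t} (\<lambda>s. g s k)))"
    by (rule integrableI_bounded) (use fin i in \<open>auto simp: eq\<close>)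
qed

text \<open>A cutoff equal to \<open>1\<close> on \<open>[-D,D]\<close> does not change the product, and makes the multiplier
  Lipschitz with compact support.\<close>

lemma integrable_inv_fourier_band_limited:
  fixes \<mu> :: "real \<Rightarrow> complex"
  assumes \<mu>: "tame I f" "i \<in> I" "f i = \<mu>" and [measurable]: "\<mu> \<in> borel_measurable borel"
    and r: "integrable lborel r" and supp: "\<And>k. \<bar>k\<bar> > D \<Longrightarrow> fourier_integral r k = 0" and D: "D \<ge> 0"
  shows "integrable lborel (ift (\<lambda>k. \<mu> k * fourier_integral r k))"
proof -
  define cut where "cut k = max 0 (min 1 (D + 1 - \<bar>k\<bar>))" for k :: real
  have "tame I (\<lambda>i. cut)"
  proof (rule tame_dominated[OF tame_id, of _ _ 1])
    show "norm (cut k) \<le> 1" for k by (auto simp: cut_def)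
    show "norm (cut (k + h) - cut k) \<le> norm (k + h - k)" for k h by (auto simp: cut_def max_def min_def abs_if split: if_splits)
  qed
  then have "tame I (\<lambda>i k. f i k * complex_of_real (cut k))" by (intro tame_mult \<mu>(1) tame_of_real)
  then obtain M where M: "M \<ge> 0" "\<And>i k. i \<in> I \<Longrightarrow> norm (f i k * complex_of_real (cut k)) \<le> M * exp (\<bar>k\<bar> / 2)"
    "\<And>i k h. i \<in> I \<Longrightarrow> 0 < h \<Longrightarrow> h \<le> 1 \<Longrightarrow> norm (f i (k + h) * complex_of_real (cut (k + h)) - f i k * complex_of_real (cut k)) \<le> h * (M * exp (\<bar>k\<bar> / 2))"
    by (rule tame_exp_bounds) blast
  define n where "n k = \<mu> k * complex_of_real (cut k)" for k
  define K where "K = M * exp ((D + 2) / 2)"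
  \<comment> \<open>The cutoff symbol n lives on [-(D+1), D+1]. The majorant reaches one unit
    further because the increment from k to k + h with h <= 1 can be nonzero while k is still
    outside.\<close>
  define G where "G k = K * indicator {-(D + 2)..D + 2} k" for k :: real
  have [measurable]: "cut \<in> borel_measurable borel" unfolding cut_def[abs_def] by measurable
  have [measurable]: "n \<in> borel_measurable borel" unfolding n_def[abs_def] by measurable
  have [measurable]: "G \<in> borel_measurable borel" unfolding G_def[abs_def] by measurable
  have n0: "n k = 0" if "\<bar>k\<bar> \<ge> D + 1" for k using that by (simp add: n_def cut_def)
  have e: "M * exp (\<bar>k\<bar> / 2) \<le> G k" if "\<bar>k\<bar> \<le> D + 2" for k
    using that M(1) by (auto simp: G_def K_def indicator_def intro!: mult_left_mono)
  have G0: "G k \<ge> 0" for k using M(1) by (simp add: G_def K_def)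
  have nG: "norm (n k) \<le> G k" for k
  proof (cases "\<bar>k\<bar> \<le> D + 2")
    case True
    then show ?thesis using M(2)[OF \<mu>(2), of k] e[OF True] by (simp add: n_def \<mu>(3))
  qed (use n0[of k] G0 in auto)
  have nL: "norm (n (k + h) - n k) \<le> h * G k" if h: "0 < h" "h \<le> 1" for h k
  proof (cases "\<bar>k\<bar> \<le> D + 2")
    case True
    have "norm (n (k + h) - n k) \<le> h * (M * exp (\<bar>k\<bar> / 2))" using M(3)[OF \<mu>(2) h, of k] by (simp add: n_def \<mu>(3))
    also have "\<dots> \<le> h * G k" using h e[OF True] by (intro mult_left_mono) auto
    finally show ?thesis .
  next
    case False
    then have "D + 1 \<le> \<bar>k\<bar>" "D + 1 \<le> \<bar>k + h\<bar>" using h by linarith+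
    then show ?thesis using n0 h G0 by simp
  qed
  have Gi: "integrable lborel G"
    unfolding G_def by (intro integrable_mult_right integrable_real_indicator) (auto simp: emeasure_lborel_Icc_eq)
  have ni: "integrable lborel n"
    by (rule Bochner_Integration.integrable_bound[OF Gi]) (use nG G0 in auto)
  have "L1n (ift n) \<le> ennreal pi + 2 * (\<integral>\<^sup>+k. ennreal ((G k)\<^sup>2) \<partial>lborel)"
    by (rule nn_integral_inv_fourier_Lipschitz[OF ni _ nG nL]) measurable
  also have "(\<integral>\<^sup>+k. ennreal ((G k)\<^sup>2) \<partial>lborel) = (\<integral>\<^sup>+k. ennreal (K\<^sup>2) * indicator {-(D + 2)..D + 2} k \<partial>lborel)"
    by (intro nn_integral_cong) (auto simp: G_def indicator_def)
  also have "\<dots> = ennreal (K\<^sup>2) * ennreal (2 * (D + 2))" using D by (subst nn_integral_cmult_indicator) auto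
  also have "ennreal pi + 2 * (ennreal (K\<^sup>2) * ennreal (2 * (D + 2))) < \<infinity>" by (simp add: ennreal_mult_less_top)
  finally have "L1n (ift n) < \<infinity>" .
  then have inv: "integrable lborel (ift n)"
    using ni by (intro integrableI_bounded) auto
  have "\<mu> k * fourier_integral r k = n k * fourier_integral r k" for k
    using supp[of k] by (cases "\<bar>k\<bar> \<le> D") (auto simp: n_def cut_def)
  then have "ift (\<lambda>k. \<mu> k * fourier_integral r k) = ift (\<lambda>k. n k * fourier_integral r k)"
    by (simp only:)
  also have "\<dots> = (\<lambda>x. ic * conv (ift n) r x)"
    by (rule ext, rule inv_fourier_mult_fourier[OF ni r])
  finally show ?thesis using integrable_conv[OF inv r] by simp
qed

lemma inv_fourier_real:
  assumes "\<And>k. g (- k) = cnj (g k)"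
  shows "complex_of_real (Re (ift g x)) = ift g x"
proof -
  have "cnj (LINT k|lborel. g k * iexp (k * x)) = (LINT k|lborel. cnj (g k * iexp (k * x)))"
    by (rule Bochner_Integration.integral_cnj[symmetric])
  also have "\<dots> = (LINT k|lborel. g (0 + - 1 * k) * iexp ((0 + - 1 * k) * x))"
    by (intro Bochner_Integration.integral_cong refl) (simp add: assms exp_cnj)
  also have "\<dots> = (LINT k|lborel. g k * iexp (k * x))"
    using lborel_integral_real_affine[of "-1" "\<lambda>k. g k * iexp (k * x)" 0] by simp
  finally have "cnj (ift g x) = ift g x"
    by (simp add: inv_fourier_integral_def)
  then show ?thesis by (simp add: complex_eq_iff)
qed

section \<open>Regularity in the Wiener spaces\<close>

context linear_wave begin

text \<open>\<open>solves_ivp\<close> speaks of real functions. For U with the symmetry of real data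
  the inverse transform is real, so taking the real part changes nothing.\<close>

definition phys :: "(real \<Rightarrow> real \<Rightarrow> complex) \<Rightarrow> real \<Rightarrow> real \<Rightarrow> real" where
  "phys U t x = Re (ift (U t) x)"

lemma wt_le: "\<tau> \<le> 1 \<Longrightarrow> exp (\<tau> * \<bar>k\<bar>) * wt 2 k \<le> wt 0 k"
proof -
  assume "\<tau> \<le> 1"
  then have "\<tau> * \<bar>k\<bar> + - 2 * \<bar>k\<bar> \<le> 0" using mult_right_mono[of \<tau> 2 "\<bar>k\<bar>"] by simp
  then have "exp (\<tau> * \<bar>k\<bar>) * exp (- 2 * \<bar>k\<bar>) \<le> 1" unfolding exp_add[symmetric] by simp
  from divide_right_mono[OF this, of "1 + k\<^sup>2"] show ?thesis
    using one_plus_square_pos[of k] unfolding wt_def by simp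
qed

lemma wt0_integrable: "integrable lborel (wt 0)"
  unfolding wt_0 by (rule integrable_inverse_one_plus_square)

text \<open>The envelope \<open>wt 2\<close> leaves room for the weight exp |k|, so dominated
  convergence gives continuity in time in the Wiener norm for every \<tau> <= 1. The case 1/2 is
  membership in \<open>C_wiener\<close>; the case 1 shows that samples of the curve at finitely many
  times converge to it, as strong measurability in \<open>Linf_wiener\<close> demands.\<close>

lemma regularity:
  assumes U: "continuous_on UNIV (\<lambda>(t, k). U t k)" and b: "\<And>t. bounded_by B 2 (U t)"
    and c: "\<And>t k. U t (- k) = cnj (U t k)"
    and i: "\<And>t. t \<in> {0..T} \<Longrightarrow> integrable lborel (ift (U t))" and T: "T > 0"
  shows "(\<lambda>t. cplx (phys U t)) \<in> Linf_wiener T 1" "(\<lambda>t. cplx (phys U t)) \<in> C_wiener T (1/2)"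
proof -
  define u where "u t = cplx (phys U t)" for t
  have u: "u t = ift (U t)" for t
    unfolding u_def cplx_def phys_def using inv_fourier_real[of "U t"] c by auto
  have [measurable]: "U t \<in> borel_measurable borel" for t by (rule bounded_byD(1)[OF b])
  have B: "B \<ge> 0" by (rule bounded_byD(3)[OF b])
  have Ub: "norm (U t k) \<le> B * wt 2 k" for t k by (rule bounded_byD(2)[OF b])
  have wpos: "wt \<tau> k \<ge> 0" for \<tau> k using wt_pos[of \<tau> k] by simp
  have Ui: "integrable lborel (U t)" for t
  proof (rule Bochner_Integration.integrable_bound[OF integrable_mult_right[OF wt0_integrable, of B]])
    have "norm (U t k) \<le> B * wt 0 k" for k
      using Ub[of t k] mult_left_mono[OF wt_le[of 0 k] B] by simp
    then show "AE k in lborel. norm (U t k) \<le> norm (B * wt 0 k)"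
      by (intro AE_I2) (auto intro: order_trans[OF _ abs_ge_self])
  qed measurable
  have ui: "integrable lborel (u t)" if "t \<in> {0..T}" for t using i[OF that] unfolding u .
  have four: "fourier (u t) = fourier_integral (u t)" "AE k in lborel. fourier_integral (u t) k = U t k"
    "fourier_integral (u t) \<in> borel_measurable borel" if "t \<in> {0..T}" for t
  proof -
    show 1: "fourier (u t) = fourier_integral (u t)" using ui[OF that] by (simp add: fourier_def)
    show "AE k in lborel. fourier_integral (u t) k = U t k" unfolding u by (rule fourier_inversion[OF Ui i[OF that]])
    show "fourier_integral (u t) \<in> borel_measurable borel" using AE_fourier_inv_fourier(2)[OF Ui, of t] 1 unfolding u by simp
  qed
  have wi: "integrable lborel (\<lambda>k. exp (\<tau> * \<bar>k\<bar>) * norm (U t k))" and wb: "exp (\<tau> * \<bar>k\<bar>) * norm (U t k) \<le> B * wt 0 k"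
    if "\<tau> \<le> 1" for \<tau> t k
  proof -
    show *: "exp (\<tau> * \<bar>k\<bar>) * norm (U t k) \<le> B * wt 0 k" for k
    proof -
      have "exp (\<tau> * \<bar>k\<bar>) * norm (U t k) \<le> exp (\<tau> * \<bar>k\<bar>) * (B * wt 2 k)" by (intro mult_left_mono Ub) simp
      also have "\<dots> = B * (exp (\<tau> * \<bar>k\<bar>) * wt 2 k)" by simp
      also have "\<dots> \<le> B * wt 0 k" by (intro mult_left_mono wt_le that B)
      finally show ?thesis .
    qed
    show "integrable lborel (\<lambda>k. exp (\<tau> * \<bar>k\<bar>) * norm (U t k))"
    proof (rule Bochner_Integration.integrable_bound[OF integrable_mult_right[OF wt0_integrable, of B]])
      show "AE k in lborel. norm (exp (\<tau> * \<bar>k\<bar>) * norm (U t k)) \<le> norm (B * wt 0 k)"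
        using * B wpos by (intro AE_I2) auto
    qed measurable
  qed
  have wn: "wiener_norm \<tau> (u t) = (LINT k|lborel. exp (\<tau> * \<bar>k\<bar>) * norm (U t k))" and w: "u t \<in> wiener \<tau>"
    if t: "t \<in> {0..T}" and \<tau>: "\<tau> \<le> 1" for t \<tau>
  proof -
    note [measurable] = four(3)[OF t]
    have ae: "AE k in lborel. exp (\<tau> * \<bar>k\<bar>) * norm (fourier_integral (u t) k) = exp (\<tau> * \<bar>k\<bar>) * norm (U t k)"
      using four(2)[OF t] by eventually_elim simp
    show "wiener_norm \<tau> (u t) = (LINT k|lborel. exp (\<tau> * \<bar>k\<bar>) * norm (U t k))"
      unfolding wiener_norm_def four(1)[OF t] by (rule integral_cong_AE) (use ae in measurable)
    have "integrable lborel (\<lambda>k. exp (\<tau> * \<bar>k\<bar>) * norm (fourier_integral (u t) k))"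
      using wi[OF \<tau>, of t] by (subst integrable_cong_AE[OF _ _ ae]) measurable
    then show "u t \<in> wiener \<tau>" unfolding wiener_def using ui[OF t] four(1)[OF t] by simp
  qed
  have wd: "wiener_norm \<tau> (\<lambda>x. u s x - u t x) = (LINT k|lborel. exp (\<tau> * \<bar>k\<bar>) * norm (U s k - U t k))"
    if t: "t \<in> {0..T}" "s \<in> {0..T}" for s t \<tau>
  proof -
    have di: "integrable lborel (\<lambda>x. u s x - u t x)" using ui t by simp
    have "fourier (\<lambda>x. u s x - u t x) k = fourier_integral (u s) k - fourier_integral (u t) k" for k
      unfolding fourier_def using di inv_fourier_diff[OF ui[OF t(2)] ui[OF t(1)]] by (simp add: fourier_integral_eq)
    then have F: "fourier (\<lambda>x. u s x - u t x) = (\<lambda>k. fourier_integral (u s) k - fourier_integral (u t) k)" by auto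
    note [measurable] = four(3)[OF t(1)] four(3)[OF t(2)]
    have ae: "AE k in lborel. exp (\<tau> * \<bar>k\<bar>) * norm (fourier_integral (u s) k - fourier_integral (u t) k) = exp (\<tau> * \<bar>k\<bar>) * norm (U s k - U t k)"
      using four(2)[OF t(1)] four(2)[OF t(2)] by eventually_elim simp
    show ?thesis unfolding wiener_norm_def F by (rule integral_cong_AE) (use ae in measurable)
  qed
  have lim: "((\<lambda>s. wiener_norm \<tau> (\<lambda>x. u s x - u t x)) \<longlongrightarrow> 0) (at t within {0..T})" if t: "t \<in> {0..T}" and \<tau>: "\<tau> \<le> 1" for t \<tau>
  proof -
    let ?F = "\<lambda>s k. complex_of_real (exp (\<tau> * \<bar>k\<bar>) * norm (U s k - U t k))"
    have "continuous_on {0..T} (\<lambda>s. LINT k|lborel. ?F s k)"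
    proof (rule continuous_on_LINT[where G = "\<lambda>k. 2 * B * wt 0 k"])
      show "?F s \<in> borel_measurable lborel" for s by measurable
      show "integrable lborel (\<lambda>k. 2 * B * wt 0 k)" by (intro integrable_mult_right wt0_integrable)
      fix s k :: real
      have "exp (\<tau> * \<bar>k\<bar>) * norm (U s k - U t k) \<le> exp (\<tau> * \<bar>k\<bar>) * (norm (U s k) + norm (U t k))"
        by (intro mult_left_mono norm_triangle_ineq4) simp
      also have "\<dots> \<le> 2 * B * wt 0 k" using wb[OF \<tau>, of k s] wb[OF \<tau>, of k t] by (simp add: distrib_left)
      finally show "norm (?F s k) \<le> 2 * B * wt 0 k" by (simp add: norm_mult)
    next
      fix s assume s: "s \<in> {0..T}"
      have "continuous (at s within {0..T}) (\<lambda>s. ?F s k)" for k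
      proof -
        have "continuous_on {0..T} (\<lambda>s. (s, k))" by (intro continuous_intros)
        from continuous_on_compose2[OF U this] have "continuous_on {0..T} (\<lambda>s. U s k)" by simp
        then have "continuous_on {0..T} (\<lambda>s. ?F s k)" by (intro continuous_intros)
        with s show ?thesis by (simp add: continuous_on_eq_continuous_within)
      qed
      then show "AE k in lborel. continuous (at s within {0..T}) (\<lambda>s. ?F s k)" by simp
    qed
    then have "((\<lambda>s. LINT k|lborel. ?F s k) \<longlongrightarrow> (LINT k|lborel. ?F t k)) (at t within {0..T})"
      using t unfolding continuous_on_def by blast
    from tendsto_Re[OF this[unfolded integral_complex_of_real], unfolded Re_complex_of_real]
    have "((\<lambda>s. LINT k|lborel. exp (\<tau> * \<bar>k\<bar>) * norm (U s k - U t k)) \<longlongrightarrow> 0) (at t within {0..T})"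
      by simp
    then show ?thesis
      by (rule Lim_transform_within[where d = 1]) (use wd[OF t] in auto)
  qed
  show "(\<lambda>t. cplx (phys U t)) \<in> C_wiener T (1/2)"
    unfolding C_wiener_def u_def[symmetric] using w lim by auto
  show "(\<lambda>t. cplx (phys U t)) \<in> Linf_wiener T 1"
    unfolding Linf_wiener_def u_def[symmetric] mem_Collect_eq
  proof (intro conjI exI)
    have "u t \<in> wiener 1 \<and> wiener_norm 1 (u t) \<le> B * pi" if t: "t \<in> {0..T}" for t
    proof
      show "u t \<in> wiener 1" using w[OF t] by simp
      have "wiener_norm 1 (u t) \<le> (LINT k|lborel. B * wt 0 k)"
        unfolding wn[OF t order_refl] by (intro integral_mono wi wb order_refl integrable_mult_right wt0_integrable)
      also have "\<dots> = B * pi" unfolding wt_0 by (simp only: integral_mult_right_zero integral_inverse_one_plus_square)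
      finally show "wiener_norm 1 (u t) \<le> B * pi" .
    qed
    then show "AE t in lebesgue_on {0..T}. u t \<in> wiener 1 \<and> wiener_norm 1 (u t) \<le> B * pi"
      by (intro AE_I2) (simp add: space_restrict_space)
    \<comment> \<open>Rounding t down to the grid of mesh T / (n + 1) in [0, T] takes finitely many
      values, so u composed with it is a simple function.\<close>
    define g where "g n t = T * (of_int \<lfloor>real (Suc n) * (t / T)\<rfloor> / real (Suc n))" for n t
    have fl: "of_int \<lfloor>y\<rfloor> \<le> y \<and> y < of_int \<lfloor>y\<rfloor> + 1 \<and> (0 \<le> y \<longrightarrow> 0 \<le> real_of_int \<lfloor>y\<rfloor>)" for y :: real
      using real_of_int_floor_add_one_gt[of y] of_int_floor_le[of y] by simp
    have fl': "\<lfloor>y\<rfloor> \<in> {0..int m}" if "0 \<le> y" "y \<le> real m" for y :: real and m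
      using floor_mono[OF that(2)] that(1) by simp
    have g0: "g n t \<in> {0..T}" "\<bar>g n t - t\<bar> \<le> T / real (Suc n)" if t: "t \<in> {0..T}" for n t
    proof -
      let ?y = "real (Suc n) * (t / T)"
      have y0: "0 \<le> ?y" using t T by auto
      have f: "of_int \<lfloor>?y\<rfloor> \<le> ?y" "?y < of_int \<lfloor>?y\<rfloor> + 1" "0 \<le> real_of_int \<lfloor>?y\<rfloor>"
        using fl[of ?y] y0 by auto
      have ty: "t = T * (?y / real (Suc n))" using T by simp
      have le: "T * (of_int \<lfloor>?y\<rfloor> / real (Suc n)) \<le> T * (?y / real (Suc n))"
        using T f(1) by (intro mult_left_mono divide_right_mono) auto
      have ge: "T * (?y / real (Suc n)) \<le> T * ((of_int \<lfloor>?y\<rfloor> + 1) / real (Suc n))"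
        using T f(2) by (intro mult_left_mono divide_right_mono) auto
      have le': "g n t \<le> t" using le ty by (simp only: g_def)
      have "t \<le> T * ((of_int \<lfloor>?y\<rfloor> + 1) / real (Suc n))" using ge ty by simp
      also have "\<dots> = g n t + T / real (Suc n)" by (simp add: g_def add_divide_distrib distrib_left)
      finally show "\<bar>g n t - t\<bar> \<le> T / real (Suc n)" using le' by linarith
      have "0 \<le> g n t" unfolding g_def using T f(3) by simp
      then show "g n t \<in> {0..T}" using le' t by auto
    qed
    have gs: "simple_function (lebesgue_on {0..T}) (g n)" for n
    proof (rule simple_function_borel_measurable)
      have "g n \<in> borel_measurable borel" unfolding g_def[abs_def] by measurable
      then show "g n \<in> borel_measurable (lebesgue_on {0..T})"
        by (intro measurable_restrict_space1 measurable_completion) simp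
      have "g n ` {0..T} \<subseteq> (\<lambda>j. T * (of_int j / real (Suc n))) ` {0..int (Suc n)}"
      proof (rule image_subsetI)
        fix t assume t: "t \<in> {0..T}"
        have "t / T \<le> 1" "0 \<le> t / T" using t T by auto
        then have "\<lfloor>real (Suc n) * (t / T)\<rfloor> \<in> {0..int (Suc n)}"
          by (intro fl' mult_left_le mult_nonneg_nonneg of_nat_0_le_iff)
        then show "g n t \<in> (\<lambda>j. T * (of_int j / real (Suc n))) ` {0..int (Suc n)}" unfolding g_def by blast
      qed
      then have "finite (g n ` {0..T})" by (rule finite_subset) (intro finite_imageI finite_atLeastAtMost_int)
      then show "finite (g n ` space (lebesgue_on {0..T}))" by (simp add: space_restrict_space)
    qed
    show "\<forall>n. simple_function (lebesgue_on {0..T}) (\<lambda>t. u (g n t)) \<and> (\<forall>t\<in>{0..T}. u (g n t) \<in> wiener 1)"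
      using simple_function_compose1[OF gs] w g0(1) by auto
    have "(\<lambda>n. wiener_norm 1 (\<lambda>x. u (g n t) x - u t x)) \<longlonglongrightarrow> 0" if t: "t \<in> {0..T}" for t
    proof -
      have z: "wiener_norm 1 (\<lambda>x. u t x - u t x) = 0" using wd[OF t t, of 1] by simp
      have "((\<lambda>s. wiener_norm 1 (\<lambda>x. u s x - u t x)) \<longlongrightarrow> wiener_norm 1 (\<lambda>x. u t x - u t x)) (at t within {0..T})"
        unfolding z by (rule lim[OF t order_refl])
      then have cw: "continuous (at t within {0..T}) (\<lambda>s. wiener_norm 1 (\<lambda>x. u s x - u t x))"
        by (simp add: continuous_within)
      have "(\<lambda>n. g n t) \<longlonglongrightarrow> t"
      proof (rule LIM_zero_cancel, rule tendsto_rabs_zero_cancel, rule tendsto_sandwich[of "\<lambda>_. 0"])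
        show "(\<lambda>n. T / real (Suc n)) \<longlonglongrightarrow> 0" by (rule LIMSEQ_Suc[OF lim_const_over_n])
      qed (use g0(2)[OF t] in auto)
      with cw g0(1)[OF t] show ?thesis unfolding continuous_within_sequentially o_def z by auto
    qed
    then show "AE t in lebesgue_on {0..T}. (\<lambda>n. wiener_norm 1 (\<lambda>x. u (g n t) x - u t x)) \<longlonglongrightarrow> 0"
      by (intro AE_I2) (simp add: space_restrict_space)
  qed
qed

end

section \<open>Time derivatives and spatial integrability of the mild solution\<close>

locale wave_solution = wave_problem +
  fixes \<Phi> \<Psi> :: "real \<Rightarrow> real \<Rightarrow> complex" and r0 r1 :: "real \<Rightarrow> complex"
  assumes cont: "continuous_on UNIV (\<lambda>(t, k). \<Phi> t k)" "continuous_on UNIV (\<lambda>(t, k). \<Psi> t k)"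
    and bnd: "\<And>t. bounded_by BB 2 (\<Phi> t)" "\<And>t. bounded_by BB 2 (\<Psi> t)"
    and herm: "\<And>t k. \<Phi> t (- k) = cnj (\<Phi> t k)" "\<And>t k. \<Psi> t (- k) = cnj (\<Psi> t k)"
    and NLc: "continuous_on UNIV (\<lambda>(t, k). NL \<Phi> \<Psi> t k)"
    and mild: "\<And>t k. t \<in> {0..TT} \<Longrightarrow> \<Phi> t k = DP \<Phi> \<Psi> t k" "\<And>t k. t \<in> {0..TT} \<Longrightarrow> \<Psi> t k = DV \<Phi> \<Psi> t k"
    and r: "integrable lborel r0" "integrable lborel r1" "\<Phi>0 = fourier_integral r0" "\<Phi>1 = fourier_integral r1"
begin

abbreviation N :: "real \<Rightarrow> real \<Rightarrow> complex" where "N \<equiv> NL \<Phi> \<Psi>"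

definition Q :: "real \<Rightarrow> real \<Rightarrow> complex" where "Q t = qsym (\<Phi> t) (\<Psi> t)"

text \<open>The transform of f_tt as prescribed by the equation; \<open>\<Psi>_deriv\<close>
  identifies it as the actual time derivative.\<close>

definition Xi :: "real \<Rightarrow> real \<Rightarrow> complex" where
  "Xi t k = - Q t k + of_real \<epsilon> * N t k"

lemma coefficients_deriv:
  assumes t: "t \<in> {0..TT}"
  shows "((\<lambda>t. c1 \<Phi> \<Psi> t k) has_vector_derivative of_real \<epsilon> * (PS (- t) k * N t k)) (at t within {0..TT})"
    "((\<lambda>t. c2 \<Phi> \<Psi> t k) has_vector_derivative of_real \<epsilon> * (PS' (- t) k * N t k)) (at t within {0..TT})"
proof -
  have "continuous_on {0..TT} (\<lambda>s. PS (- s) k * N s k)" "continuous_on {0..TT} (\<lambda>s. PS' (- s) k * N s k)"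
    by (intro continuous_on_mult slice_continuous(1)[OF NLc] continuous_on_propagators continuous_intros)+
  note i = this[THEN integral_has_vector_derivative, OF t]
  have "((\<lambda>t. \<Phi>0 k + of_real \<epsilon> * integral {0..t} (\<lambda>s. PS (- s) k * N s k)) has_vector_derivative 0 + of_real \<epsilon> * (PS (- t) k * N t k)) (at t within {0..TT})"
    "((\<lambda>t. \<Phi>1 k + of_real \<epsilon> * integral {0..t} (\<lambda>s. PS' (- s) k * N s k)) has_vector_derivative 0 + of_real \<epsilon> * (PS' (- t) k * N t k)) (at t within {0..TT})"
    by (intro has_vector_derivative_add has_vector_derivative_const has_vector_derivative_mult_right i)+
  then show "((\<lambda>t. c1 \<Phi> \<Psi> t k) has_vector_derivative of_real \<epsilon> * (PS (- t) k * N t k)) (at t within {0..TT})"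
    "((\<lambda>t. c2 \<Phi> \<Psi> t k) has_vector_derivative of_real \<epsilon> * (PS' (- t) k * N t k)) (at t within {0..TT})"
    unfolding c1_def by (simp_all add: c2_def)
qed

text \<open>In variation of constants the derivatives of the coefficients contribute the propagator
  at time t - t = 0, by the addition theorem. For \<Phi> this is \<open>PS 0\<close> = 0, so nothing
  is added; for \<Psi> below it is \<open>PS' 0\<close> = 1, which produces the term \<epsilon>
  N.\<close>

lemma \<Phi>_deriv:
  assumes t: "t \<in> {0..TT}"
  shows "((\<lambda>t. \<Phi> t k) has_vector_derivative \<Psi> t k) (at t within {0..TT})"
proof -
  note d = coefficients_deriv[OF t, of k]
  have "((\<lambda>t. DP \<Phi> \<Psi> t k) has_vector_derivative
     (PA t k * (of_real \<epsilon> * (PS (- t) k * N t k)) + (- of_real (om2 k) * PS t k) * c1 \<Phi> \<Psi> t k) +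
     (PS t k * (of_real \<epsilon> * (PS' (- t) k * N t k)) + PS' t k * c2 \<Phi> \<Psi> t k)) (at t within {0..TT})"
    unfolding DP_def
    by (intro has_vector_derivative_add has_vector_derivative_mult PA_has_vector_derivative PS_has_vector_derivative d)
  also have "(PA t k * (of_real \<epsilon> * (PS (- t) k * N t k)) + (- of_real (om2 k) * PS t k) * c1 \<Phi> \<Psi> t k) +
     (PS t k * (of_real \<epsilon> * (PS' (- t) k * N t k)) + PS' t k * c2 \<Phi> \<Psi> t k)
     = of_real \<epsilon> * N t k * (PA t k * PS (- t) k + PS t k * PS' (- t) k) + DV \<Phi> \<Psi> t k"
    unfolding DV_def by (simp add: algebra_simps)
  also have "PA t k * PS (- t) k + PS t k * PS' (- t) k = 0"
    using propagator_diff(1)[of t t k] by (simp add: propagator_0)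
  finally have "((\<lambda>t. DP \<Phi> \<Psi> t k) has_vector_derivative \<Psi> t k) (at t within {0..TT})"
    using mild(2)[OF t] by simp
  then show ?thesis by (rule has_vector_derivative_transform[OF t mild(1), rotated])
qed

lemma \<Psi>_deriv:
  assumes t: "t \<in> {0..TT}"
  shows "((\<lambda>t. \<Psi> t k) has_vector_derivative Xi t k) (at t within {0..TT})"
proof -
  note d = coefficients_deriv[OF t, of k]
  let ?a = "2 * \<i> * complex_of_real (aa k)"
  have "((\<lambda>t. DV \<Phi> \<Psi> t k) has_vector_derivative
     ((- of_real (om2 k) * PS t k) * (of_real \<epsilon> * (PS (- t) k * N t k)) + (- of_real (om2 k) * PS' t k) * c1 \<Phi> \<Psi> t k) +
     (PS' t k * (of_real \<epsilon> * (PS' (- t) k * N t k)) + (- of_real (om2 k) * PS t k + ?a * PS' t k) * c2 \<Phi> \<Psi> t k)) (at t within {0..TT})"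
    unfolding DV_def
    by (intro has_vector_derivative_add has_vector_derivative_mult has_vector_derivative_mult_right PS'_has_vector_derivative PS_has_vector_derivative d)
  also have "((- of_real (om2 k) * PS t k) * (of_real \<epsilon> * (PS (- t) k * N t k)) + (- of_real (om2 k) * PS' t k) * c1 \<Phi> \<Psi> t k) +
     (PS' t k * (of_real \<epsilon> * (PS' (- t) k * N t k)) + (- of_real (om2 k) * PS t k + ?a * PS' t k) * c2 \<Phi> \<Psi> t k)
     = of_real \<epsilon> * N t k * (- of_real (om2 k) * PS t k * PS (- t) k + PS' t k * PS' (- t) k)
      - of_real (om2 k) * (PS' t k * c1 \<Phi> \<Psi> t k + PS t k * c2 \<Phi> \<Psi> t k) + ?a * PS' t k * c2 \<Phi> \<Psi> t k"
    by (simp add: algebra_simps)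
  also have "- of_real (om2 k) * PS t k * PS (- t) k + PS' t k * PS' (- t) k = 1"
    using propagator_diff(2)[of t t k] by (simp add: propagator_0)
  also have "of_real \<epsilon> * N t k * 1 - of_real (om2 k) * (PS' t k * c1 \<Phi> \<Psi> t k + PS t k * c2 \<Phi> \<Psi> t k) + ?a * PS' t k * c2 \<Phi> \<Psi> t k = Xi t k"
  proof -
    \<comment> \<open>This identity moves the coefficient of \<open>c1\<close> from
      \<open>PS'\<close> to \<open>PA\<close>; the surplus 2i \<open>aa\<close> \<open>om2\<close>
      \<open>PS\<close> \<open>c1\<close> is what completes \<open>DV\<close> in the damping-type
      term.\<close>
    have "PS' t k = PA t k + ?a * PS t k" by (simp add: PS_def PS'_def PA_def algebra_simps)
    then have "of_real (om2 k) * (PS' t k * c1 \<Phi> \<Psi> t k + PS t k * c2 \<Phi> \<Psi> t k) - ?a * PS' t k * c2 \<Phi> \<Psi> t k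
      = of_real (om2 k) * DP \<Phi> \<Psi> t k - ?a * DV \<Phi> \<Psi> t k"
      unfolding DP_def DV_def by (simp add: algebra_simps)
    then show ?thesis unfolding Xi_def Q_def qsym_def mild[OF t] by (simp add: algebra_simps)
  qed
  finally have "((\<lambda>t. DV \<Phi> \<Psi> t k) has_vector_derivative Xi t k) (at t within {0..TT})" .
  then show ?thesis by (rule has_vector_derivative_transform[OF t mild(2), rotated])
qed

lemma states_measurable: "\<Phi> t \<in> borel_measurable borel" "\<Psi> t \<in> borel_measurable borel"
  using bnd by (auto dest: bounded_byD)

lemma decays_\<Phi>: "m \<in> borel_measurable borel \<Longrightarrow> (\<And>k. norm (m k) \<le> 27 * exp \<bar>k\<bar>) \<Longrightarrow> decays (27 * BB) (\<lambda>k. m k * \<Phi> t k)"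
  and decays_\<Psi>: "m \<in> borel_measurable borel \<Longrightarrow> (\<And>k. norm (m k) \<le> 27 * exp \<bar>k\<bar>) \<Longrightarrow> decays (27 * BB) (\<lambda>k. m k * \<Psi> t k)"
  by (intro decays_of_bounded_by bnd; assumption)+

lemma one_le_exp_abs: "1 \<le> 27 * exp \<bar>k::real\<bar>" using exp_ge_add_one_self[of "\<bar>k\<bar>"] by linarith

lemma decays_basic:
  "decays (27 * BB) (\<Phi> t)" "decays (27 * BB) (\<Psi> t)"
  "decays (27 * BB) (\<lambda>k. of_real \<bar>k\<bar> * \<Phi> t k)" "decays (27 * BB) (\<lambda>k. of_real (\<bar>k\<bar> ^ 3) * \<Phi> t k)"
  "decays (27 * BB) (\<lambda>k. of_real \<bar>k\<bar> * (\<i> * of_real k) * \<Psi> t k)"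
  using decays_\<Phi>[of "\<lambda>_. 1" t] decays_\<Psi>[of "\<lambda>_. 1" t] one_le_exp_abs
    decays_\<Phi>[of "\<lambda>k. of_real \<bar>k\<bar>" t] decays_\<Phi>[of "\<lambda>k. of_real (\<bar>k\<bar> ^ 3)" t] decays_\<Psi>[of "\<lambda>k. of_real \<bar>k\<bar> * (\<i> * of_real k)" t]
    monomial_le_exp[of "\<bar>k\<bar>" for k :: real]
  by (simp_all add: norm_mult norm_power power2_eq_square)

lemma decays_Q: "decays (Cq * BB) (Q t)"
  unfolding decays_def
proof (intro conjI allI)
  show "Q t \<in> borel_measurable borel" unfolding Q_def by (intro qsym_measurable states_measurable)
  fix k
  have "norm (Q t k) \<le> Cq * exp \<bar>k\<bar> * (BB * wt 2 k)" unfolding Q_def by (rule norm_qsym_le[OF bnd])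
  also have "wt 2 k = exp (- \<bar>k\<bar>) * (exp (- \<bar>k\<bar>) / (1 + k\<^sup>2))" using wt_split[of 1 1 k] by (simp add: wt_def)
  also have "Cq * exp \<bar>k\<bar> * (BB * (exp (- \<bar>k\<bar>) * (exp (- \<bar>k\<bar>) / (1 + k\<^sup>2)))) = (exp \<bar>k\<bar> * exp (- \<bar>k\<bar>)) * (Cq * BB * exp (- \<bar>k\<bar>) / (1 + k\<^sup>2))"
    by (simp only: ac_simps times_divide_eq_right)
  also have "exp \<bar>k\<bar> * exp (- \<bar>k\<bar>) = 1" by (simp flip: exp_add)
  finally show "norm (Q t k) \<le> Cq * BB * exp (- \<bar>k\<bar>) / (1 + k\<^sup>2)" by simp
qed

abbreviation sg :: "(real \<Rightarrow> complex) \<Rightarrow> real \<Rightarrow> complex" where "sg f \<equiv> \<lambda>m. of_real (sgn m) * f m"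

text \<open>The nonlinearity split into plain convolutions. The estimates in x and the
  identification with the equation both start from this form.\<close>

lemma N_eq: "N t k = ic * (of_real \<bar>k\<bar> * conv (sg (\<Psi> t)) (sg (\<Psi> t)) k) + dcomm (\<Phi> t) (Q t) k"
proof -
  have i1: "integrable lborel (\<lambda>m. sg (\<Psi> t) (k - m) * sg (\<Psi> t) m)"
    by (rule integrable_conv_kernel[OF decays_sgn[OF decays_basic(2)] integrable_decays[OF decays_sgn[OF decays_basic(2)]]])
  have i2: "integrable lborel (\<lambda>m. \<Phi> t (k - m) * Q t m)"
    by (rule integrable_conv_kernel[OF decays_basic(1) integrable_decays[OF decays_Q]])
  have i3: "integrable lborel (\<lambda>m. \<Phi> t (k - m) * sg (Q t) m)"
    by (rule integrable_conv_kernel[OF decays_basic(1) integrable_decays[OF decays_sgn[OF decays_Q]]])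
  have gen: "(LINT m|lborel. A * a m + (A * b m - C * c m)) = A * integral\<^sup>L lborel a + (A * integral\<^sup>L lborel b - C * integral\<^sup>L lborel c)"
    if "integrable lborel a" "integrable lborel b" "integrable lborel c" for a b c :: "real \<Rightarrow> complex" and A C
    using that by simp
  have "(LINT m|lborel. nlk (\<Phi> t) (\<Psi> t) (\<Phi> t) (\<Psi> t) k m) = (LINT m|lborel. of_real \<bar>k\<bar> * (sg (\<Psi> t) (k - m) * sg (\<Psi> t) m) +
    (of_real \<bar>k\<bar> * (\<Phi> t (k - m) * Q t m) - of_real k * (\<Phi> t (k - m) * sg (Q t) m)))"
    by (intro Bochner_Integration.integral_cong refl) (simp add: nlk_def Q_def algebra_simps)
  also have "\<dots> = of_real \<bar>k\<bar> * conv (sg (\<Psi> t)) (sg (\<Psi> t)) k + (of_real \<bar>k\<bar> * conv (\<Phi> t) (Q t) k - of_real k * conv (\<Phi> t) (sg (Q t)) k)"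
    unfolding conv_def by (rule gen[OF i1 i2 i3])
  finally show ?thesis unfolding NL_def nl_def dcomm_def by (simp only: distrib_left)
qed

lemma N_le: "norm (N t k) \<le> CN * BB\<^sup>2 * wt 0 k"
proof -
  have "norm (N t k) \<le> CN * (BB * BB) * (\<bar>k\<bar> * wt 2 k)" unfolding NL_def by (intro norm_nl_le bnd) simp
  also have "\<dots> \<le> CN * (BB * BB) * wt 0 k"
  proof (intro mult_left_mono)
    have "\<bar>k\<bar> \<le> exp (1 * \<bar>k\<bar>)" unfolding mult_1 using exp_ge_add_one_self[of "\<bar>k\<bar>"] by linarith
    then have "\<bar>k\<bar> * wt 2 k \<le> exp (1 * \<bar>k\<bar>) * wt 2 k" using wt_pos[of 2 k] by (intro mult_right_mono) auto
    also have "\<dots> \<le> wt 0 k" by (rule wt_le) simp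
    finally show "\<bar>k\<bar> * wt 2 k \<le> wt 0 k" .
    show "0 \<le> CN * (BB * BB)" using CN_nonneg BB_pos by simp
  qed
  finally show ?thesis by (simp add: power2_eq_square)
qed

text \<open>The outer symbols that occur are the propagator times |k| or times k, and both are tame,
  as |k| is Lipschitz at 0. The signs of the inner variables jump, but they sit inside the convolved
  factors, of which only decay is required. The constant is uniform in s and t because the
  propagators are tame uniformly for times in [0, 1].\<close>

lemma duhamel_terms_L1:
  assumes K: "K = PS \<or> K = PS'"
  obtains C where "\<And>s t. 0 \<le> s \<Longrightarrow> s \<le> t \<Longrightarrow> t \<le> TT \<Longrightarrow>
    L1n (ift (\<lambda>k. K (t - s) k * N s k)) \<le> ennreal C"
proof -
  have tK: "tame {0..1} K" using K tame_propagators by auto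
  have "tame {0..1} (\<lambda>t k. K t k * of_real \<bar>k\<bar>)" by (intro tame_mult tK tame_of_real tame_abs)
  then obtain M1 where M1: "M1 \<ge> 0" "\<And>i k. i \<in> {0..1} \<Longrightarrow> norm (K i k * of_real \<bar>k\<bar>) \<le> M1 * exp (\<bar>k\<bar> / 2)"
    "\<And>i k h. i \<in> {0..1} \<Longrightarrow> 0 < h \<Longrightarrow> h \<le> 1 \<Longrightarrow> norm (K i (k + h) * of_real (\<bar>k + h\<bar>) - K i k * of_real \<bar>k\<bar>) \<le> h * (M1 * exp (\<bar>k\<bar> / 2))"
    by (rule tame_exp_bounds) blast
  have "tame {0..1} (\<lambda>t k. K t k * of_real k)" by (intro tame_mult tK tame_of_real tame_id)
  then obtain M2 where M2: "M2 \<ge> 0" "\<And>i k. i \<in> {0..1} \<Longrightarrow> norm (K i k * of_real k) \<le> M2 * exp (\<bar>k\<bar> / 2)"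
    "\<And>i k h. i \<in> {0..1} \<Longrightarrow> 0 < h \<Longrightarrow> h \<le> 1 \<Longrightarrow> norm (K i (k + h) * of_real (k + h) - K i k * of_real k) \<le> h * (M2 * exp (\<bar>k\<bar> / 2))"
    by (rule tame_exp_bounds) blast
  define B where "B = 27 * BB + Cq * BB"
  have B: "27 * BB \<le> B" "Cq * BB \<le> B" using BB_pos Cq_nonneg by (simp_all add: B_def)
  have dP: "decays B (\<Phi> s)" "decays B (sg (\<Psi> s))" "decays B (Q s)" "decays B (sg (Q s))" for s
    using decays_mono[OF decays_basic(1) B(1)] decays_mono[OF decays_sgn[OF decays_basic(2)] B(1)] decays_mono[OF decays_Q B(2)]
      decays_mono[OF decays_sgn[OF decays_Q] B(2)] by auto
  define L where "L M = (pi + 2 * ((32 * exp 1 * M)\<^sup>2 * pi)) * (pi * B\<^sup>2)" for M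
  have L0: "L M \<ge> 0" for M by (simp add: L_def)
  have i1: "norm ic \<le> 1"
  proof -
    have "1 \<le> sqrt (2 * pi)" using pi_gt3 by (intro real_le_rsqrt) simp
    then show ?thesis by (simp add: norm_divide divide_le_eq)
  qed
  show ?thesis
  proof (rule that[of "L M1 + L M1 + L M2"])
    fix s t assume st: "0 \<le> s" "s \<le> t" "t \<le> TT"
    have u: "t - s \<in> {0..1}" using st TT by auto
    have Kc: "continuous_on UNIV (K (t - s))" using K by (auto intro!: continuous_intros)
    then have [measurable]: "K (t - s) \<in> borel_measurable borel" by (rule borel_measurable_continuous_onI)
    have K2: "norm (K (t - s) k) \<le> 2" for k
      using K norm_PS_le[of "t - s" k] norm_PS'_le[of "t - s" k] u by auto
    let ?f1 = "\<lambda>k. (K (t - s) k * of_real \<bar>k\<bar>) * conv (sg (\<Psi> s)) (sg (\<Psi> s)) k"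
    let ?f2 = "\<lambda>k. (K (t - s) k * of_real \<bar>k\<bar>) * conv (\<Phi> s) (Q s) k"
    let ?f3 = "\<lambda>k. (K (t - s) k * of_real k) * conv (\<Phi> s) (sg (Q s)) k"
    have Km: "K (t - s) \<in> borel_measurable borel" by measurable
    have I: "integrable lborel ?f1" "integrable lborel ?f2" "integrable lborel ?f3"
      unfolding mult.assoc
      by (rule integrable_bounded_mult[OF integrable_abs_mult_conv[OF dP(2) dP(2)] Km K2]
          integrable_bounded_mult[OF integrable_abs_mult_conv[OF dP(1) dP(3)] Km K2]
          integrable_bounded_mult[OF integrable_mult_conv[OF dP(1) dP(4)] Km K2])+
    have eq: "ift (\<lambda>k. K (t - s) k * N s k) x = ic * (ift ?f1 x + (ift ?f2 x - ift ?f3 x))" for x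
    proof -
      have "(\<lambda>k. K (t - s) k * N s k) = (\<lambda>k. ic * (?f1 k + (?f2 k - ?f3 k)))"
        unfolding N_eq dcomm_def by (auto simp: algebra_simps simp del: of_real_divide)
      then show ?thesis
        using inv_fourier_add[OF I(1) Bochner_Integration.integrable_diff[OF I(2,3)]] inv_fourier_diff[OF I(2,3)]
        by (simp only: inv_fourier_cmult)
    qed
    have [measurable]: "ift ?f1 \<in> borel_measurable borel" "ift ?f2 \<in> borel_measurable borel" "ift ?f3 \<in> borel_measurable borel"
      by (intro borel_measurable_inv_fourier I)+
    have "L1n (ift (\<lambda>k. K (t - s) k * N s k)) \<le>
      (\<integral>\<^sup>+x. (ennreal (norm (ift ?f1 x)) + ennreal (norm (ift ?f2 x))) + ennreal (norm (ift ?f3 x)) \<partial>lborel)"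
    proof (intro nn_integral_mono)
      fix x
      have "norm (ift (\<lambda>k. K (t - s) k * N s k) x) \<le> 1 * norm (ift ?f1 x + (ift ?f2 x - ift ?f3 x))"
        unfolding eq norm_mult by (intro mult_right_mono i1) simp
      also have "\<dots> \<le> norm (ift ?f1 x) + (norm (ift ?f2 x) + norm (ift ?f3 x))"
        unfolding mult_1 by (intro norm_triangle_le add_left_mono norm_triangle_ineq4)
      finally show "ennreal (norm (ift (\<lambda>k. K (t - s) k * N s k) x)) \<le>
        (ennreal (norm (ift ?f1 x)) + ennreal (norm (ift ?f2 x))) + ennreal (norm (ift ?f3 x))"
        by (simp add: ennreal_leI add.assoc flip: ennreal_plus)
    qed
    also have "\<dots> = L1n (ift ?f1) + L1n (ift ?f2) + L1n (ift ?f3)"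
      by (simp add: nn_integral_add)
    also have "\<dots> \<le> ennreal (L M1) + ennreal (L M1) + ennreal (L M2)"
      unfolding L_def by (intro add_mono nn_integral_inv_fourier_mult_conv dP M1(2,3) M2(2,3) u; measurable)
    also have "\<dots> = ennreal (L M1 + L M1 + L M2)" by (simp only: ennreal_plus add_nonneg_nonneg L0)
    finally show "L1n (ift (\<lambda>k. K (t - s) k * N s k)) \<le> ennreal (L M1 + L M1 + L M2)" .
  qed
qed

lemma duhamel_L1:
  assumes K: "K = PS \<or> K = PS'" and t: "t \<in> {0..TT}"
  shows "integrable lborel (\<lambda>k. integral {0..t} (\<lambda>s. K (t - s) k * N s k))"
    "integrable lborel (ift (\<lambda>k. integral {0..t} (\<lambda>s. K (t - s) k * N s k)))"
proof -
  obtain C where C: "\<And>s t. 0 \<le> s \<Longrightarrow> s \<le> t \<Longrightarrow> t \<le> TT \<Longrightarrow>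
    L1n (ift (\<lambda>k. K (t - s) k * N s k)) \<le> ennreal C"
    using duhamel_terms_L1[OF K] by blast
  have c: "continuous_on UNIV (\<lambda>(s, k). K (t - s) k * N s k)"
    using NLc K unfolding case_prod_beta by (auto intro!: continuous_intros)
  have b: "norm (K (t - s) k * N s k) \<le> 2 * (CN * BB\<^sup>2) * (1 / (1 + k\<^sup>2))" if "s \<in> {0..t}" for s k
  proof -
    have "norm (K (t - s) k) \<le> 2"
      using K norm_PS_le[of "t - s" k] norm_PS'_le[of "t - s" k] that t TT by auto
    then have "norm (K (t - s) k * N s k) \<le> 2 * (CN * BB\<^sup>2 * wt 0 k)"
      unfolding norm_mult by (intro mult_mono N_le) auto
    then show ?thesis unfolding wt_0 by (simp only: mult.assoc)
  qed
  have t0: "0 \<le> t" using t by simp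
  show "integrable lborel (\<lambda>k. integral {0..t} (\<lambda>s. K (t - s) k * N s k))"
    "integrable lborel (ift (\<lambda>k. integral {0..t} (\<lambda>s. K (t - s) k * N s k)))"
    by (rule integrable_inv_fourier_time_integral[OF c t0 b]; use C t in auto)+
qed

lemma propagator_measurable:
  "PS t \<in> borel_measurable borel" "PS' t \<in> borel_measurable borel" "PA t \<in> borel_measurable borel" "om2 \<in> borel_measurable borel"
  by (intro borel_measurable_continuous_onI continuous_intros)+

lemma solution_L1:
  assumes t: "t \<in> {0..TT}"
  shows "integrable lborel (ift (\<Phi> t))" "integrable lborel (ift (\<Psi> t))"
proof -
  note [measurable] = propagator_measurable
  have t1: "t \<in> {0..1}" using t TT by auto
  have s0: "\<bar>k\<bar> > D \<Longrightarrow> fourier_integral r0 k = 0" and s1: "\<bar>k\<bar> > D \<Longrightarrow> fourier_integral r1 k = 0" for k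
    using data_supp r by auto
  have dc: "\<Phi>0 \<in> borel_measurable borel" "\<Phi>1 \<in> borel_measurable borel"
    using data_cont by (auto intro: borel_measurable_continuous_onI)
  have di: "integrable lborel (\<lambda>k. \<mu> k * \<Phi>0 k)" "integrable lborel (\<lambda>k. \<mu> k * \<Phi>1 k)" if "continuous_on UNIV \<mu>" for \<mu>
  proof -
    have *: "integrable lborel F" if F: "continuous_on UNIV F" "\<And>k. \<bar>k\<bar> > D \<Longrightarrow> F k = 0" for F :: "real \<Rightarrow> complex"
    proof -
      have "set_integrable lborel {-D..D} F" by (rule borel_integrable_atLeastAtMost'[OF continuous_on_subset[OF F(1)]]) simp
      moreover have "indicator {-D..D} k *\<^sub>R F k = F k" for k using F(2)[of k] by (auto simp: indicator_def)
      ultimately show ?thesis by (simp add: set_integrable_def)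
    qed
    show "integrable lborel (\<lambda>k. \<mu> k * \<Phi>0 k)" "integrable lborel (\<lambda>k. \<mu> k * \<Phi>1 k)"
      by (intro * continuous_on_mult that data_cont; simp add: data_supp)+
  qed
  have combine: "integrable lborel (ift (\<lambda>k. f1 k + f2 k + of_real \<epsilon> * f3 k))"
    if "integrable lborel f1" "integrable lborel f2" "integrable lborel f3"
      "integrable lborel (ift f1)" "integrable lborel (ift f2)" "integrable lborel (ift f3)" for f1 f2 f3
  proof -
    have "ift (\<lambda>k. f1 k + f2 k + of_real \<epsilon> * f3 k) x = ift f1 x + ift f2 x + of_real \<epsilon> * ift f3 x" for x
      using that by (simp add: inv_fourier_add inv_fourier_cmult)
    then have "ift (\<lambda>k. f1 k + f2 k + of_real \<epsilon> * f3 k) = (\<lambda>x. ift f1 x + ift f2 x + of_real \<epsilon> * ift f3 x)"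
      by auto
    then show ?thesis using that by simp
  qed
  have tO: "tame {0..1} (\<lambda>t k. - complex_of_real (om2 k) * PS t k)"
  proof -
    have "tame {0..1} (\<lambda>t k. complex_of_real (- 1 * om2 k) * PS t k)"
      by (intro tame_mult tame_of_real tame_propagators tame_om2 tame_const)
    then show ?thesis by simp
  qed
  have P: "\<Phi> t = (\<lambda>k. PA t k * \<Phi>0 k + PS t k * \<Phi>1 k + of_real \<epsilon> * integral {0..t} (\<lambda>s. PS (t - s) k * N s k))"
    using mild(1)[OF t] duhamel(1)[OF NLc] by auto
  have V: "\<Psi> t = (\<lambda>k. - of_real (om2 k) * PS t k * \<Phi>0 k + PS' t k * \<Phi>1 k + of_real \<epsilon> * integral {0..t} (\<lambda>s. PS' (t - s) k * N s k))"
    using mild(2)[OF t] duhamel(2)[OF NLc] by auto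
  note BL = integrable_inv_fourier_band_limited[OF _ t1 _ _ _ _ D0]
  show "integrable lborel (ift (\<Phi> t))"
    unfolding P
  proof (rule combine)
    show "integrable lborel (ift (\<lambda>k. PA t k * \<Phi>0 k))" unfolding r(3)
      by (rule BL[OF tame_propagators(3) refl _ r(1) s0]) measurable
    show "integrable lborel (ift (\<lambda>k. PS t k * \<Phi>1 k))" unfolding r(4)
      by (rule BL[OF tame_propagators(1) refl _ r(2) s1]) measurable
  qed (intro di duhamel_L1 t continuous_intros; simp)+
  show "integrable lborel (ift (\<Psi> t))"
    unfolding V
  proof (rule combine)
    show "integrable lborel (ift (\<lambda>k. - of_real (om2 k) * PS t k * \<Phi>0 k))" unfolding r(3)
      by (rule BL[OF tO refl _ r(1) s0]) measurable
    show "integrable lborel (ift (\<lambda>k. PS' t k * \<Phi>1 k))" unfolding r(4)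
      by (rule BL[OF tame_propagators(2) refl _ r(2) s1]) measurable
  qed (intro di duhamel_L1 t continuous_intros; simp)+
qed

end

lemma conv_combination:
  fixes b c :: complex
  assumes P: "decays A P" and Q: "integrable lborel Q1" "integrable lborel Q2" "integrable lborel Q3"
  shows "conv P (\<lambda>m. Q1 m + (b * Q2 m - c * Q3 m)) k = conv P Q1 k + (b * conv P Q2 k - c * conv P Q3 k)"
proof -
  have gen: "(LINT m|lborel. x m + (b * y m - c * z m)) = integral\<^sup>L lborel x + (b * integral\<^sup>L lborel y - c * integral\<^sup>L lborel z)"
    if "integrable lborel x" "integrable lborel y" "integrable lborel z" for x y z :: "real \<Rightarrow> complex"
    using that by simp
  have "conv P (\<lambda>m. Q1 m + (b * Q2 m - c * Q3 m)) k = (LINT m|lborel. P (k - m) * Q1 m + (b * (P (k - m) * Q2 m) - c * (P (k - m) * Q3 m)))"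
    unfolding conv_def by (simp only: distrib_left right_diff_distrib mult.left_commute)
  also have "\<dots> = conv P Q1 k + (b * conv P Q2 k - c * conv P Q3 k)"
    unfolding conv_def by (intro gen integrable_conv_kernel[OF P] Q)
  finally show ?thesis .
qed

text \<open>The combination has the shape of \<open>Q_eq\<close>: it splits the one commutator of
  the Fourier side into the three commutators of the equation.\<close>

lemma dcomm_combination:
  fixes b c :: complex
  assumes P: "decays A P" and Q: "decays B Q1" "decays B Q2" "decays B Q3"
  shows "dcomm P (\<lambda>m. Q1 m + (b * Q2 m - c * Q3 m)) k = dcomm P Q1 k + (b * dcomm P Q2 k - c * dcomm P Q3 k)"
proof -
  note s = Q[THEN decays_sgn, THEN integrable_decays]
  have "(\<lambda>m. complex_of_real (sgn m) * (Q1 m + (b * Q2 m - c * Q3 m))) =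
    (\<lambda>m. of_real (sgn m) * Q1 m + (b * (of_real (sgn m) * Q2 m) - c * (of_real (sgn m) * Q3 m)))"
    by (simp add: algebra_simps)
  then show ?thesis
    unfolding dcomm_def by (simp only: conv_combination[OF P s] conv_combination[OF P Q[THEN integrable_decays]]) (simp add: algebra_simps)
qed

lemma has_real_derivative_Re:
  "(f has_vector_derivative f') F \<Longrightarrow> ((\<lambda>s. Re (f s)) has_real_derivative Re f') F"
  unfolding has_real_derivative_iff_has_vector_derivative
  by (rule bounded_linear.has_vector_derivative[OF bounded_linear_Re])

section \<open>The equation in physical space\<close>

context wave_solution begin

lemma inv_fourier_time_derivative:
  fixes U U' :: "real \<Rightarrow> real \<Rightarrow> complex"
  assumes t: "t \<in> {0..TT}" and U: "\<And>s. integrable lborel (U s)" and U': "U' t \<in> borel_measurable borel"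
    and d: "\<And>s k. s \<in> {0..TT} \<Longrightarrow> ((\<lambda>s. U s k) has_vector_derivative U' s k) (at s within {0..TT})"
    and b: "\<And>s k. norm (U' s k) \<le> C * wt 0 k"
  shows "((\<lambda>s. ift (U s) x) has_vector_derivative ift (U' t) x) (at t within {0..TT})"
proof -
  have "((\<lambda>s. LINT k|lborel. U s k * iexp (k * x)) has_vector_derivative (LINT k|lborel. U' t k * iexp (k * x))) (at t within {0..TT})"
  proof (rule has_vector_derivative_LINT[where F' = "\<lambda>s k. U' s k * iexp (k * x)" and G = "\<lambda>k. C * wt 0 k"])
    show "(\<lambda>k. U' t k * iexp (k * x)) \<in> borel_measurable lborel" using U' by measurable
    show "norm (U' s k * iexp (k * x)) \<le> C * wt 0 k" for s k using b by (simp add: norm_mult norm_exp_i_times)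
    show "integrable lborel (\<lambda>k. C * wt 0 k)" by (intro integrable_mult_right wt0_integrable)
    show "integrable lborel (\<lambda>k. U s k * iexp (k * x))" for s by (rule integrable_mult_iexp[OF U])
    show "((\<lambda>s. U s k * iexp (k * x)) has_vector_derivative U' s k * iexp (k * x)) (at s within {0..TT})" if "s \<in> {0..TT}" for s k
      by (rule has_vector_derivative_mult_left[OF d[OF that]])
  qed (use t in simp_all)
  from has_vector_derivative_mult_right[OF this, of ic] show ?thesis unfolding inv_fourier_integral_def .
qed

lemma integrable_states: "integrable lborel (\<Phi> t)" "integrable lborel (\<Psi> t)"
  by (rule integrable_decays[OF decays_basic(1)] integrable_decays[OF decays_basic(2)])+

lemma state_le: "norm (\<Psi> s k) \<le> BB * wt 0 k"
proof -
  have "wt 2 k \<le> wt 0 k" using wt_le[of 0 k] by simp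
  then have "BB * wt 2 k \<le> BB * wt 0 k" using BB_pos by (intro mult_left_mono) auto
  with bounded_byD(2)[OF bnd(2)] show ?thesis by (rule order_trans)
qed

lemma Q_le: "norm (Q s k) \<le> (Cq * BB) * wt 0 k"
  using decaysD(4)[OF decays_Q, of s k] by (simp add: wt_0)

lemma Xi_le: "norm (Xi s k) \<le> (Cq * BB + \<bar>\<epsilon>\<bar> * (CN * BB\<^sup>2)) * wt 0 k"
proof -
  have "norm (Xi s k) \<le> norm (Q s k) + \<bar>\<epsilon>\<bar> * norm (N s k)"
    unfolding Xi_def by (rule order_trans[OF norm_triangle_ineq]) (simp add: norm_mult)
  also have "\<dots> \<le> (Cq * BB) * wt 0 k + \<bar>\<epsilon>\<bar> * (CN * BB\<^sup>2 * wt 0 k)"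
    by (intro add_mono Q_le mult_left_mono N_le) simp
  finally show ?thesis by (simp only: distrib_right mult.assoc)
qed

lemma N_measurable: "N t \<in> borel_measurable borel"
  by (intro borel_measurable_continuous_onI slice_continuous(2)[OF NLc])

lemma Q_measurable: "Q t \<in> borel_measurable borel"
  using decays_Q by (rule decaysD(1))

lemma Xi_measurable: "Xi t \<in> borel_measurable borel"
  using N_measurable[of t] Q_measurable[of t] unfolding Xi_def[abs_def] by measurable

lemma Xi_herm: "Xi t (- k) = cnj (Xi t k)"
proof -
  have "N t (- k) = cnj (N t k)" unfolding NL_def by (intro nl_cnj herm)
  then show ?thesis unfolding Xi_def Q_def qsym_def parity herm by simp
qed

text \<open>The transform of the mixed derivative f_tx.\<close>

definition Wx :: "real \<Rightarrow> real \<Rightarrow> complex" where "Wx t k = \<i> * of_real k * \<Psi> t k"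

lemma Wx_herm: "Wx t (- k) = cnj (Wx t k)"
  unfolding Wx_def herm by simp

lemma Wx_integrable: "integrable lborel (Wx t)"
  unfolding Wx_def[abs_def] mult.assoc by (rule integrable_mult_right[OF integrable_decays_mult[OF decays_basic(2)]])

lemma cplx_phys:
  "cplx (phys \<Phi> t) = ift (\<Phi> t)" "cplx (phys \<Psi> t) = ift (\<Psi> t)"
  "cplx (phys Wx t) = ift (Wx t)" "cplx (phys Xi t) = ift (Xi t)"
  using inv_fourier_real[of "\<Phi> t"] inv_fourier_real[of "\<Psi> t"] inv_fourier_real[of "Wx t"] inv_fourier_real[of "Xi t"]
    herm Wx_herm Xi_herm unfolding cplx_def phys_def by auto

text \<open>The transforms of \<Lambda>f, \<Lambda>^3 f and \<Lambda>f_tx, the three constituents of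
  \<open>Q\<close>.\<close>

definition F1 :: "real \<Rightarrow> real \<Rightarrow> complex" where "F1 t k = of_real \<bar>k\<bar> * \<Phi> t k"
definition F3 :: "real \<Rightarrow> real \<Rightarrow> complex" where "F3 t k = of_real (\<bar>k\<bar> ^ 3) * \<Phi> t k"
definition FW :: "real \<Rightarrow> real \<Rightarrow> complex" where "FW t k = of_real \<bar>k\<bar> * (\<i> * of_real k) * \<Psi> t k"

lemma decays_F: "decays (27 * BB) (F1 t)" "decays (27 * BB) (F3 t)" "decays (27 * BB) (FW t)"
  unfolding F1_def[abs_def] F3_def[abs_def] FW_def[abs_def] by (rule decays_basic)+

lemma Q_eq: "Q t = (\<lambda>k. F1 t k + (of_real \<beta> * F3 t k - of_real \<alpha> * FW t k))"
  unfolding Q_def qsym_def F1_def F3_def FW_def om2_def aa_def by (simp add: fun_eq_iff algebra_simps)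

lemma multipliers:
  "Lam (ift (\<Phi> t)) = ift (F1 t)"
  "Lam_pow 3 (ift (\<Phi> t)) = ift (F3 t)"
  "Lam (ift (Wx t)) = ift (FW t)"
proof -
  show "Lam (ift (\<Phi> t)) = ift (F1 t)"
    unfolding Lam_def F1_def[abs_def] by (rule multiplier_inv_fourier[OF integrable_states(1)]) measurable
  have "Lam_pow 3 (ift (\<Phi> t)) = ift (\<lambda>k. of_real (\<bar>k\<bar> powr 3) * \<Phi> t k)"
    unfolding Lam_pow_def by (rule multiplier_inv_fourier[OF integrable_states(1)]) measurable
  then show "Lam_pow 3 (ift (\<Phi> t)) = ift (F3 t)"
    unfolding F3_def[abs_def] by (simp add: powr_numeral)
  have "Lam (ift (Wx t)) = ift (\<lambda>k. of_real \<bar>k\<bar> * Wx t k)"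
    unfolding Lam_def by (rule multiplier_inv_fourier[OF Wx_integrable]) measurable
  then show "Lam (ift (Wx t)) = ift (FW t)"
    unfolding FW_def[abs_def] Wx_def by (simp add: mult.assoc)
qed

text \<open>The transform of -H((H f_t)^2)_x.\<close>

definition A1 :: "real \<Rightarrow> real \<Rightarrow> complex" where
  "A1 t k = ic * (of_real \<bar>k\<bar> * conv (sg (\<Psi> t)) (sg (\<Psi> t)) k)"

lemma A1_integrable: "integrable lborel (A1 t)"
  unfolding A1_def[abs_def] by (intro integrable_mult_right integrable_abs_mult_conv[OF decays_sgn[OF decays_basic(2)] decays_sgn[OF decays_basic(2)]])

lemma flux1_deriv:
  "(flux1 (cplx (phys \<Phi> t)) (cplx (phys \<Psi> t)) has_vector_derivative
     (ift (A1 t) x + ift (dcomm (\<Phi> t) (F1 t)) x)) (at x)"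
  unfolding flux1_def cplx_phys multipliers A1_def[abs_def]
  by (intro has_vector_derivative_add hilbert_square_has_vector_derivative[OF decays_basic(2)]
      commutator_has_vector_derivative[OF decays_basic(1) decays_F(1)])

lemma flux2_deriv:
  "(flux2 \<alpha> \<beta> (cplx (phys \<Phi> t)) (cplx (phys Wx t)) has_vector_derivative
     (- of_real \<alpha> * ift (dcomm (\<Phi> t) (FW t)) x + of_real \<beta> * ift (dcomm (\<Phi> t) (F3 t)) x)) (at x)"
  unfolding flux2_def cplx_phys multipliers
  by (intro has_vector_derivative_add has_vector_derivative_mult_right
      commutator_has_vector_derivative[OF decays_basic(1) decays_F(2)] commutator_has_vector_derivative[OF decays_basic(1) decays_F(3)])

text \<open>\<open>Q\<close> occurs in \<open>Xi\<close> twice, as the linear part and inside the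
  commutator. Both times it splits into the same three pieces, and the inverse transform is linear
  because every piece is integrable.\<close>

lemma equation:
  "ift (Xi t) x =
    - ift (F1 t) x - of_real \<beta> * ift (F3 t) x + of_real \<alpha> * ift (FW t) x
    + of_real \<epsilon> * (ift (A1 t) x + ift (dcomm (\<Phi> t) (F1 t)) x)
    + of_real \<epsilon> * (- of_real \<alpha> * ift (dcomm (\<Phi> t) (FW t)) x + of_real \<beta> * ift (dcomm (\<Phi> t) (F3 t)) x)"
proof -
  define J where "J g = ift g x" for g
  note iF = decays_F[THEN integrable_decays, of t]
  note iD = decays_F[THEN integrable_dcomm[OF decays_basic(1)], of t t]
  have lin: "J (\<lambda>k. - (f1 k + (b * f3 k - a * fw k)) + e * (g k + (d1 k + (b * d3 k - a * dw k)))) =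
     - J f1 - b * J f3 + a * J fw + e * (J g + J d1) + e * (- a * J dw + b * J d3)"
    if i: "integrable lborel f1" "integrable lborel f3" "integrable lborel fw" "integrable lborel g" "integrable lborel d1" "integrable lborel d3" "integrable lborel dw"
    for f1 f3 fw g d1 d3 dw and a b e :: complex
  proof -
    have "(\<lambda>k. - (f1 k + (b * f3 k - a * fw k)) + e * (g k + (d1 k + (b * d3 k - a * dw k)))) =
      (\<lambda>k. (- 1 * f1 k + (- b * f3 k + a * fw k)) + (e * g k + (e * d1 k + (e * b * d3 k + - e * a * dw k))))"
      by (simp add: fun_eq_iff algebra_simps)
    moreover have "J (\<lambda>k. (- 1 * f1 k + (- b * f3 k + a * fw k)) + (e * g k + (e * d1 k + (e * b * d3 k + - e * a * dw k)))) =
      (- 1 * J f1 + (- b * J f3 + a * J fw)) + (e * J g + (e * J d1 + (e * b * J d3 + - e * a * J dw)))"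
      unfolding J_def by (simp only: inv_fourier_add inv_fourier_cmult i integrable_mult_right Bochner_Integration.integrable_add)
    ultimately show ?thesis by (simp add: algebra_simps)
  qed
  have "Xi t = (\<lambda>k. - (F1 t k + (of_real \<beta> * F3 t k - of_real \<alpha> * FW t k)) +
     of_real \<epsilon> * (A1 t k + (dcomm (\<Phi> t) (F1 t) k + (of_real \<beta> * dcomm (\<Phi> t) (F3 t) k - of_real \<alpha> * dcomm (\<Phi> t) (FW t) k))))"
    unfolding Xi_def N_eq Q_eq dcomm_combination[OF decays_basic(1) decays_F] A1_def ..
  then have "J (Xi t) = - J (F1 t) - of_real \<beta> * J (F3 t) + of_real \<alpha> * J (FW t) + of_real \<epsilon> * (J (A1 t) + J (dcomm (\<Phi> t) (F1 t)))
     + of_real \<epsilon> * (- of_real \<alpha> * J (dcomm (\<Phi> t) (FW t)) + of_real \<beta> * J (dcomm (\<Phi> t) (F3 t)))"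
    using lin[OF iF A1_integrable iD] by (simp only:)
  then show ?thesis unfolding J_def .
qed

lemma solution:
  assumes f0: "\<And>x. complex_of_real (f0 x) = ift \<Phi>0 x" and f1: "\<And>x. complex_of_real (f1 x) = ift \<Phi>1 x"
  shows "solves_ivp \<epsilon> \<alpha> \<beta> f0 f1 TT (phys \<Phi>) (phys \<Psi>)"
  unfolding solves_ivp_def
proof (intro conjI allI ballI)
  have z: "0 \<in> {0..TT}" using TT by simp
  have "\<Phi> 0 = \<Phi>0" "\<Psi> 0 = \<Phi>1"
    using mild[OF z] by (simp_all add: fun_eq_iff DP_def DV_def c1_def c2_def propagator_0)
  then show "phys \<Phi> 0 x = f0 x" "phys \<Psi> 0 x = f1 x" for x
    unfolding phys_def by (simp_all add: f0[symmetric] f1[symmetric])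
  show "((\<lambda>s. phys \<Phi> s x) has_real_derivative phys \<Psi> t x) (at t within {0..TT})" if t: "t \<in> {0..TT}" for t x
    unfolding phys_def
    by (intro has_real_derivative_Re inv_fourier_time_derivative[OF t integrable_states(1) states_measurable(2) \<Phi>_deriv state_le])
  show "\<exists>ftt ftx N1x N2x. \<forall>t\<in>{0..TT}. \<forall>x.
        ((\<lambda>s. phys \<Psi> s x) has_real_derivative ftt t x) (at t within {0..TT}) \<and>
        (phys \<Psi> t has_real_derivative ftx t x) (at x) \<and>
        (flux1 (cplx (phys \<Phi> t)) (cplx (phys \<Psi> t)) has_vector_derivative N1x t x) (at x) \<and>
        (flux2 \<alpha> \<beta> (cplx (phys \<Phi> t)) (cplx (ftx t)) has_vector_derivative N2x t x) (at x) \<and>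
        complex_of_real (ftt t x) =
          - Lam (cplx (phys \<Phi> t)) x - of_real \<beta> * Lam_pow 3 (cplx (phys \<Phi> t)) x
          + of_real \<alpha> * Lam (cplx (ftx t)) x
          + of_real \<epsilon> * N1x t x + of_real \<epsilon> * N2x t x"
  \<comment> \<open>The witnesses are fixed by the conjuncts below: f_tt is \<open>phys Xi\<close>,
    f_tx is \<open>phys Wx\<close>, and the flux derivatives are those of \<open>flux1_deriv\<close>
    and \<open>flux2_deriv\<close>.\<close>
  proof (intro exI ballI allI conjI)
    fix t x assume t: "t \<in> {0..TT}"
    show "((\<lambda>s. phys \<Psi> s x) has_real_derivative phys Xi t x) (at t within {0..TT})"
      unfolding phys_def
      by (intro has_real_derivative_Re inv_fourier_time_derivative[OF t integrable_states(2) Xi_measurable \<Psi>_deriv Xi_le])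
    show "(phys \<Psi> t has_real_derivative phys Wx t x) (at x)"
      unfolding phys_def[abs_def] Wx_def[abs_def]
      by (intro has_real_derivative_Re has_vector_derivative_inv_fourier integrable_states integrable_decays_mult[OF decays_basic(2)])
    show "(flux1 (cplx (phys \<Phi> t)) (cplx (phys \<Psi> t)) has_vector_derivative
       (ift (A1 t) x + ift (dcomm (\<Phi> t) (F1 t)) x)) (at x)" by (rule flux1_deriv)
    show "(flux2 \<alpha> \<beta> (cplx (phys \<Phi> t)) (cplx (phys Wx t)) has_vector_derivative
     (- of_real \<alpha> * ift (dcomm (\<Phi> t) (FW t)) x + of_real \<beta> * ift (dcomm (\<Phi> t) (F3 t)) x)) (at x)"
      by (rule flux2_deriv)
    have "complex_of_real (phys Xi t x) = ift (Xi t) x"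
      using fun_cong[OF cplx_phys(4)[of t], of x] by (simp add: cplx_def)
    then show "complex_of_real (phys Xi t x) =
          - Lam (cplx (phys \<Phi> t)) x - of_real \<beta> * Lam_pow 3 (cplx (phys \<Phi> t)) x
          + of_real \<alpha> * Lam (cplx (phys Wx t)) x
          + of_real \<epsilon> * (ift (A1 t) x + ift (dcomm (\<Phi> t) (F1 t)) x)
          + of_real \<epsilon> * (- of_real \<alpha> * ift (dcomm (\<Phi> t) (FW t)) x + of_real \<beta> * ift (dcomm (\<Phi> t) (F3 t)) x)"
      unfolding cplx_phys multipliers equation .
  qed
qed

lemma solution_regularity:
  "(\<lambda>t. cplx (phys \<Phi> t)) \<in> Linf_wiener TT 1 \<inter> C_wiener TT (1/2)"
  "(\<lambda>t. cplx (phys \<Psi> t)) \<in> Linf_wiener TT 1 \<inter> C_wiener TT (1/2)"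
  using regularity[OF cont(1) bnd(1) herm(1) solution_L1(1) TT(1)] regularity[OF cont(2) bnd(2) herm(2) solution_L1(2) TT(1)] by auto

end

text \<open>The assumption says that f is the inverse transform of its transform cut off to [-D, D].
  By the inversion theorem the transform equals this cutoff almost everywhere. Being continuous, it
  vanishes at every point outside the band, which is the form the fixed point argument uses.\<close>

lemma band_limited_data:
  fixes f :: "real \<Rightarrow> real"
  assumes f: "integrable lborel f"
    and inv: "\<And>x. complex_of_real (f x) = complex_of_real (1 / sqrt (2 * pi)) *
           (LINT k:{-D..D}|lborel. fourier (cplx f) k * exp (\<i> * of_real (k * x)))"
  defines "F \<equiv> fourier_integral (cplx f)"
  shows "integrable lborel (cplx f)" "continuous_on UNIV F" "norm (F k) \<le> 1 / sqrt (2 * pi) * (LINT x|lborel. \<bar>f x\<bar>)"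
    "\<bar>k\<bar> > D \<Longrightarrow> F k = 0" "F (- k) = cnj (F k)" "complex_of_real (f x) = ift F x"
proof -
  show ci: "integrable lborel (cplx f)" unfolding cplx_def using f by simp
  have fF: "fourier (cplx f) = F" unfolding F_def fourier_def using ci by simp
  show Fc: "continuous_on UNIV F" unfolding F_def fourier_integral_eq[abs_def]
    by (intro continuous_on_compose2[OF continuous_on_inv_fourier[OF ci, of UNIV]] continuous_intros) auto
  show "norm (F k) \<le> 1 / sqrt (2 * pi) * (LINT x|lborel. \<bar>f x\<bar>)"
    unfolding F_def fourier_integral_eq using norm_inv_fourier_le[OF ci, of "- k"] by (simp add: cplx_def)
  show "F (- k) = cnj (F k)"
  proof -
    have "cnj (LINT x|lborel. cplx f x * exp (- (\<i> * of_real (k * x)))) = (LINT x|lborel. cnj (cplx f x * exp (- (\<i> * of_real (k * x)))))"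
      by (rule Bochner_Integration.integral_cnj[symmetric])
    also have "\<dots> = (LINT x|lborel. cplx f x * exp (- (\<i> * of_real (- k * x))))"
      by (intro Bochner_Integration.integral_cong refl) (simp add: cplx_def exp_cnj)
    finally show ?thesis unfolding F_def fourier_integral_def by simp
  qed
  define g where "g k = indicator {-D..D} k *\<^sub>R F k" for k
  have gi: "integrable lborel g"
    using borel_integrable_atLeastAtMost'[OF continuous_on_subset[OF Fc subset_UNIV], of "-D" D] by (simp add: set_integrable_def g_def[abs_def])
  have cg: "cplx f = ift g"
  proof
    fix x
    have "cplx f x = complex_of_real (f x)" by (simp add: cplx_def)
    also note inv
    also have "complex_of_real (1 / sqrt (2 * pi)) * (LINT k:{-D..D}|lborel. fourier (cplx f) k * iexp (k * x)) = ift g x"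
      unfolding fF inv_fourier_integral_def set_lebesgue_integral_def g_def by simp
    finally show "cplx f x = ift g x" .
  qed
  have ae: "AE k in lborel. F k = g k"
    using fourier_inversion[OF gi] ci unfolding F_def cg by simp
  have "ift F = ift g"
    by (rule inv_fourier_cong_AE[OF ae]) (use gi Fc in \<open>auto intro: borel_measurable_continuous_onI\<close>)
  then show "complex_of_real (f x) = ift F x" using fun_cong[OF cg, of x] by (simp add: cplx_def)
  show "F k = 0" if k: "\<bar>k\<bar> > D"
  \<comment> \<open>A nonzero value outside the band persists on an open interval by continuity, and
    an interval is not a null set.\<close>
  proof (rule ccontr)
    assume Fk: "F k \<noteq> 0"
    have "open {k. D < \<bar>k\<bar> \<and> F k \<noteq> 0}"
      using Fc by (intro open_Collect_conj open_Collect_less open_Collect_neq continuous_intros)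
    moreover have "k \<in> {k. D < \<bar>k\<bar> \<and> F k \<noteq> 0}" using k Fk by simp
    ultimately obtain e where e: "e > 0" "ball k e \<subseteq> {k. D < \<bar>k\<bar> \<and> F k \<noteq> 0}"
      unfolding open_contains_ball by blast
    have "AE y in lborel. y \<notin> {k - e<..<k + e}"
      using ae
    proof eventually_elim
      case (elim y)
      show ?case
      proof
        assume "y \<in> {k - e<..<k + e}"
        then have "y \<in> ball k e" by (auto simp: dist_real_def)
        with e(2) have "D < \<bar>y\<bar>" "F y \<noteq> 0" by auto
        then have "y \<notin> {-D..D}" by auto
        with elim \<open>F y \<noteq> 0\<close> show False by (simp add: g_def)
      qed
    qed
    then have "{y. k - e < y \<and> y < k + e} \<in> null_sets lborel" by (subst (asm) AE_iff_null) auto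
    also have "{y. k - e < y \<and> y < k + e} = {k - e<..<k + e}" by auto
    finally have "{k - e<..<k + e} \<in> null_sets lborel" .
    then have "emeasure lborel {k - e<..<k + e} = 0" by auto
    with e(1) show False by simp
  qed
qed

theorem theorem1:
  fixes \<epsilon> \<alpha>\<^sub>o \<beta> D :: real and f\<^sub>0 f\<^sub>1 :: "real \<Rightarrow> real"
  assumes "\<epsilon> > 0" and "\<beta> \<ge> 0" and "\<alpha>\<^sub>o \<ge> 0"
    and "integrable lborel f\<^sub>0" and "integrable lborel f\<^sub>1"
    and "1 < D"
    and "\<And>x. complex_of_real (f\<^sub>0 x) = complex_of_real (1 / sqrt (2 * pi)) *
           (LINT k:{-D..D}|lborel. fourier (cplx f\<^sub>0) k * exp (\<i> * of_real (k * x)))"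
    and "\<And>x. complex_of_real (f\<^sub>1 x) = complex_of_real (1 / sqrt (2 * pi)) *
           (LINT k:{-D..D}|lborel. fourier (cplx f\<^sub>1) k * exp (\<i> * of_real (k * x)))"
  shows "\<exists>T>0. \<exists>f ft. solves_ivp \<epsilon> \<alpha>\<^sub>o \<beta> f\<^sub>0 f\<^sub>1 T f ft \<and>
           (\<lambda>t. cplx (f t)) \<in> Linf_wiener T 1 \<inter> C_wiener T (1/2) \<and>
           (\<lambda>t. cplx (ft t)) \<in> Linf_wiener T 1 \<inter> C_wiener T (1/2)"
proof -
  note d0 = band_limited_data[OF assms(4,7)] and d1 = band_limited_data[OF assms(5,8)]
  let ?I = "\<lambda>f. 1 / sqrt (2 * pi) * (LINT x|lborel. \<bar>f x :: real\<bar>)"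
  have I0: "?I f \<ge> 0" for f by simp
  \<comment> \<open>The sum of the two bounds serves as the common bound for both
    transforms.\<close>
  interpret wave_problem \<alpha>\<^sub>o \<beta> \<epsilon> D "?I f\<^sub>0 + ?I f\<^sub>1" "fourier_integral (cplx f\<^sub>0)" "fourier_integral (cplx f\<^sub>1)"
  proof unfold_locales
    show "norm (fourier_integral (cplx f\<^sub>0) k) \<le> ?I f\<^sub>0 + ?I f\<^sub>1" for k using d0(3)[of k] I0[of f\<^sub>1] by linarith
    show "norm (fourier_integral (cplx f\<^sub>1) k) \<le> ?I f\<^sub>0 + ?I f\<^sub>1" for k using d1(3)[of k] I0[of f\<^sub>0] by linarith
  qed (use assms(2,3,6) d0(2,4,5) d1(2,4,5) in auto)
  obtain \<Phi> \<Psi> where "wave_solution \<alpha>\<^sub>o \<beta> \<epsilon> D (?I f\<^sub>0 + ?I f\<^sub>1) (fourier_integral (cplx f\<^sub>0)) (fourier_integral (cplx f\<^sub>1)) \<Phi> \<Psi> (cplx f\<^sub>0) (cplx f\<^sub>1)"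
  proof (rule exists_mild_solution)
    fix \<Phi> \<Psi> assume *: "continuous_on UNIV (\<lambda>(t, k). \<Phi> t k)" "continuous_on UNIV (\<lambda>(t, k). \<Psi> t k)"
    "\<And>t. bounded_by BB 2 (\<Phi> t)" "\<And>t. bounded_by BB 2 (\<Psi> t)"
    "\<And>t k. \<Phi> t (- k) = cnj (\<Phi> t k)" "\<And>t k. \<Psi> t (- k) = cnj (\<Psi> t k)"
    "continuous_on UNIV (\<lambda>(t, k). NL \<Phi> \<Psi> t k)"
    "\<And>t k. t \<in> {0..TT} \<Longrightarrow> \<Phi> t k = DP \<Phi> \<Psi> t k" "\<And>t k. t \<in> {0..TT} \<Longrightarrow> \<Psi> t k = DV \<Phi> \<Psi> t k"
    show thesis by (rule that, unfold_locales) (fact * d0(1) d1(1) refl)+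
  qed
  then interpret wave_solution \<alpha>\<^sub>o \<beta> \<epsilon> D "?I f\<^sub>0 + ?I f\<^sub>1" "fourier_integral (cplx f\<^sub>0)" "fourier_integral (cplx f\<^sub>1)" \<Phi> \<Psi> "cplx f\<^sub>0" "cplx f\<^sub>1" .
  have "solves_ivp \<epsilon> \<alpha>\<^sub>o \<beta> f\<^sub>0 f\<^sub>1 TT (phys \<Phi>) (phys \<Psi>)"
    by (rule solution[OF d0(6) d1(6)])
  with TT(1) solution_regularity show ?thesis by blast
qed

end
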